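(* Let $X, Y$ be completely regular topological spaces. Let $\mu$ be a non-atomic Radon probability measure on $X$, let $\nu$ be a Radon probability measure on $Y$, and suppose that each of the measures $\mu$ and $\nu$ is concentrated on a countable union of metrizable compact sets. Let $T$ be a metric space and let $h \colon X \times Y \times T \to [0, \infty)$ be a continuous function; write $h_t(x,y)=h(x,y,t)$. Suppose that for every $t\in T$ there are functions $a_t \in L^1(\mu)$ and $b_t \in L^1(\nu)$ such that $h(x, y, t) \le a_t(x) + b_t(y)$ for all $x\in X$, $y\in Y$, $t\in T$, and $$ \lim_{R \to +\infty} \sup_{t \in T} \Bigl(\int_{\{a_t \ge R\}} a_t \, d\mu + \int_{\{b_t \ge R\}} b_t \, d\nu \Bigr) = 0. $$ Then for any $\varepsilon > 0$ one can select, for all $t\in T$, $\varepsilon$-optimal Monge mappings $T_t^{\varepsilon}\colon X\to Y$ for the cost functions $h_t$ and the measures $\mu,\nu$ (in particular $\mu\circ (T_t^{\varepsilon})^{-1}=\nu$ for every $t\in T$) such that $T_t^{\varepsilon}$ is continuous in $t$ in the sense of convergence $\mu$-a.e.: for every $t\in T$ and every sequence $t_n \to t$ in $T$, $T_{t_n}^{\varepsilon} \to T_t^{\varepsilon}$ $\mu$-a.e. as $n\to\infty$.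
   Context: A nonnegative Radon measure on a topological space $X$ is a bounded Borel measure $\mu\ge 0$ such that for every Borel set $B$ and every $\varepsilon>0$ there is a compact set $K\subset B$ with $\mu(B\setminus K)<\varepsilon$. A measure is concentrated on a set if the complement of this set has measure zero. For probability measures $\mu$ on $X$ and $\nu$ on $Y$, $\Pi(\mu,\nu)$ denotes the set of Borel probability measures $\sigma$ on $X\times Y$ with marginals $\mu$ and $\nu$, that is, $\sigma(A\times Y)=\mu(A)$ and $\sigma(X\times B)=\nu(B)$ for all Borel $A\subset X$, $B\subset Y$. For a nonnegative Borel cost function $h$ on $X\times Y$, the Kantorovich cost is $K_h(\mu,\nu)=\inf\{\int h\,d\sigma:\sigma\in\Pi(\mu,\nu)\}$. For a Borel mapping $S\colon X\to Y$, $(\mu\circ S^{-1})(B)=\mu(S^{-1}(B))$ for Borel sets $B\subset Y$. Given $\varepsilon>0$, an $\varepsilon$-optimal Monge mapping for the cost function $h$ and measures $\mu,\nu$ is a Borel mapping $S\colon X\to Y$ such that $\mu\circ S^{-1}=\nu$ and $\int_X h(x,S(x))\,\mu(dx)\le K_h(\mu,\nu)+\varepsilon$. *)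

theory Defs
  imports "HOL-Probability.Probability"
begin

text \<open>
  Topological spaces are types, and a Borel measure on such a space is a measure \<open>M\<close> with
  \<open>sets M = sets borel\<close>.  The Hausdorff property is not assumed anywhere, so compact sets need
  not be Borel.  Since \<^const>\<open>measure\<close> and \<^const>\<open>emeasure\<close> return \<open>0\<close> on non-measurable
  sets, the approximating compact set in the definition of a Radon measure is explicitly required
  to be Borel; in Hausdorff spaces this holds for every compact set.
\<close>

definition radon_measure :: "'a::topological_space measure \<Rightarrow> bool" where
  "radon_measure M \<longleftrightarrow>
     sets M = sets borel \<and> finite_measure M \<and>
     (\<forall>B\<in>sets M. \<forall>e>0. \<exists>K\<in>sets M. compact K \<and> K \<subseteq> B \<and> measure M (B - K) < e)"

text \<open>Every measurable set of positive measure has a measurable part of strictly smaller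
  positive measure.\<close>

definition nonatomic :: "'a measure \<Rightarrow> bool" where
  "nonatomic M \<longleftrightarrow>
     (\<forall>A\<in>sets M. 0 < emeasure M A \<longrightarrow>
        (\<exists>B\<in>sets M. B \<subseteq> A \<and> 0 < emeasure M B \<and> emeasure M B < emeasure M A))"

definition concentrated_on :: "'a measure \<Rightarrow> 'a set \<Rightarrow> bool" where
  "concentrated_on M A \<longleftrightarrow> space M - A \<in> null_sets M"

definition concentrated_on_metrizable_compacts :: "'a::topological_space measure \<Rightarrow> bool" where
  "concentrated_on_metrizable_compacts M \<longleftrightarrow>
     (\<exists>K :: nat \<Rightarrow> 'a set.
        (\<forall>n. compact (K n) \<and> metrizable_space (top_of_set (K n))) \<and>
        concentrated_on M (\<Union>n. K n))"

text \<open>The measures in \<open>couplings \<mu> \<nu>\<close> live on the Borel sigma-algebra of the product topology,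
  which can be larger than the product of the two Borel sigma-algebras.\<close>

definition couplings ::
  "'a::topological_space measure \<Rightarrow> 'b::topological_space measure \<Rightarrow> ('a \<times> 'b) measure set"
where
  "couplings \<mu> \<nu> =
     {\<sigma>. sets \<sigma> = sets borel \<and> prob_space \<sigma> \<and>
         (\<forall>A\<in>sets borel. emeasure \<sigma> (A \<times> UNIV) = emeasure \<mu> A) \<and>
         (\<forall>B\<in>sets borel. emeasure \<sigma> (UNIV \<times> B) = emeasure \<nu> B)}"

text \<open>The costs are nonnegative, so \<^const>\<open>ennreal\<close> does not truncate.\<close>

definition kantorovich_cost ::
  "('a::topological_space \<Rightarrow> 'b::topological_space \<Rightarrow> real) \<Rightarrow> 'a measure \<Rightarrow> 'b measure \<Rightarrow> ennreal"
where
  "kantorovich_cost h \<mu> \<nu> =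
     (INF \<sigma>\<in>couplings \<mu> \<nu>. \<integral>\<^sup>+z. ennreal (h (fst z) (snd z)) \<partial>\<sigma>)"

definition eps_optimal_monge ::
  "real \<Rightarrow> ('a::topological_space \<Rightarrow> 'b::topological_space \<Rightarrow> real) \<Rightarrow>
   'a measure \<Rightarrow> 'b measure \<Rightarrow> ('a \<Rightarrow> 'b) \<Rightarrow> bool"
where
  "eps_optimal_monge e h \<mu> \<nu> S \<longleftrightarrow>
     S \<in> borel \<rightarrow>\<^sub>M borel \<and>
     distr \<mu> borel S = \<nu> \<and>
     (\<integral>\<^sup>+x. ennreal (h x (S x)) \<partial>\<mu>) \<le> kantorovich_cost h \<mu> \<nu> + ennreal e"

end

theory Submission
  imports Defs
begin

text \<open>
  Everything is transported to the unit interval.  Let \<open>unif\<close> be Lebesgue measure on \<open>[0, 1)\<close>.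
  A measure that lives on countably many metrizable compact sets is the image of \<open>unif\<close> under a
  map \<open>\<xi>\<close> that is continuous on a set of full measure: the points are coded by reals with a
  decoder that is continuous on a Borel set (\<open>concentrated_code\<close>), and the decoder is composed
  with the quantile function of the law of the code.  In the other direction a point together with
  an independent uniform number yields a uniform coordinate of the point
  (\<open>interval_parametrization\<close>); if the measure has no atoms, the extra randomness is not needed
  and \<open>\<mu>\<close> itself carries a uniform coordinate.  So every coupling of \<open>\<mu>\<close> and \<open>\<nu>\<close> lifts to a
  coupling of \<open>unif\<close> with itself of the same cost (\<open>lift_coupling\<close>), and a measure-preserving map
  \<open>r\<close> of \<open>[0, 1)\<close> gives the Monge mapping that takes the coordinate of \<open>x\<close>, applies \<open>r\<close> and then
  the parametrization of \<open>Y\<close>.  Since that parametrization is continuous on a set of full measure,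
  almost everywhere convergence of the maps \<open>r\<close> carries over to the Monge mappings.

  On the interval, uniform integrability allows the costs to be truncated uniformly in \<open>t\<close> and in
  the coupling.  With continuity on large compact sets this gives two facts: the cost of a coupling
  is continuous in \<open>t\<close>, uniformly over all couplings (\<open>cost_equicontinuous\<close>), and for fixed \<open>t\<close>
  two couplings that give the same mass to all products of dyadic cells of a fine enough level have
  nearly the same cost (\<open>cost_same_cells\<close>).  By the second fact nearly optimal couplings can be
  taken with a density that is constant on products of dyadic cells, and countably many of these
  block plans suffice for all \<open>t\<close> at once (\<open>countable_block_family\<close>).  Weighting each of them
  by the amount by which its cost stays below the optimal cost plus a margin gives a mixture of
  block plans that depends continuously on \<open>t\<close> and is nearly optimal, because the cost is linear in
  the coupling.

  A mixture is turned into a map by using the fine position of \<open>v\<close> inside its cell as a random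
  number that selects where \<open>v\<close> is sent.  The maps \<open>level_coord l\<close> supply this number: restricted to
  a dyadic cell of level at most \<open>l\<close> they are uniformly distributed, so the map realizes the mixture
  up to the position inside the cells, and they depend continuously on the real parameter \<open>l\<close>.
  The real parameter is essential.  How fine the cells must be depends on \<open>t\<close>, and as \<open>T\<close> need not
  be compact no single level works; the level is therefore chosen as a continuous function of \<open>t\<close>
  (\<open>continuous_level_function\<close>), and the construction has to pass continuously from one dyadic
  level to the next (\<open>continuous_monge_selection\<close>).
\<close>

section \<open>Lebesgue measure on the unit interval and dyadic cells\<close>

definition unif :: "real measure" where
  "unif = density lborel (indicator {0..<1})"

lemma sets_unif [simp, measurable_cong]: "sets unif = sets borel"
  by (simp add: unif_def)

lemma space_unif [simp]: "space unif = UNIV"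
  by (simp add: unif_def)

lemma nn_integral_unif:
  "f \<in> borel_measurable borel \<Longrightarrow> (\<integral>\<^sup>+x. f x \<partial>unif) = (\<integral>\<^sup>+x. f x * indicator {0..<1} x \<partial>lborel)"
  unfolding unif_def by (subst nn_integral_density) (auto simp: mult.commute)

lemma prob_space_unif: "prob_space unif"
  by (rule prob_spaceI) (simp add: unif_def emeasure_density)

interpretation unif: prob_space unif by (rule prob_space_unif)

lemma AE_unif_Ico: "AE v in unif. v \<in> {0..<1}"
  unfolding unif_def by (subst AE_density) (auto simp: indicator_def)

lemma AE_unif_countable: "countable S \<Longrightarrow> AE v in unif. v \<notin> S"
  unfolding unif_def using AE_not_in[OF countable_imp_null_set_lborel]
  by (subst AE_density) fastforce+

lemma AE_unif_Ioo: "AE v in unif. v \<in> {0<..<1}"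
  using AE_unif_Ico AE_unif_countable[of "{0}"] by (auto elim: eventually_elim2)

lemma nn_integral_Ico_affine:
  fixes f :: "real \<Rightarrow> ennreal"
  assumes [measurable]: "f \<in> borel_measurable borel" and "a \<le> b"
  shows "(\<integral>\<^sup>+x. f x * indicator {a..<b} x \<partial>lborel) = ennreal (b - a) * (\<integral>\<^sup>+s. f (a + (b - a) * s) \<partial>unif)"
proof (cases "a = b")
  case False
  with assms have "a < b" by simp
  have *: "indicator {a..<b} (a + (b - a) * x) = (indicator {0..<1} x :: ennreal)" for x
  proof -
    have "(b - a) * x < b - a \<longleftrightarrow> x < 1"
      using \<open>a < b\<close> mult_less_cancel_left_pos[of "b - a" x 1] by simp
    moreover have "0 \<le> (b - a) * x \<longleftrightarrow> 0 \<le> x"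
      using \<open>a < b\<close> by (simp add: zero_le_mult_iff)
    ultimately show ?thesis
      by (simp add: indicator_def add.commute[of a] flip: less_diff_eq)
  qed
  have "(\<integral>\<^sup>+x. f x * indicator {a..<b} x \<partial>lborel)
     = ennreal \<bar>b - a\<bar> * (\<integral>\<^sup>+x. f (a + (b - a) * x) * indicator {a..<b} (a + (b - a) * x) \<partial>lborel)"
    using \<open>a < b\<close> by (intro nn_integral_real_affine) auto
  then show ?thesis
    using \<open>a < b\<close> by (simp add: * nn_integral_unif)
qed simp

lemma sum_indicator_blocks:
  assumes "N > 0"
  shows "(\<Sum>k<n. indicator {real k / N..<(real k + 1) / N} x) = (indicator {0..<real n / N} x :: ennreal)"
proof (induction n)
  case (Suc n)
  have "real n / N < (real n + 1) / N" "0 \<le> real n / N"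
    using assms by (auto simp: divide_strict_right_mono)
  then show ?case
    using Suc by (auto simp: indicator_def add.commute split: if_splits)
qed simp

lemma nn_integral_unif_blocks:
  fixes f :: "real \<Rightarrow> ennreal" and N :: nat
  assumes [measurable]: "f \<in> borel_measurable borel" and "N > 0"
  shows "(\<integral>\<^sup>+x. f x \<partial>unif) = (\<Sum>k<N. ennreal (1 / N) * (\<integral>\<^sup>+s. f ((real k + s) / N) \<partial>unif))"
proof -
  have ind: "indicator {0..<1} x = (\<Sum>k<N. indicator {real k / N..<(real k + 1) / N} x :: ennreal)" for x
    using sum_indicator_blocks[of "real N" x N] assms by simp
  have "(\<integral>\<^sup>+x. f x \<partial>unif) = (\<integral>\<^sup>+x. (\<Sum>k<N. f x * indicator {real k / N..<(real k + 1) / N} x) \<partial>lborel)"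
    by (simp add: nn_integral_unif ind sum_distrib_left)
  also have "\<dots> = (\<Sum>k<N. \<integral>\<^sup>+x. f x * indicator {real k / N..<(real k + 1) / N} x \<partial>lborel)"
    by (intro nn_integral_sum) auto
  also have "\<dots> = (\<Sum>k<N. ennreal (1 / N) * (\<integral>\<^sup>+s. f ((real k + s) / N) \<partial>unif))"
  proof (rule sum.cong)
    fix k assume "k \<in> {..<N}"
    have "(real k + 1) / N - real k / N = 1 / N"
      by (simp flip: diff_divide_distrib)
    moreover have "real k / N + (1 / N) * s = (real k + s) / N" for s
      by (simp add: add_divide_distrib)
    ultimately show "(\<integral>\<^sup>+x. f x * indicator {real k / N..<(real k + 1) / N} x \<partial>lborel)
        = ennreal (1 / N) * (\<integral>\<^sup>+s. f ((real k + s) / N) \<partial>unif)"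
      using nn_integral_Ico_affine[of f "real k / N" "(real k + 1) / N"] assms
      by (simp add: divide_right_mono)
  qed simp
  finally show ?thesis .
qed

definition cell :: "nat \<Rightarrow> real \<Rightarrow> nat" where
  "cell n v = nat \<lfloor>2 ^ n * v\<rfloor>"

lemma measurable_cell [measurable]: "cell n \<in> borel \<rightarrow>\<^sub>M count_space UNIV"
  unfolding cell_def by measurable

lemma cell_block: "0 \<le> s \<Longrightarrow> s < 1 \<Longrightarrow> cell n ((real k + s) / 2 ^ n) = k"
  by (simp add: cell_def floor_eq_iff nat_eq_iff)

lemma cell_less: "0 \<le> v \<Longrightarrow> v < 1 \<Longrightarrow> cell n v < 2 ^ n"
  by (auto simp: cell_def nat_less_iff floor_less_iff)

lemma nn_integral_unif_cells:
  fixes f :: "nat \<Rightarrow> real \<Rightarrow> ennreal"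
  assumes [measurable]: "\<And>k. f k \<in> borel_measurable borel"
  shows "(\<integral>\<^sup>+v. f (cell n v) v \<partial>unif)
     = (\<Sum>k<2^n. ennreal (1 / 2^n) * (\<integral>\<^sup>+s. f k ((real k + s) / 2^n) \<partial>unif))"
proof -
  have "(\<lambda>v. f (cell n v) v) \<in> borel_measurable borel"
    by (rule measurable_compose_countable'[where I=UNIV and g="cell n"]) auto
  from nn_integral_unif_blocks[OF this, of "2^n"]
  have "(\<integral>\<^sup>+v. f (cell n v) v \<partial>unif) = (\<Sum>k<2^n. ennreal (1 / 2^n) *
      (\<integral>\<^sup>+s. f (cell n ((real k + s) / 2^n)) ((real k + s) / 2^n) \<partial>unif))"
    by simp
  also have "\<dots> = (\<Sum>k<2^n. ennreal (1 / 2^n) * (\<integral>\<^sup>+s. f k ((real k + s) / 2^n) \<partial>unif))"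
    by (intro sum.cong refl arg_cong2[where f="(*)"] nn_integral_cong_AE eventually_mono[OF AE_unif_Ico])
       (auto simp: cell_block)
  finally show ?thesis .
qed

lemma cell_left_endpoint_nonneg:
  assumes "n \<le> m" "0 \<le> v"
  shows "cell n (real (cell m v) / 2 ^ m) = cell n v"
proof -
  let ?k = "\<lfloor>2 ^ m * v\<rfloor>"
  have k: "real (cell m v) = of_int ?k"
    using assms by (simp add: cell_def)
  have pw: "(2::real) ^ m = 2 ^ n * 2 ^ (m - n)"
    using assms by (simp flip: power_add)
  have "\<lfloor>2 ^ n * (real_of_int ?k / 2 ^ m)\<rfloor> = \<lfloor>real_of_int ?k / real_of_int (2 ^ (m - n))\<rfloor>"
    by (simp add: pw)
  also have "\<dots> = ?k div 2 ^ (m - n)"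
    by (rule floor_divide_of_int_eq)
  also have "\<dots> = \<lfloor>2 ^ m * v / real_of_int (2 ^ (m - n))\<rfloor>"
    using floor_divide_real_eq_div[of "2 ^ (m - n)" "2 ^ m * v"] by simp
  also have "2 ^ m * v / real_of_int (2 ^ (m - n)) = 2 ^ n * v"
    by (simp add: pw)
  finally show ?thesis
    unfolding k cell_def[of n] by simp
qed

text \<open>
  A function of \<open>v\<close> that depends only on cells of level at most \<open>m\<close> may be evaluated at the left
  endpoint of the level \<open>m\<close> cell of \<open>v\<close>, where it takes only countably many values as \<open>v\<close> varies.
\<close>

lemma cell_left_endpoint:
  assumes "n \<le> m"
  shows "cell n (real (cell m v) / 2 ^ m) = cell n v"
proof (cases "0 \<le> v")
  case False
  then have "cell k v = 0" for k
    using mult_pos_neg[of "2 ^ k" v] by (simp add: cell_def floor_le_iff)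
  then show ?thesis by (simp add: cell_def)
qed (use assms cell_left_endpoint_nonneg in auto)

text \<open>
  \<open>slide s\<close> for \<open>0 \<le> s \<le> 1\<close> joins the identity (\<open>s = 0\<close>) to the doubling map modulo 1 (\<open>s = 1\<close>)
  through measure-preserving maps of \<open>[0, 1)\<close>: it acts on \<open>[0, s)\<close> as the doubling map modulo \<open>s\<close>
  and fixes the rest.
\<close>

definition slide :: "real \<Rightarrow> real \<Rightarrow> real" where
  "slide s v = (if v < s / 2 then 2 * v else if v < s then 2 * v - s else v)"

lemma measurable_slide [measurable]: "slide s \<in> borel_measurable borel"
  unfolding slide_def by measurable

lemma slide_bounds: "0 \<le> s \<Longrightarrow> s \<le> 1 \<Longrightarrow> 0 \<le> v \<Longrightarrow> v < 1 \<Longrightarrow> 0 \<le> slide s v \<and> slide s v < 1"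
  by (auto simp: slide_def)

lemma nn_integral_slide:
  fixes g :: "real \<Rightarrow> ennreal"
  assumes [measurable]: "g \<in> borel_measurable borel" and s: "0 \<le> s" "s \<le> 1"
  shows "(\<integral>\<^sup>+v. g (slide s v) \<partial>unif) = (\<integral>\<^sup>+v. g v \<partial>unif)"
proof -
  have split: "g (slide s v) * indicator {0..<1} v
      = g (2 * v) * indicator {0..<s/2} v + g (2 * v - s) * indicator {s/2..<s} v + g v * indicator {s..<1} v" for v
    using s by (auto simp: slide_def indicator_def)
  have h1: "(\<integral>\<^sup>+v. g (2 * v) * indicator {0..<s/2} v \<partial>lborel) = ennreal (s/2) * (\<integral>\<^sup>+x. g (s * x) \<partial>unif)"
    using nn_integral_Ico_affine[of "\<lambda>v. g (2 * v)" 0 "s/2"] s by simp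
  have *: "2 * (s / 2 + (s - s / 2) * x) - s = s * x" for x
    by (simp add: algebra_simps)
  have h2: "(\<integral>\<^sup>+v. g (2 * v - s) * indicator {s/2..<s} v \<partial>lborel) = ennreal (s/2) * (\<integral>\<^sup>+x. g (s * x) \<partial>unif)"
    using nn_integral_Ico_affine[of "\<lambda>v. g (2 * v - s)" "s/2" s] s unfolding * by simp
  have h3: "(\<integral>\<^sup>+v. g v * indicator {0..<s} v \<partial>lborel) = ennreal s * (\<integral>\<^sup>+x. g (s * x) \<partial>unif)"
    using nn_integral_Ico_affine[of g 0 s] s by simp
  have half: "ennreal s = ennreal (s/2) + ennreal (s/2)"
    using s by (simp flip: ennreal_plus)
  have "(\<integral>\<^sup>+v. g (slide s v) \<partial>unif)
      = (\<integral>\<^sup>+v. g (2 * v) * indicator {0..<s/2} v \<partial>lborel) + (\<integral>\<^sup>+v. g (2 * v - s) * indicator {s/2..<s} v \<partial>lborel)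
        + (\<integral>\<^sup>+v. g v * indicator {s..<1} v \<partial>lborel)"
    by (simp add: nn_integral_unif split nn_integral_add)
  also have "\<dots> = (\<integral>\<^sup>+v. g v * indicator {0..<s} v \<partial>lborel) + (\<integral>\<^sup>+v. g v * indicator {s..<1} v \<partial>lborel)"
    by (simp add: h1 h2 h3 half distrib_right)
  also have "\<dots> = (\<integral>\<^sup>+v. g v * indicator {0..<s} v + g v * indicator {s..<1} v \<partial>lborel)"
    by (simp add: nn_integral_add)
  also have "(\<lambda>v. g v * indicator {0..<s} v + g v * indicator {s..<1} v) = (\<lambda>v. g v * indicator {0..<1} v)"
    using s by (auto simp: indicator_def)
  finally show ?thesis
    by (simp add: nn_integral_unif)
qed

text \<open>
  For an integer \<open>l = m\<close> this is the relative position of \<open>v\<close> in its dyadic cell of level \<open>m\<close>.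
  Doubling that position modulo 1 gives the position in the cell of level \<open>m + 1\<close>, and between the
  two integers \<open>slide\<close> interpolates.
\<close>

definition level_coord :: "real \<Rightarrow> real \<Rightarrow> real" where
  "level_coord l v = slide (frac l) (frac (2 ^ nat \<lfloor>l\<rfloor> * v))"

lemma measurable_level_coord [measurable]: "level_coord l \<in> borel_measurable borel"
  unfolding level_coord_def frac_def by measurable

lemma level_coord_bounds: "0 \<le> level_coord l v \<and> level_coord l v < 1"
  unfolding level_coord_def
  using slide_bounds[of "frac l" "frac (2 ^ nat \<lfloor>l\<rfloor> * v)"] by (simp add: frac_lt_1 less_imp_le)

text \<open>
  In law, the pair of the level \<open>m\<close> cell and \<open>level_coord l\<close> consists of independent components,
  the second one uniform: inside each cell the relative position is uniform, and \<open>slide\<close> preserves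
  the uniform law.
\<close>

lemma nn_integral_level_coord:
  fixes \<Phi> :: "nat \<Rightarrow> real \<Rightarrow> ennreal"
  assumes \<Phi>: "\<And>k. \<Phi> k \<in> borel_measurable borel" and "nat \<lfloor>l\<rfloor> = m"
  shows "(\<integral>\<^sup>+v. \<Phi> (cell m v) (level_coord l v) \<partial>unif) = (\<integral>\<^sup>+v. \<integral>\<^sup>+u. \<Phi> (cell m v) u \<partial>unif \<partial>unif)"
proof -
  note [measurable] = \<Phi>
  have fr: "frac (real k + s) = s" if "0 \<le> s" "s < 1" for s k
  proof -
    have "\<lfloor>real k + s\<rfloor> = int k" using that by (simp add: floor_eq_iff)
    then show ?thesis by (simp add: frac_def)
  qed
  have "(\<integral>\<^sup>+v. \<Phi> (cell m v) (level_coord l v) \<partial>unif)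
      = (\<Sum>k<2^m. ennreal (1 / (2^m)) * (\<integral>\<^sup>+s. \<Phi> k (level_coord l ((real k + s) / 2^m)) \<partial>unif))"
    by (rule nn_integral_unif_cells) simp
  also have "\<dots> = (\<Sum>k<2^m. ennreal (1 / (2^m)) * (\<integral>\<^sup>+s. \<Phi> k (slide (frac l) s) \<partial>unif))"
    by (intro sum.cong refl arg_cong2[where f="(*)"] nn_integral_cong_AE eventually_mono[OF AE_unif_Ico])
       (use assms(2) fr in \<open>simp add: level_coord_def\<close>)
  also have "\<dots> = (\<Sum>k<2^m. ennreal (1 / (2^m)) * (\<integral>\<^sup>+s. \<integral>\<^sup>+u. \<Phi> k u \<partial>unif \<partial>unif))"
    by (simp add: nn_integral_slide frac_lt_1 less_imp_le unif.emeasure_space_1[simplified])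
  also have "\<dots> = (\<integral>\<^sup>+v. \<integral>\<^sup>+u. \<Phi> (cell m v) u \<partial>unif \<partial>unif)"
    by (rule nn_integral_unif_cells[symmetric]) simp
  finally show ?thesis .
qed

lemma isCont_slide:
  assumes "y \<noteq> s / 2" "y \<noteq> s"
  shows "isCont (\<lambda>s. slide s y) s"
proof -
  have ev: "\<forall>\<^sub>F s' in nhds s. slide s' y = (if y < s / 2 then 2 * y else if y < s then 2 * y - s' else y)"
  proof -
    have o: "\<forall>\<^sub>F s' in nhds s. (y < s' / 2 \<longleftrightarrow> y < s / 2) \<and> (y < s' \<longleftrightarrow> y < s)"
    proof (intro eventually_conj)
      show "\<forall>\<^sub>F s' in nhds s. (y < s' / 2 \<longleftrightarrow> y < s / 2)"
      proof (cases "y < s / 2")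
        case True
        then have "\<forall>\<^sub>F s' in nhds s. s' > 2 * y"
          using eventually_nhds_in_open[of "{2*y<..}" s] by simp
        then show ?thesis by (rule eventually_mono) (use True in auto)
      next
        case False
        then have "\<forall>\<^sub>F s' in nhds s. s' < 2 * y"
          using assms eventually_nhds_in_open[of "{..<2*y}" s] by simp
        then show ?thesis by (rule eventually_mono) (use False in auto)
      qed
      show "\<forall>\<^sub>F s' in nhds s. (y < s' \<longleftrightarrow> y < s)"
      proof (cases "y < s")
        case True
        then have "\<forall>\<^sub>F s' in nhds s. s' > y"
          using eventually_nhds_in_open[of "{y<..}" s] by simp
        then show ?thesis by (rule eventually_mono) (use True in auto)
      next
        case False
        then have "\<forall>\<^sub>F s' in nhds s. s' < y"
          using assms eventually_nhds_in_open[of "{..<y}" s] by simp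
        then show ?thesis by (rule eventually_mono) (use False in auto)
      qed
    qed
    then show ?thesis
      by eventually_elim (auto simp: slide_def)
  qed
  show ?thesis
    unfolding isCont_cong[OF ev]
    by (cases "y < s / 2"; cases "y < s") (simp_all add: continuous_intros)
qed

lemma countable_frac_eq: "countable {v. frac (2 ^ m * v) = (c::real)}"
proof (rule countable_subset)
  show "{v. frac (2 ^ m * v) = c} \<subseteq> range (\<lambda>k::int. (of_int k + c) / 2 ^ m)"
  proof
    fix v assume "v \<in> {v. frac (2 ^ m * v) = c}"
    then have "v = (of_int \<lfloor>2 ^ m * v\<rfloor> + c) / 2 ^ m"
      by (simp add: frac_def field_simps)
    then show "v \<in> range (\<lambda>k::int. (of_int k + c) / 2 ^ m)" by blast
  qed
qed auto

text \<open>
  Continuity in the level can fail only where a breakpoint of \<open>slide\<close> passes through the relative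
  position of \<open>v\<close>, which happens for countably many \<open>v\<close>.  At an integer level the two one-sided
  limits agree because \<open>slide 1\<close> is the doubling map.
\<close>

lemma isCont_level_coord:
  assumes "l \<ge> 1"
  shows "AE v in unif. isCont (\<lambda>l. level_coord l v) l"
proof (cases "frac l = 0")
  case False
  define m where "m = \<lfloor>l\<rfloor>"
  define S where "S = {v. frac (2 ^ nat m * v) = frac l / 2} \<union> {v. frac (2 ^ nat m * v) = frac l}"
  have "countable S"
    unfolding S_def by (intro countable_Un countable_frac_eq)
  then have "AE v in unif. v \<notin> S" by (rule AE_unif_countable)
  then show ?thesis
  proof eventually_elim
    case (elim v)
    have m: "of_int m < l" "l < of_int m + 1"
      using False frac_ge_0[of l] frac_lt_1[of l] unfolding frac_def m_def by linarith+
    then have "\<forall>\<^sub>F l' in nhds l. l' \<in> {of_int m<..<of_int m + 1}"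
      by (intro eventually_nhds_in_open) auto
    then have ev: "\<forall>\<^sub>F l' in nhds l. level_coord l' v = slide (l' - of_int m) (frac (2 ^ nat m * v))"
    proof eventually_elim
      case (elim l')
      then have "\<lfloor>l'\<rfloor> = m" by (simp add: floor_eq_iff)
      then show ?case by (simp add: level_coord_def frac_def)
    qed
    have "isCont (\<lambda>s. slide s (frac (2 ^ nat m * v))) (l - of_int m)"
      using elim by (intro isCont_slide) (auto simp: S_def frac_def m_def)
    then have "isCont (\<lambda>l'. slide (l' - of_int m) (frac (2 ^ nat m * v))) l"
      by (rule isCont_o2[of l "\<lambda>l'. l' - of_int m", rotated]) (intro continuous_intros)
    then show ?case
      unfolding isCont_cong[OF ev] .
  qed
next
  case True
  then obtain m :: nat where l: "l = real (Suc m)"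
  proof -
    have "l = of_int \<lfloor>l\<rfloor>" using True by (simp add: frac_def)
    moreover have "\<lfloor>l\<rfloor> \<ge> 1" using assms by simp
    ultimately have "l = real (Suc (nat (\<lfloor>l\<rfloor> - 1)))"
      by simp
    then show thesis using that by blast
  qed
  \<comment> \<open>on the right the breakpoints are near 0, on the left near 1/2 and 1\<close>
  define S where "S = {v::real. frac (2 ^ Suc m * v) = 0} \<union> {v. frac (2 ^ m * v) = 1/2}"
  have "countable S"
    unfolding S_def by (intro countable_Un countable_frac_eq)
  then have "AE v in unif. v \<notin> S" by (rule AE_unif_countable)
  then show ?thesis
  proof eventually_elim
    case (elim v)
    define x where "x = frac (2 ^ m * v)"
    define y where "y = frac (2 ^ Suc m * v)"
    have y: "0 < y" "y < 1" and x: "0 \<le> x" "x < 1" "x \<noteq> 1/2"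
      using elim frac_ge_0[of "2 ^ Suc m * v"] by (auto simp: S_def y_def x_def frac_lt_1)
    have yx: "y = slide 1 x"
    proof -
      have y': "y = frac (2 * (2 ^ m * v))" by (simp add: y_def mult.assoc)
      define z where "z = \<lfloor>2 ^ m * v\<rfloor>"
      have z: "2 ^ m * v = of_int z + x" by (simp add: x_def frac_def z_def)
      show ?thesis
      proof (cases "x < 1/2")
        case True
        then have "\<lfloor>2 * (of_int z + x)\<rfloor> = 2 * z" using x unfolding floor_eq_iff by simp
        then show ?thesis using True by (simp add: y' z slide_def frac_def)
      next
        case False
        then have "\<lfloor>2 * (of_int z + x)\<rfloor> = 2 * z + 1" using x unfolding floor_eq_iff by simp
        then show ?thesis using False x by (simp add: y' z slide_def frac_def)
      qed
    qed
    have lc: "level_coord l v = y"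
    proof -
      have "\<lfloor>real (Suc m)\<rfloor> = int (Suc m)" by (simp only: floor_of_nat)
      then have "level_coord l v = slide 0 y"
        unfolding level_coord_def frac_def y_def l by (simp only: nat_int) simp
      then show ?thesis using y by (simp add: slide_def)
    qed
    have "\<forall>\<^sub>F l' in at_right l. l' \<in> {l<..<l + y}"
      using y by (intro eventually_at_right_real) auto
    then have "\<forall>\<^sub>F l' in at_right l. y = level_coord l' v"
    proof eventually_elim
      case (elim l')
      then have fl: "\<lfloor>l'\<rfloor> = int (Suc m)" using y by (simp add: floor_eq_iff l)
      have "level_coord l' v = slide (l' - l) y"
        unfolding level_coord_def fl frac_def[of l'] nat_int y_def l by simp
      also have "\<dots> = y" using elim by (auto simp: slide_def)
      finally show ?case ..
    qed
    then have r: "((\<lambda>l. level_coord l v) \<longlongrightarrow> y) (at_right l)"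
      by (rule Lim_transform_eventually[OF tendsto_const])
    have "\<forall>\<^sub>F l' in at_left l. l' \<in> {l - 1<..<l}"
      by (intro eventually_at_left_real) auto
    then have ev: "\<forall>\<^sub>F l' in at_left l. slide (l' - real m) x = level_coord l' v"
    proof eventually_elim
      case (elim l')
      then have fl: "\<lfloor>l'\<rfloor> = int m" by (simp add: floor_eq_iff l)
      show ?case
        unfolding level_coord_def fl frac_def[of l'] nat_int x_def l by simp
    qed
    have "isCont (\<lambda>s. slide s x) 1"
      using x by (intro isCont_slide) auto
    then have "isCont (\<lambda>l'. slide (l' - real m) x) l"
      using isCont_o2[of l "\<lambda>l'. l' - real m" "\<lambda>s. slide s x"] by (simp add: l)
    then have "((\<lambda>l'. slide (l' - real m) x) \<longlongrightarrow> slide 1 x) (at_left l)"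
      unfolding isCont_def by (auto simp: l filterlim_at_split)
    then have "((\<lambda>l. level_coord l v) \<longlongrightarrow> y) (at_left l)"
      unfolding yx by (rule Lim_transform_eventually[OF _ ev])
    with r show ?case
      unfolding isCont_def lc by (simp add: filterlim_at_split)
  qed
qed

section \<open>Splitting the unit interval according to weights\<close>

text \<open>
  Weights \<open>p\<close> with total mass 1 split \<open>[0, 1)\<close> into consecutive intervals of lengths \<open>p 0\<close>, \<open>p 1\<close>,
  and so on; \<open>pick\<close> is the index of the interval that contains \<open>u\<close>, and \<open>rescaled\<close> is the relative
  position of \<open>u\<close> in it.
\<close>

definition cumul :: "(nat \<Rightarrow> real) \<Rightarrow> nat \<Rightarrow> real" where
  "cumul p i = (\<Sum>j<i. p j)"

definition pick :: "(nat \<Rightarrow> real) \<Rightarrow> real \<Rightarrow> nat" where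
  "pick p u = (LEAST i. u < cumul p (Suc i))"

definition rescaled :: "(nat \<Rightarrow> real) \<Rightarrow> real \<Rightarrow> real" where
  "rescaled p u = (u - cumul p (pick p u)) / p (pick p u)"

lemma measurable_pick [measurable]: "pick p \<in> borel \<rightarrow>\<^sub>M count_space UNIV"
  unfolding pick_def by measurable

lemma measurable_rescaled [measurable]: "rescaled p \<in> borel_measurable borel"
  unfolding rescaled_def
  by (rule measurable_compose_countable'[where I=UNIV and g="pick p"]) auto

locale weights =
  fixes p :: "nat \<Rightarrow> real"
  assumes p_nonneg: "\<And>i. 0 \<le> p i" and p_sums: "p sums 1"
begin

lemma cumul_Suc: "cumul p (Suc i) = cumul p i + p i"
  by (simp add: cumul_def)

lemma cumul_mono: "i \<le> j \<Longrightarrow> cumul p i \<le> cumul p j"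
  unfolding cumul_def by (intro sum_mono2) (auto simp: p_nonneg)

lemma cumul_le_1: "cumul p i \<le> 1"
  unfolding cumul_def using p_sums
  by (metis p_nonneg sum_le_suminf[of p "{..<i}"] sums_summable sums_unique finite_lessThan)

lemma cumul_nonneg: "0 \<le> cumul p i"
  unfolding cumul_def by (intro sum_nonneg) (auto simp: p_nonneg)

lemma cumul_tendsto: "cumul p \<longlonglongrightarrow> 1"
  using p_sums unfolding sums_def cumul_def[abs_def] .

lemma pick_eq:
  assumes "cumul p i \<le> u" "u < cumul p (Suc i)"
  shows "pick p u = i"
  unfolding pick_def
proof (rule Least_equality)
  fix j assume "u < cumul p (Suc j)"
  then show "i \<le> j" using assms cumul_mono[of "Suc j" i] by (cases "i \<le> j") auto
qed (rule assms)

lemma pick_bounds: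
  assumes "0 \<le> u" "u < 1"
  shows "cumul p (pick p u) \<le> u" "u < cumul p (Suc (pick p u))"
proof -
  obtain k where "u < cumul p k"
    using order_tendstoD(1)[OF cumul_tendsto assms(2)] by (auto simp: eventually_sequentially)
  then have ex: "\<exists>i. u < cumul p (Suc i)"
    using cumul_mono[of k "Suc k"] by (intro exI[of _ k]) auto
  then show "u < cumul p (Suc (pick p u))"
    unfolding pick_def by (rule LeastI_ex)
  show "cumul p (pick p u) \<le> u"
  proof (cases "pick p u")
    case 0
    then show ?thesis using assms by (simp add: cumul_def)
  next
    case (Suc k)
    then have "\<not> u < cumul p (Suc k)"
      unfolding pick_def using not_less_Least[of k "\<lambda>i. u < cumul p (Suc i)"] by simp
    then show ?thesis using Suc by simp
  qed
qed

text \<open>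
  A uniform number thus produces an index with law \<open>p\<close> and an independent uniform number.
\<close>

lemma nn_integral_pick:
  fixes \<Phi> :: "nat \<Rightarrow> real \<Rightarrow> ennreal"
  assumes [measurable]: "\<And>i. \<Phi> i \<in> borel_measurable borel"
  shows "(\<integral>\<^sup>+u. \<Phi> (pick p u) (rescaled p u) \<partial>unif) = (\<Sum>i. ennreal (p i) * (\<integral>\<^sup>+s. \<Phi> i s \<partial>unif))"
proof -
  have m: "(\<lambda>u. \<Phi> (pick p u) (rescaled p u)) \<in> borel_measurable borel"
    by (rule measurable_compose_countable'[where I=UNIV and g="pick p"]) auto
  have dec: "\<Phi> (pick p u) (rescaled p u) * indicator {0..<1} u
     = (\<Sum>i. \<Phi> i ((u - cumul p i) / p i) * indicator {cumul p i..<cumul p (Suc i)} u)" for u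
  proof (cases "0 \<le> u \<and> u < 1")
    case True
    then have b: "cumul p (pick p u) \<le> u" "u < cumul p (Suc (pick p u))" using pick_bounds by auto
    have "(\<Sum>i. \<Phi> i ((u - cumul p i) / p i) * indicator {cumul p i..<cumul p (Suc i)} u)
       = (\<Sum>i\<in>{pick p u}. \<Phi> i ((u - cumul p i) / p i) * indicator {cumul p i..<cumul p (Suc i)} u)"
      by (intro suminf_finite) (auto simp: indicator_def dest: pick_eq)
    then show ?thesis using True b by (simp add: rescaled_def)
  next
    case False
    then have "u \<notin> {cumul p i..<cumul p (Suc i)}" for i
      using cumul_nonneg[of i] cumul_le_1[of "Suc i"] by auto
    then show ?thesis using False by simp
  qed
  have "(\<integral>\<^sup>+u. \<Phi> (pick p u) (rescaled p u) \<partial>unif)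
     = (\<integral>\<^sup>+u. (\<Sum>i. \<Phi> i ((u - cumul p i) / p i) * indicator {cumul p i..<cumul p (Suc i)} u) \<partial>lborel)"
    by (simp add: nn_integral_unif m dec)
  also have "\<dots> = (\<Sum>i. \<integral>\<^sup>+u. \<Phi> i ((u - cumul p i) / p i) * indicator {cumul p i..<cumul p (Suc i)} u \<partial>lborel)"
    by (intro nn_integral_suminf) measurable
  also have "\<dots> = (\<Sum>i. ennreal (p i) * (\<integral>\<^sup>+s. \<Phi> i s \<partial>unif))"
  proof (rule suminf_cong)
    fix i
    show "(\<integral>\<^sup>+u. \<Phi> i ((u - cumul p i) / p i) * indicator {cumul p i..<cumul p (Suc i)} u \<partial>lborel)
        = ennreal (p i) * (\<integral>\<^sup>+s. \<Phi> i s \<partial>unif)"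
      using nn_integral_Ico_affine[of "\<lambda>u. \<Phi> i ((u - cumul p i) / p i)" "cumul p i" "cumul p (Suc i)"] p_nonneg[of i]
      by (cases "p i = 0") (simp_all add: cumul_Suc)
  qed
  finally show ?thesis .
qed

end

section \<open>Couplings of the unit interval with itself\<close>

text \<open>
  Rows and columns are indexed by the \<open>2 ^ n\<close> dyadic cells of level \<open>n\<close>.
\<close>

definition doubly_stochastic :: "nat \<Rightarrow> (nat \<Rightarrow> nat \<Rightarrow> real) \<Rightarrow> bool" where
  "doubly_stochastic n D \<longleftrightarrow>
     (\<forall>k<2^n. \<forall>l<2^n. 0 \<le> D k l) \<and>
     (\<forall>k<2^n. (\<Sum>l<2^n. D k l) = 1) \<and> (\<forall>l<2^n. (\<Sum>k<2^n. D k l) = 1)"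

definition couplings01 :: "(real \<times> real) measure set" where
  "couplings01 = {\<gamma>. sets \<gamma> = sets borel \<and> distr \<gamma> borel fst = unif \<and> distr \<gamma> borel snd = unif}"

lemma borel_fst [measurable]: "fst \<in> (borel :: ('a::topological_space \<times> 'b::topological_space) measure) \<rightarrow>\<^sub>M borel"
  and borel_snd [measurable]: "snd \<in> (borel :: ('a::topological_space \<times> 'b::topological_space) measure) \<rightarrow>\<^sub>M borel"
  by (intro borel_measurable_continuous_onI continuous_intros)+

lemma couplings01_sets: "\<gamma> \<in> couplings01 \<Longrightarrow> sets \<gamma> = sets borel"
  by (simp add: couplings01_def)

lemma couplings01_fst:
  assumes "\<gamma> \<in> couplings01" and [measurable]: "f \<in> borel_measurable borel"
  shows "(\<integral>\<^sup>+z. f (fst z) \<partial>\<gamma>) = (\<integral>\<^sup>+v. f v \<partial>unif)"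
proof -
  note [measurable_cong] = couplings01_sets[OF assms(1)]
  have "(\<integral>\<^sup>+v. f v \<partial>unif) = (\<integral>\<^sup>+v. f v \<partial>distr \<gamma> borel fst)"
    using assms(1) by (simp add: couplings01_def)
  also have "\<dots> = (\<integral>\<^sup>+z. f (fst z) \<partial>\<gamma>)"
    by (intro nn_integral_distr) auto
  finally show ?thesis ..
qed

lemma couplings01_snd:
  assumes "\<gamma> \<in> couplings01" and [measurable]: "f \<in> borel_measurable borel"
  shows "(\<integral>\<^sup>+z. f (snd z) \<partial>\<gamma>) = (\<integral>\<^sup>+v. f v \<partial>unif)"
proof -
  note [measurable_cong] = couplings01_sets[OF assms(1)]
  have "(\<integral>\<^sup>+v. f v \<partial>unif) = (\<integral>\<^sup>+v. f v \<partial>distr \<gamma> borel snd)"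
    using assms(1) by (simp add: couplings01_def)
  also have "\<dots> = (\<integral>\<^sup>+z. f (snd z) \<partial>\<gamma>)"
    by (intro nn_integral_distr) auto
  finally show ?thesis ..
qed

lemma distr_eq_unifI:
  assumes g: "g \<in> M \<rightarrow>\<^sub>M borel"
    and eq: "\<And>f. f \<in> borel_measurable borel \<Longrightarrow> (\<integral>\<^sup>+z. f (g z) \<partial>M) = (\<integral>\<^sup>+v. f v \<partial>unif)"
  shows "distr M borel g = unif"
proof (rule measure_eqI)
  fix S :: "real set" assume "S \<in> sets (distr M borel g)"
  then have [measurable]: "S \<in> sets borel" by simp
  have "emeasure (distr M borel g) S = (\<integral>\<^sup>+v. indicator S v \<partial>distr M borel g)" by simp
  also have "\<dots> = (\<integral>\<^sup>+z. indicator S (g z) \<partial>M)" by (rule nn_integral_distr[OF g]) simp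
  also have "\<dots> = emeasure unif S" using eq[of "indicator S"] by simp
  finally show "emeasure (distr M borel g) S = emeasure unif S" .
qed simp

lemma couplings01I:
  assumes s: "sets \<gamma> = sets borel"
    and f: "\<And>f. f \<in> borel_measurable borel \<Longrightarrow> (\<integral>\<^sup>+z. f (fst z) \<partial>\<gamma>) = (\<integral>\<^sup>+v. f v \<partial>unif)"
    and g: "\<And>f. f \<in> borel_measurable borel \<Longrightarrow> (\<integral>\<^sup>+z. f (snd z) \<partial>\<gamma>) = (\<integral>\<^sup>+v. f v \<partial>unif)"
  shows "\<gamma> \<in> couplings01"
proof -
  note [measurable_cong] = s
  have fst_m: "fst \<in> \<gamma> \<rightarrow>\<^sub>M (borel :: real measure)" and snd_m: "snd \<in> \<gamma> \<rightarrow>\<^sub>M (borel :: real measure)"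
    by auto
  have "distr \<gamma> borel fst = unif" "distr \<gamma> borel snd = unif"
    using distr_eq_unifI[OF fst_m f] distr_eq_unifI[OF snd_m g] by auto
  with s show ?thesis
    unfolding couplings01_def by blast
qed

text \<open>
  Given \<open>v\<close>, the second component falls into cell \<open>l\<close> with probability \<open>D (cell n v) l\<close> and is
  uniform there; the factor \<open>2 ^ n\<close> is the inverse length of a cell.
\<close>

definition block_density :: "nat \<Rightarrow> (nat \<Rightarrow> nat \<Rightarrow> real) \<Rightarrow> real \<Rightarrow> real \<Rightarrow> ennreal" where
  "block_density n D v w = ennreal (2 ^ n * D (cell n v) (cell n w))"

lemma measurable_block_density [measurable]:
  "(\<lambda>z. block_density n D (fst z) (snd z)) \<in> borel_measurable borel"
  "(\<lambda>w. block_density n D v w) \<in> borel_measurable borel"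
proof -
  have c: "(\<lambda>z::real\<times>real. cell n (fst z)) \<in> borel \<rightarrow>\<^sub>M count_space UNIV"
      "(\<lambda>z::real\<times>real. cell n (snd z)) \<in> borel \<rightarrow>\<^sub>M count_space UNIV"
    by simp_all
  show "(\<lambda>z. block_density n D (fst z) (snd z)) \<in> borel_measurable borel"
    unfolding block_density_def
    by (rule measurable_compose_countable'[OF _ c(1)], rule measurable_compose_countable'[OF _ c(2)]) auto
  show "(\<lambda>w. block_density n D v w) \<in> borel_measurable borel"
    unfolding block_density_def
    by (rule measurable_compose_countable'[where g="cell n" and I=UNIV]) auto
qed

lemma nn_integral_block_density:
  fixes f :: "real \<Rightarrow> ennreal"
  assumes [measurable]: "f \<in> borel_measurable borel" 
  shows "(\<integral>\<^sup>+w. f w * block_density n D v w \<partial>unif)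
     = (\<Sum>l<2^n. ennreal (D (cell n v) l) * (\<integral>\<^sup>+s. f ((real l + s) / 2^n) \<partial>unif))"
proof -
  have "(\<integral>\<^sup>+w. f w * block_density n D v w \<partial>unif)
     = (\<Sum>l<2^n. ennreal (1 / 2^n) * (\<integral>\<^sup>+s. f ((real l + s) / 2^n) * ennreal (2^n * D (cell n v) l) \<partial>unif))"
    unfolding block_density_def
    by (rule nn_integral_unif_cells[of "\<lambda>l w. f w * ennreal (2^n * D (cell n v) l)"]) simp
  also have "\<dots> = (\<Sum>l<2^n. ennreal (D (cell n v) l) * (\<integral>\<^sup>+s. f ((real l + s) / 2^n) \<partial>unif))"
  proof (intro sum.cong refl)
    fix l
    have "ennreal (1 / 2^n) * (X * ennreal (2^n * d)) = ennreal d * X" for X d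
    proof -
      have "ennreal (1 / 2^n) * ennreal (2^n * d) = ennreal d"
        by (simp flip: ennreal_mult')
      then show ?thesis by (metis mult.assoc mult.commute)
    qed
    then show "ennreal (1 / 2^n) * (\<integral>\<^sup>+s. f ((real l + s) / 2^n) * ennreal (2^n * D (cell n v) l) \<partial>unif)
      = ennreal (D (cell n v) l) * (\<integral>\<^sup>+s. f ((real l + s) / 2^n) \<partial>unif)"
      by (simp add: nn_integral_multc)
  qed
  finally show ?thesis .
qed

definition block_plan :: "nat \<Rightarrow> (nat \<Rightarrow> nat \<Rightarrow> real) \<Rightarrow> (real \<times> real) measure" where
  "block_plan n D = density (unif \<Otimes>\<^sub>M unif) (\<lambda>z. block_density n D (fst z) (snd z))"

lemma sets_unif_pair: "sets (unif \<Otimes>\<^sub>M unif) = sets (borel :: (real\<times>real) measure)"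
proof -
  have "sets (unif \<Otimes>\<^sub>M unif) = sets (borel \<Otimes>\<^sub>M (borel :: real measure))"
    by (rule sets_pair_measure_cong) auto
  then show ?thesis unfolding borel_prod .
qed

lemma nn_integral_pair_density:
  fixes F d :: "real \<times> real \<Rightarrow> ennreal"
  assumes F: "F \<in> borel_measurable borel" and d: "d \<in> borel_measurable borel"
  shows "(\<integral>\<^sup>+z. F z \<partial>density (unif \<Otimes>\<^sub>M unif) d) = (\<integral>\<^sup>+v. \<integral>\<^sup>+w. F (v, w) * d (v, w) \<partial>unif \<partial>unif)"
proof -
  note [measurable_cong] = sets_unif_pair
  have [measurable]: "F \<in> borel_measurable (unif \<Otimes>\<^sub>M unif)" "d \<in> borel_measurable (unif \<Otimes>\<^sub>M unif)"
    using F d by (auto simp: measurable_cong_sets[OF sets_unif_pair refl])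
  show ?thesis
    by (subst nn_integral_density) (simp_all add: unif.nn_integral_fst[symmetric] mult.commute)
qed

lemma nn_integral_block_plan:
  assumes "F \<in> borel_measurable borel"
  shows "(\<integral>\<^sup>+z. F z \<partial>block_plan n D) = (\<integral>\<^sup>+v. \<integral>\<^sup>+w. F (v, w) * block_density n D v w \<partial>unif \<partial>unif)"
  unfolding block_plan_def using assms by (subst nn_integral_pair_density) auto

lemma doubly_stochastic_sum_ennreal:
  assumes "doubly_stochastic n D" "k < 2^n"
  shows "(\<Sum>l<2^n. ennreal (D k l)) = 1" "(\<Sum>l<2^n. ennreal (D l k)) = 1"
  using assms by (subst sum_ennreal; auto simp: doubly_stochastic_def)+

lemma nn_integral_block_density_1:
  assumes "doubly_stochastic n D" "v \<in> {0..<1}"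
  shows "(\<integral>\<^sup>+w. block_density n D v w \<partial>unif) = 1"
  using nn_integral_block_density[of "\<lambda>_. 1" n D v] assms
  by (simp add: unif.emeasure_space_1[simplified] doubly_stochastic_sum_ennreal cell_less)

lemma block_plan_couplings01:
  assumes D: "doubly_stochastic n D"
  shows "block_plan n D \<in> couplings01"
proof (rule couplings01I)
  show "sets (block_plan n D) = sets borel"
    unfolding block_plan_def sets_density by (rule sets_unif_pair)
  fix f :: "real \<Rightarrow> ennreal" assume [measurable]: "f \<in> borel_measurable borel"
  have b: "(\<lambda>z::real\<times>real. f (fst z)) \<in> borel_measurable borel" "(\<lambda>z::real\<times>real. f (snd z)) \<in> borel_measurable borel"
    by simp_all
  have "(\<integral>\<^sup>+z. f (fst z) \<partial>block_plan n D) = (\<integral>\<^sup>+v. f v * (\<integral>\<^sup>+w. block_density n D v w \<partial>unif) \<partial>unif)"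
    by (simp add: nn_integral_block_plan[OF b(1)] nn_integral_cmult)
  also have "\<dots> = (\<integral>\<^sup>+v. f v \<partial>unif)"
    by (intro nn_integral_cong_AE eventually_mono[OF AE_unif_Ico]) (simp add: nn_integral_block_density_1[OF D])
  finally show "(\<integral>\<^sup>+z. f (fst z) \<partial>block_plan n D) = (\<integral>\<^sup>+v. f v \<partial>unif)" .
  define I where "I l = (\<integral>\<^sup>+s. f ((real l + s) / 2^n) \<partial>unif)" for l
  have "(\<integral>\<^sup>+z. f (snd z) \<partial>block_plan n D) = (\<integral>\<^sup>+v. (\<Sum>l<2^n. ennreal (D (cell n v) l) * I l) \<partial>unif)"
    by (simp add: nn_integral_block_plan[OF b(2)] nn_integral_block_density I_def)
  also have "\<dots> = (\<Sum>k<2^n. ennreal (1 / 2^n) * (\<integral>\<^sup>+s. (\<Sum>l<2^n. ennreal (D k l) * I l) \<partial>unif))"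
    by (rule nn_integral_unif_cells[of "\<lambda>k v. \<Sum>l<2^n. ennreal (D k l) * I l"]) simp
  also have "\<dots> = (\<Sum>k<2^n. \<Sum>l<2^n. ennreal (1 / 2^n) * (ennreal (D k l) * I l))"
    by (simp add: unif.emeasure_space_1[simplified] sum_distrib_left)
  also have "\<dots> = (\<Sum>l<2^n. \<Sum>k<2^n. ennreal (1 / 2^n) * (ennreal (D k l) * I l))"
    by (rule sum.swap)
  also have "\<dots> = (\<Sum>l<2^n. ennreal (1 / 2^n) * ((\<Sum>k<2^n. ennreal (D k l)) * I l))"
    by (simp add: sum_distrib_left sum_distrib_right)
  also have "\<dots> = (\<Sum>l<2^n. ennreal (1 / 2^n) * I l)"
    by (intro sum.cong refl) (simp add: doubly_stochastic_sum_ennreal[OF D])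
  also have "\<dots> = (\<integral>\<^sup>+v. f v \<partial>unif)"
    using nn_integral_unif_blocks[of f "2^n"] by (simp add: I_def)
  finally show "(\<integral>\<^sup>+z. f (snd z) \<partial>block_plan n D) = (\<integral>\<^sup>+v. f v \<partial>unif)" .
qed

section \<open>Maps realizing mixtures of block plans\<close>

text \<open>
  A sequence of block plans of levels \<open>lvl j\<close>.  A weight sequence \<open>q\<close> describes the mixture
  of these plans in which plan \<open>j\<close> has weight \<open>q j\<close>.
\<close>

locale plan_family =
  fixes lvl :: "nat \<Rightarrow> nat" and D :: "nat \<Rightarrow> nat \<Rightarrow> nat \<Rightarrow> real"
  assumes stochastic: "\<And>j. doubly_stochastic (lvl j) (D j)"
begin

text \<open>
  Indices \<open>i\<close> encode pairs of a plan \<open>j\<close> and a target cell \<open>l\<close>.  The weight of such a branch is the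
  probability, given \<open>v\<close>, that plan \<open>j\<close> is chosen and sends \<open>v\<close> to cell \<open>l\<close>.
\<close>

definition branch_weight :: "(nat \<Rightarrow> real) \<Rightarrow> real \<Rightarrow> nat \<Rightarrow> real" where
  "branch_weight q v i = (case prod_decode i of (j, l) \<Rightarrow> if l < 2 ^ lvl j then q j * D j (cell (lvl j) v) l else 0)"

definition branch :: "nat \<Rightarrow> real \<Rightarrow> real" where
  "branch i s = (case prod_decode i of (j, l) \<Rightarrow> (real l + s) / 2 ^ lvl j)"

text \<open>
  The number \<open>u\<close> selects a branch, and its relative position in the interval of that branch becomes
  the position in the target cell.
\<close>

definition glue :: "(nat \<Rightarrow> real) \<Rightarrow> real \<Rightarrow> real \<Rightarrow> real" where
  "glue q v u = branch (pick (branch_weight q v) u) (rescaled (branch_weight q v) u)"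

definition mix_density :: "(nat \<Rightarrow> real) \<Rightarrow> real \<Rightarrow> real \<Rightarrow> ennreal" where
  "mix_density q v w = (\<Sum>j. ennreal (q j) * block_density (lvl j) (D j) v w)"

definition mix :: "(nat \<Rightarrow> real) \<Rightarrow> (real \<times> real) measure" where
  "mix q = density (unif \<Otimes>\<^sub>M unif) (\<lambda>z. mix_density q (fst z) (snd z))"

lemma measurable_branch [measurable]: "branch i \<in> borel_measurable borel"
  unfolding branch_def by (cases "prod_decode i") simp

lemma measurable_glue [measurable]: "glue q v \<in> borel_measurable borel"
  unfolding glue_def
  by (rule measurable_compose_countable'[where I=UNIV and g="pick (branch_weight q v)"]) auto

lemma suminf_branch_weight:
  assumes q: "weights q" and v: "v \<in> {0..<1}" and I: "\<And>i. I i = J (prod_decode i)"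
  shows "(\<Sum>i. ennreal (branch_weight q v i) * I i) = (\<Sum>j. ennreal (q j) * (\<Sum>l<2^lvl j. ennreal (D j (cell (lvl j) v) l) * J (j, l)))"
proof -
  define W where "W z = ennreal (case z of (j, l) \<Rightarrow> if l < 2 ^ lvl j then q j * D j (cell (lvl j) v) l else 0) * J z" for z
  have "(\<Sum>i. ennreal (branch_weight q v i) * I i) = (\<Sum>i. W (prod_decode i))"
    by (simp add: W_def branch_weight_def I)
  also have "\<dots> = (\<Sum>j. ennreal (q j) * (\<Sum>l<2^lvl j. ennreal (D j (cell (lvl j) v) l) * J (j, l)))"
  proof (rule suminf_ennreal_2dimen)
    fix j
    have "(\<Sum>l. W (j, l)) = (\<Sum>l<2^lvl j. W (j, l))"
      by (intro suminf_finite) (auto simp: W_def)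
    also have "\<dots> = (\<Sum>l<2^lvl j. ennreal (q j) * (ennreal (D j (cell (lvl j) v) l) * J (j, l)))"
      using weights.p_nonneg[OF q, of j]
      by (intro sum.cong) (auto simp: W_def ennreal_mult' mult.assoc)
    finally show "ennreal (q j) * (\<Sum>l<2^lvl j. ennreal (D j (cell (lvl j) v) l) * J (j, l)) = (\<Sum>l. W (j, l))"
      by (simp add: sum_distrib_left)
  qed
  finally show ?thesis .
qed

lemma weights_branch_weight:
  assumes q: "weights q" and v: "v \<in> {0..<1}"
  shows "weights (branch_weight q v)"
proof -
  have nonneg: "0 \<le> branch_weight q v i" for i
    using weights.p_nonneg[OF q] stochastic v
    by (cases "prod_decode i") (auto simp: branch_weight_def doubly_stochastic_def cell_less)
  have "(\<Sum>i. ennreal (branch_weight q v i)) = (\<Sum>j. ennreal (q j) * (\<Sum>l<2^lvl j. ennreal (D j (cell (lvl j) v) l)))"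
    using suminf_branch_weight[OF q v, of "\<lambda>_. 1" "\<lambda>_. 1"] by simp
  also have "\<dots> = (\<Sum>j. ennreal (q j))"
    using v by (simp add: doubly_stochastic_sum_ennreal[OF stochastic] cell_less)
  also have "\<dots> = ennreal 1"
    by (rule suminf_ennreal_eq[OF weights.p_nonneg[OF q] weights.p_sums[OF q]])
  finally have s: "(\<Sum>i. ennreal (branch_weight q v i)) = ennreal 1" .
  have sm: "summable (branch_weight q v)"
    by (rule summable_suminf_not_top[OF nonneg]) (simp only: s ennreal_neq_top not_False_eq_True)
  have "(\<Sum>i. ennreal (branch_weight q v i)) = ennreal (\<Sum>i. branch_weight q v i)"
    by (rule suminf_ennreal[OF nonneg]) (simp only: s ennreal_neq_top not_False_eq_True)
  then have "ennreal (\<Sum>i. branch_weight q v i) = ennreal 1"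
    by (simp only: s)
  then have "(\<Sum>i. branch_weight q v i) = 1"
    using suminf_nonneg[OF sm nonneg] by (subst (asm) ennreal_inj) auto
  with sm show ?thesis
    by unfold_locales (simp_all add: nonneg sums_iff)
qed

text \<open>
  For fixed \<open>v\<close> and uniform \<open>u\<close>, \<open>glue q v u\<close> has the conditional law of the second
  component of the mixture given that the first one is \<open>v\<close>.
\<close>

lemma nn_integral_glue:
  fixes f :: "real \<Rightarrow> ennreal"
  assumes q: "weights q" and v: "v \<in> {0..<1}" and [measurable]: "f \<in> borel_measurable borel"
  shows "(\<integral>\<^sup>+u. f (glue q v u) \<partial>unif) = (\<integral>\<^sup>+w. f w * mix_density q v w \<partial>unif)"
proof -
  define J where "J z = (\<integral>\<^sup>+s. f ((real (snd z) + s) / 2 ^ lvl (fst z)) \<partial>unif)" for z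
  have I: "(\<integral>\<^sup>+s. f (branch i s) \<partial>unif) = J (prod_decode i)" for i
    by (simp add: branch_def J_def case_prod_beta)
  have "(\<integral>\<^sup>+u. f (glue q v u) \<partial>unif) = (\<Sum>i. ennreal (branch_weight q v i) * (\<integral>\<^sup>+s. f (branch i s) \<partial>unif))"
    unfolding glue_def by (rule weights.nn_integral_pick[OF weights_branch_weight[OF q v]]) simp
  also have "\<dots> = (\<Sum>j. ennreal (q j) * (\<Sum>l<2^lvl j. ennreal (D j (cell (lvl j) v) l) * J (j, l)))"
    by (rule suminf_branch_weight[where J=J, OF q v]) (rule I)
  also have "\<dots> = (\<Sum>j. ennreal (q j) * (\<integral>\<^sup>+w. f w * block_density (lvl j) (D j) v w \<partial>unif))"
    by (simp add: nn_integral_block_density J_def)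
  also have "\<dots> = (\<Sum>j. \<integral>\<^sup>+w. ennreal (q j) * (f w * block_density (lvl j) (D j) v w) \<partial>unif)"
    by (intro suminf_cong) (simp add: nn_integral_cmult)
  also have "\<dots> = (\<integral>\<^sup>+w. (\<Sum>j. ennreal (q j) * (f w * block_density (lvl j) (D j) v w)) \<partial>unif)"
    by (intro nn_integral_suminf[symmetric]) simp
  also have "\<dots> = (\<integral>\<^sup>+w. f w * mix_density q v w \<partial>unif)"
    unfolding mix_density_def ennreal_suminf_cmult[symmetric] by (simp add: mult.left_commute)
  finally show ?thesis .
qed

lemma measurable_mix_density [measurable]:
  "(\<lambda>z. mix_density q (fst z) (snd z)) \<in> borel_measurable borel"
  "(\<lambda>w. mix_density q v w) \<in> borel_measurable borel"
  unfolding mix_density_def by measurable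

lemma nn_integral_mix:
  assumes [measurable]: "F \<in> borel_measurable borel"
  shows "(\<integral>\<^sup>+z. F z \<partial>mix q) = (\<Sum>j. ennreal (q j) * (\<integral>\<^sup>+z. F z \<partial>block_plan (lvl j) (D j)))"
proof -
  have [measurable]: "(\<lambda>z. F z * block_density n E (fst z) (snd z)) \<in> borel_measurable (unif \<Otimes>\<^sub>M unif)"
    "(\<lambda>z. mix_density q (fst z) (snd z)) \<in> borel_measurable (unif \<Otimes>\<^sub>M unif)"
    "(\<lambda>z. block_density n E (fst z) (snd z)) \<in> borel_measurable (unif \<Otimes>\<^sub>M unif)"
    "F \<in> borel_measurable (unif \<Otimes>\<^sub>M unif)" for n E
    by (simp_all add: measurable_cong_sets[OF sets_unif_pair refl])
  have "(\<integral>\<^sup>+z. F z \<partial>mix q) = (\<integral>\<^sup>+z. mix_density q (fst z) (snd z) * F z \<partial>(unif \<Otimes>\<^sub>M unif))"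
    unfolding mix_def by (intro nn_integral_density) auto
  also have "\<dots> = (\<integral>\<^sup>+z. (\<Sum>j. ennreal (q j) * (F z * block_density (lvl j) (D j) (fst z) (snd z))) \<partial>(unif \<Otimes>\<^sub>M unif))"
    unfolding mix_density_def ennreal_suminf_multc[symmetric] by (simp add: ac_simps)
  also have "\<dots> = (\<Sum>j. \<integral>\<^sup>+z. ennreal (q j) * (F z * block_density (lvl j) (D j) (fst z) (snd z)) \<partial>(unif \<Otimes>\<^sub>M unif))"
    by (intro nn_integral_suminf) simp
  also have "\<dots> = (\<Sum>j. ennreal (q j) * (\<integral>\<^sup>+z. F z \<partial>block_plan (lvl j) (D j)))"
    unfolding block_plan_def
    by (intro suminf_cong) (simp add: nn_integral_cmult nn_integral_density mult.commute)
  finally show ?thesis .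
qed

lemma mix_couplings01:
  assumes q: "weights q"
  shows "mix q \<in> couplings01"
proof (rule couplings01I)
  have s: "(\<Sum>j. ennreal (q j)) = 1"
    using suminf_ennreal_eq[OF weights.p_nonneg[OF q] weights.p_sums[OF q]] by simp
  show "sets (mix q) = sets borel"
    unfolding mix_def sets_density by (rule sets_unif_pair)
  fix f :: "real \<Rightarrow> ennreal" assume [measurable]: "f \<in> borel_measurable borel"
  have "(\<lambda>z::real\<times>real. f (fst z)) \<in> borel_measurable borel" "(\<lambda>z::real\<times>real. f (snd z)) \<in> borel_measurable borel"
    by simp_all
  then show "(\<integral>\<^sup>+z. f (fst z) \<partial>mix q) = (\<integral>\<^sup>+v. f v \<partial>unif)" "(\<integral>\<^sup>+z. f (snd z) \<partial>mix q) = (\<integral>\<^sup>+v. f v \<partial>unif)"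
    by (simp_all add: nn_integral_mix couplings01_fst[OF block_plan_couplings01[OF stochastic]]
        couplings01_snd[OF block_plan_couplings01[OF stochastic]] s del: suminf_ennreal)
qed

text \<open>
  The uniform number that selects the branch is replaced by a function of \<open>v\<close>.
\<close>

definition monge :: "(nat \<Rightarrow> real) \<Rightarrow> real \<Rightarrow> real \<Rightarrow> real" where
  "monge q l v = glue q v (level_coord l v)"

definition level_bound :: "(nat \<Rightarrow> real) \<Rightarrow> nat \<Rightarrow> bool" where
  "level_bound q m \<longleftrightarrow> (\<forall>j. q j \<noteq> 0 \<longrightarrow> lvl j \<le> m)"

lemma branch_weight_cell:
  assumes "level_bound q m"
  shows "branch_weight q (real (cell m v) / 2 ^ m) = branch_weight q v"
  using assms by (auto simp: branch_weight_def level_bound_def fun_eq_iff cell_left_endpoint split: prod.splits)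

lemma glue_cell:
  assumes "level_bound q m"
  shows "glue q (real (cell m v) / 2 ^ m) = glue q v"
  by (simp add: glue_def[abs_def] branch_weight_cell[OF assms])

lemma measurable_monge:
  assumes "level_bound q m"
  shows "monge q l \<in> borel_measurable borel"
proof -
  have "(\<lambda>v. glue q (real (cell m v) / 2 ^ m) (level_coord l v)) \<in> borel_measurable borel"
    by (rule measurable_compose_countable'[where I=UNIV and g="cell m"]) auto
  then show ?thesis
    by (simp add: glue_cell[OF assms] monge_def[abs_def])
qed

text \<open>
  The graph of \<open>monge q l\<close> and the mixture have the same law up to the position of the first
  component inside its cell: \<open>glue q\<close> depends on \<open>v\<close> only through that cell, and
  \<open>level_coord l\<close> is independent of the cell.
\<close>

lemma nn_integral_monge:
  fixes F :: "nat \<Rightarrow> real \<Rightarrow> ennreal"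
  assumes q: "weights q" and lb: "level_bound q m" and m: "nat \<lfloor>l\<rfloor> = m"
    and [measurable]: "\<And>k. F k \<in> borel_measurable borel"
  shows "(\<integral>\<^sup>+v. F (cell m v) (monge q l v) \<partial>unif) = (\<integral>\<^sup>+z. F (cell m (fst z)) (snd z) \<partial>mix q)"
proof -
  have [measurable]: "(\<lambda>z::real\<times>real. F (cell m (fst z)) (snd z)) \<in> borel_measurable borel"
    by (rule measurable_compose_countable'[where I=UNIV and g="\<lambda>z. cell m (fst z)"]) auto
  have "(\<integral>\<^sup>+v. F (cell m v) (monge q l v) \<partial>unif)
      = (\<integral>\<^sup>+v. F (cell m v) (glue q (real (cell m v) / 2 ^ m) (level_coord l v)) \<partial>unif)"
    by (simp add: monge_def glue_cell[OF lb])
  also have "\<dots> = (\<integral>\<^sup>+v. \<integral>\<^sup>+u. F (cell m v) (glue q (real (cell m v) / 2 ^ m) u) \<partial>unif \<partial>unif)"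
    by (rule nn_integral_level_coord[where \<Phi>="\<lambda>k u. F k (glue q (real k / 2 ^ m) u)"]) (use m in auto)
  also have "\<dots> = (\<integral>\<^sup>+v. \<integral>\<^sup>+w. F (cell m v) w * mix_density q v w \<partial>unif \<partial>unif)"
    by (rule nn_integral_cong_AE, rule eventually_mono[OF AE_unif_Ico]) (simp add: glue_cell[OF lb] nn_integral_glue[OF q])
  also have "\<dots> = (\<integral>\<^sup>+z. F (cell m (fst z)) (snd z) \<partial>mix q)"
    unfolding mix_def by (subst nn_integral_pair_density) auto
  finally show ?thesis .
qed

definition graph_plan :: "(nat \<Rightarrow> real) \<Rightarrow> real \<Rightarrow> (real \<times> real) measure" where
  "graph_plan q l = distr unif borel (\<lambda>v. (v, monge q l v))"

lemma nn_integral_graph_plan: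
  assumes lb: "level_bound q m" and [measurable]: "F \<in> borel_measurable borel"
  shows "(\<integral>\<^sup>+z. F z \<partial>graph_plan q l) = (\<integral>\<^sup>+v. F (v, monge q l v) \<partial>unif)"
proof -
  note [measurable] = measurable_monge[OF lb]
  show ?thesis
    unfolding graph_plan_def by (intro nn_integral_distr) auto
qed

lemma graph_plan_couplings01:
  assumes q: "weights q" and lb: "level_bound q m" and m: "nat \<lfloor>l\<rfloor> = m"
  shows "graph_plan q l \<in> couplings01"
proof (rule couplings01I)
  show "sets (graph_plan q l) = sets borel" by (simp add: graph_plan_def)
  fix f :: "real \<Rightarrow> ennreal" assume [measurable]: "f \<in> borel_measurable borel"
  have b: "(\<lambda>z::real\<times>real. f (fst z)) \<in> borel_measurable borel" "(\<lambda>z::real\<times>real. f (snd z)) \<in> borel_measurable borel"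
    by simp_all
  show "(\<integral>\<^sup>+z. f (fst z) \<partial>graph_plan q l) = (\<integral>\<^sup>+v. f v \<partial>unif)"
    by (simp add: nn_integral_graph_plan[OF lb b(1)])
  show "(\<integral>\<^sup>+z. f (snd z) \<partial>graph_plan q l) = (\<integral>\<^sup>+v. f v \<partial>unif)"
    using nn_integral_monge[OF q lb m, of "\<lambda>_. f"]
    by (simp add: nn_integral_graph_plan[OF lb b(2)] couplings01_snd[OF mix_couplings01[OF q]])
qed

text \<open>
  Away from the endpoints of the splitting, the branch that is picked is locally constant, and on
  each branch \<open>glue\<close> is affine with coefficients that depend continuously on the weights.
\<close>

lemma glue_tendsto:
  assumes q: "weights q" and qs: "\<And>n. weights (qs n)" "\<And>j. (\<lambda>n. qs n j) \<longlonglongrightarrow> q j"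
    and v: "v \<in> {0..<1}" and u: "u \<in> {0..<1}" "us \<longlonglongrightarrow> u" "u \<notin> range (cumul (branch_weight q v))"
  shows "(\<lambda>n. glue (qs n) v (us n)) \<longlonglongrightarrow> glue q v u"
proof -
  interpret W: weights "branch_weight q v" by (rule weights_branch_weight[OF q v])
  define i where "i = pick (branch_weight q v) u"
  have w: "(\<lambda>n. branch_weight (qs n) v k) \<longlonglongrightarrow> branch_weight q v k" for k
    unfolding branch_weight_def by (cases "prod_decode k") (auto intro!: tendsto_intros qs(2))
  then have P: "(\<lambda>n. cumul (branch_weight (qs n) v) k) \<longlonglongrightarrow> cumul (branch_weight q v) k" for k
    unfolding cumul_def by (intro tendsto_sum)
  have "cumul (branch_weight q v) i \<noteq> u" using u(3) by blast
  then have lo: "cumul (branch_weight q v) i < u" and hi: "u < cumul (branch_weight q v) (Suc i)"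
    using W.pick_bounds[of u] u(1) by (auto simp: i_def less_le)
  then have pos: "branch_weight q v i > 0" by (simp add: W.cumul_Suc)
  have "\<forall>\<^sub>F n in sequentially. cumul (branch_weight (qs n) v) i < us n"
    using lo by (intro order_tendstoD(2)[OF tendsto_diff[OF P u(2)], of i 0, simplified]) auto
  moreover have "\<forall>\<^sub>F n in sequentially. us n < cumul (branch_weight (qs n) v) (Suc i)"
    using hi by (intro order_tendstoD(2)[OF tendsto_diff[OF u(2) P], of "Suc i" 0, simplified]) auto
  ultimately have ev: "\<forall>\<^sub>F n in sequentially.
      branch i ((us n - cumul (branch_weight (qs n) v) i) / branch_weight (qs n) v i) = glue (qs n) v (us n)"
  proof eventually_elim
    case (elim n)
    then have "pick (branch_weight (qs n) v) (us n) = i"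
      by (intro weights.pick_eq weights_branch_weight qs v) auto
    then show ?case by (simp add: glue_def rescaled_def)
  qed
  have "(\<lambda>n. branch i ((us n - cumul (branch_weight (qs n) v) i) / branch_weight (qs n) v i))
      \<longlonglongrightarrow> branch i ((u - cumul (branch_weight q v) i) / branch_weight q v i)"
    unfolding branch_def using pos
    by (cases "prod_decode i") (auto intro!: tendsto_intros P w u(2))
  then have "(\<lambda>n. glue (qs n) v (us n)) \<longlonglongrightarrow> branch i ((u - cumul (branch_weight q v) i) / branch_weight q v i)"
    by (rule Lim_transform_eventually[OF _ ev])
  then show ?thesis
    by (simp add: glue_def rescaled_def i_def)
qed

lemma AE_level_coord_countable:
  assumes "countable S"
  shows "AE v in unif. level_coord l v \<notin> S"
proof -
  have S [measurable]: "S \<in> sets borel"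
    using assms by (rule sets.countable[rotated]) auto
  have "(\<integral>\<^sup>+u. indicator S u \<partial>unif) = 0"
    using AE_unif_countable[OF assms] by (subst nn_integral_0_iff_AE) (auto simp: indicator_def)
  then have "(\<integral>\<^sup>+v. indicator S (level_coord l v) \<partial>unif) = 0"
    using nn_integral_level_coord[of "\<lambda>_. indicator S" l "nat \<lfloor>l\<rfloor>"] by simp
  then show ?thesis
    by (subst (asm) nn_integral_0_iff_AE) (auto simp: indicator_def split: if_splits)
qed

text \<open>
  The exceptional endpoints form a countable set that does not depend on \<open>v\<close>, because they are
  determined by the cell of \<open>v\<close>.
\<close>

lemma monge_tendsto:
  assumes q: "weights q" and lb: "level_bound q m" and qs: "\<And>n. weights (qs n)" "\<And>j. (\<lambda>n. qs n j) \<longlonglongrightarrow> q j"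
    and l: "l \<ge> 1" "ls \<longlonglongrightarrow> l"
  shows "AE v in unif. (\<lambda>n. monge (qs n) (ls n) v) \<longlonglongrightarrow> monge q l v"
proof -
  define S where "S = (\<Union>k::nat. range (cumul (branch_weight q (real k / 2 ^ m))))"
  have "countable S" unfolding S_def by auto
  from AE_level_coord_countable[OF this, of l] isCont_level_coord[OF l(1)] AE_unif_Ico
  show ?thesis
  proof eventually_elim
    case (elim v)
    have "level_coord l v \<notin> range (cumul (branch_weight q v))"
      using elim(1) branch_weight_cell[OF lb, of v] unfolding S_def by (metis UN_iff UNIV_I)
    then show ?case
      unfolding monge_def using level_coord_bounds[of l v] isCont_tendsto_compose[OF elim(2) l(2)] elim(3)
      by (intro glue_tendsto q qs) auto
  qed
qed

end

section \<open>Equicontinuity of the costs over all couplings\<close>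

lemma couplings01_prob:
  assumes "\<gamma> \<in> couplings01" shows "prob_space \<gamma>"
proof (rule prob_spaceI)
  have "(\<integral>\<^sup>+z. 1 \<partial>\<gamma>) = (\<integral>\<^sup>+v. 1 \<partial>unif)"
    using couplings01_fst[OF assms, of "\<lambda>_. 1"] by simp
  then show "emeasure \<gamma> (space \<gamma>) = 1"
    using unif.emeasure_space_1 by simp
qed

lemma unif_inner_compact:
  assumes [measurable]: "S \<in> sets borel" and S: "AE v in unif. v \<in> S" and "e > 0"
  obtains K where "compact K" "K \<subseteq> S" "K \<subseteq> {0..<1}" "emeasure unif (- K) \<le> ennreal e"
proof -
  have "AE v in unif. v \<in> S \<inter> {0..<1}"
    using S AE_unif_Ico by eventually_elim auto
  then have 1: "emeasure unif (S \<inter> {0..<1}) = 1"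
    by (intro unif.emeasure_eq_1_AE) auto
  have "emeasure unif (S \<inter> {0..<1}) = (SUP K\<in>{K. K \<subseteq> S \<inter> {0..<1} \<and> compact K}. emeasure unif K)"
    by (rule inner_regular) auto
  then have "ennreal (1 - e) < (SUP K\<in>{K. K \<subseteq> S \<inter> {0..<1} \<and> compact K}. emeasure unif K)"
    using 1 \<open>e > 0\<close> by (metis diff_gt_0_iff_gt diff_less_eq ennreal_1 ennreal_less_iff ennreal_lessI less_add_same_cancel1 zero_less_one)
  then obtain K where K: "K \<subseteq> S \<inter> {0..<1}" "compact K" "ennreal (1 - e) < emeasure unif K"
    by (auto simp: less_SUP_iff)
  have m [measurable]: "K \<in> sets borel" using K by (intro borel_closed compact_imp_closed)
  have "measure unif (- K) = 1 - measure unif K"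
    using unif.prob_compl[of K] m by (simp add: Compl_eq_Diff_UNIV)
  moreover have "1 - e \<le> measure unif K"
  proof (cases "e \<le> 1")
    case True
    with K(3) show ?thesis unfolding unif.emeasure_eq_measure by (simp add: ennreal_less_iff)
  qed (smt (verit) measure_nonneg)
  ultimately have "emeasure unif (- K) \<le> ennreal e"
    unfolding unif.emeasure_eq_measure using \<open>e > 0\<close> by (simp add: ennreal_le_iff)
  with K that show thesis by blast
qed

text \<open>
  All couplings have the same marginals, so they are uniformly tight: one compact rectangle carries
  almost all the mass of each of them.
\<close>

lemma couplings01_inner_compact:
  assumes "S \<in> sets borel" "AE v in unif. v \<in> S" "S' \<in> sets borel" "AE v in unif. v \<in> S'" "e > 0"
  obtains K K' where "compact K" "K \<subseteq> S" "K \<subseteq> {0..<1}" "compact K'" "K' \<subseteq> S'" "K' \<subseteq> {0..<1}"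
    "\<And>\<gamma>. \<gamma> \<in> couplings01 \<Longrightarrow> emeasure \<gamma> (- (K \<times> K')) \<le> ennreal e"
proof -
  obtain K where K: "compact K" "K \<subseteq> S" "K \<subseteq> {0..<1}" "emeasure unif (- K) \<le> ennreal (e/2)"
    using unif_inner_compact[OF assms(1,2), of "e/2"] assms(5) by auto
  obtain K' where K': "compact K'" "K' \<subseteq> S'" "K' \<subseteq> {0..<1}" "emeasure unif (- K') \<le> ennreal (e/2)"
    using unif_inner_compact[OF assms(3,4), of "e/2"] assms(5) by auto
  have [measurable]: "K \<in> sets borel" "K' \<in> sets borel" using K(1) K'(1) by (simp_all add: borel_closed compact_imp_closed)
  have "emeasure \<gamma> (- (K \<times> K')) \<le> ennreal e" if \<gamma>: "\<gamma> \<in> couplings01" for \<gamma>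
  proof -
    note [measurable_cong] = couplings01_sets[OF \<gamma>]
    have [measurable]: "K \<times> K' \<in> sets borel"
      using K K' by (intro borel_closed closed_Times compact_imp_closed)
    have "emeasure \<gamma> (- (K \<times> K')) = (\<integral>\<^sup>+z. indicator (- (K \<times> K')) z \<partial>\<gamma>)"
      by (simp add: couplings01_sets[OF \<gamma>])
    also have "\<dots> \<le> (\<integral>\<^sup>+z. indicator (- K) (fst z) + indicator (- K') (snd z) \<partial>\<gamma>)"
      by (intro nn_integral_mono) (auto simp: indicator_def)
    also have "\<dots> = (\<integral>\<^sup>+z. indicator (- K) (fst z) \<partial>\<gamma>) + (\<integral>\<^sup>+z. indicator (- K') (snd z) \<partial>\<gamma>)"
      by (intro nn_integral_add) auto
    also have "\<dots> = emeasure unif (- K) + emeasure unif (- K')"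
      by (simp add: couplings01_fst[OF \<gamma>, of "indicator (- K)"] couplings01_snd[OF \<gamma>, of "indicator (- K')"])
    also have "\<dots> \<le> ennreal (e/2) + ennreal (e/2)"
      by (intro add_mono K K')
    also have "\<dots> = ennreal e"
      using assms(5) by (simp flip: ennreal_plus)
    finally show ?thesis .
  qed
  with K K' that show thesis by blast
qed

lemma nn_integral_le_off_small:
  fixes G G' :: "real \<times> real \<Rightarrow> real"
  assumes \<gamma>: "\<gamma> \<in> couplings01" and [measurable]: "(\<lambda>z. ennreal (G' z)) \<in> borel_measurable borel" 
    and K: "K \<in> sets borel" "emeasure \<gamma> (- K) \<le> ennreal \<eta>"
    and le: "\<And>z. z \<in> K \<Longrightarrow> G z \<le> G' z + d" and C: "\<And>z. G z \<le> C" and nn: "0 \<le> C" "0 \<le> d" "0 \<le> \<eta>" "\<And>z. 0 \<le> G' z"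
  shows "(\<integral>\<^sup>+z. ennreal (G z) \<partial>\<gamma>) \<le> (\<integral>\<^sup>+z. ennreal (G' z) \<partial>\<gamma>) + ennreal (d + C * \<eta>)"
proof -
  interpret prob_space \<gamma> by (rule couplings01_prob[OF \<gamma>])
  note [measurable_cong] = couplings01_sets[OF \<gamma>]
  note [measurable] = K(1)
  have "(\<integral>\<^sup>+z. ennreal (G z) \<partial>\<gamma>) \<le> (\<integral>\<^sup>+z. ennreal (G' z) + (ennreal d + ennreal C * indicator (- K) z) \<partial>\<gamma>)"
  proof (rule nn_integral_mono)
    fix z
    show "ennreal (G z) \<le> ennreal (G' z) + (ennreal d + ennreal C * indicator (- K) z)"
    proof (cases "z \<in> K")
      case True
      then show ?thesis using le[OF True] nn by (simp flip: ennreal_plus)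
    next
      case False
      then have "ennreal (G z) \<le> ennreal C" using C by (intro ennreal_leI)
      also have "\<dots> \<le> ennreal (G' z) + (ennreal d + ennreal C * indicator (- K) z)"
        using False by (simp add: add_increasing)
      finally show ?thesis .
    qed
  qed
  also have "\<dots> = (\<integral>\<^sup>+z. ennreal (G' z) \<partial>\<gamma>) + (ennreal d + ennreal C * emeasure \<gamma> (- K))"
    by (simp add: nn_integral_add nn_integral_cmult emeasure_space_1 couplings01_sets[OF \<gamma>])
  also have "\<dots> \<le> (\<integral>\<^sup>+z. ennreal (G' z) \<partial>\<gamma>) + (ennreal d + ennreal C * ennreal \<eta>)"
    by (intro add_mono mult_mono K) auto
  also have "ennreal d + ennreal C * ennreal \<eta> = ennreal (d + C * \<eta>)"
    using nn by (simp add: ennreal_mult' ennreal_plus)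
  finally show ?thesis .
qed

text \<open>
  Both couplings induce the same law on pairs of level \<open>m\<close> cells.
\<close>

definition same_cells :: "nat \<Rightarrow> (real \<times> real) measure \<Rightarrow> (real \<times> real) measure \<Rightarrow> bool" where
  "same_cells m \<gamma> \<gamma>' \<longleftrightarrow> (\<forall>F :: nat \<Rightarrow> nat \<Rightarrow> ennreal.
     (\<integral>\<^sup>+z. F (cell m (fst z)) (cell m (snd z)) \<partial>\<gamma>) = (\<integral>\<^sup>+z. F (cell m (fst z)) (cell m (snd z)) \<partial>\<gamma>'))"

lemma measurable_cells [measurable]:
  fixes F :: "nat \<Rightarrow> nat \<Rightarrow> ennreal"
  shows "(\<lambda>z::real\<times>real. F (cell m (fst z)) (cell m (snd z))) \<in> borel_measurable borel"
  by (rule measurable_compose_countable'[where g="\<lambda>z. cell m (fst z)" and I=UNIV],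
      rule measurable_compose_countable'[where g="\<lambda>z. cell m (snd z)" and I=UNIV]) auto

lemma cell_dist:
  assumes "cell m v = cell m w" "0 \<le> v" "0 \<le> w"
  shows "\<bar>v - w\<bar> \<le> 1 / 2 ^ m"
proof -
  have "\<lfloor>2 ^ m * v\<rfloor> = \<lfloor>2 ^ m * w\<rfloor>"
    using assms unfolding cell_def by (subst (asm) eq_nat_nat_iff) auto
  then have "\<bar>2 ^ m * v - 2 ^ m * w\<bar> \<le> 1"
    by linarith
  also have "\<bar>2 ^ m * v - 2 ^ m * w\<bar> = 2 ^ m * \<bar>v - w\<bar>"
    by (simp flip: right_diff_distrib add: abs_mult)
  finally show ?thesis by (simp add: field_simps)
qed

lemma isCont_if_abs_diff_le:
  fixes f :: "'t::t2_space \<Rightarrow> real"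
  assumes "\<And>e. e > 0 \<Longrightarrow> \<forall>\<^sub>F t' in nhds t. \<bar>f t' - f t\<bar> \<le> e"
  shows "isCont f t"
  unfolding isCont_def
proof (rule tendstoI)
  fix e :: real assume "e > 0"
  then have "\<forall>\<^sub>F t' in nhds t. \<bar>f t' - f t\<bar> \<le> e / 2" by (intro assms) auto
  then have "\<forall>\<^sub>F t' in at t. \<bar>f t' - f t\<bar> \<le> e / 2"
    by (simp add: eventually_at_filter eventually_mono)
  then show "\<forall>\<^sub>F t' in at t. dist (f t') (f t) < e"
    by eventually_elim (use \<open>e > 0\<close> in \<open>simp add: dist_real_def\<close>)
qed

lemma continuous_on_section:
  fixes H :: "real \<Rightarrow> real \<Rightarrow> 't::topological_space \<Rightarrow> real"
  assumes "continuous_on (A \<times> B \<times> UNIV) (\<lambda>(v, w, t). H v w t)"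
  shows "continuous_on (A \<times> B) (\<lambda>z. H (fst z) (snd z) t)"
proof -
  have "continuous_on (A \<times> B) (\<lambda>z. (\<lambda>(v, w, t). H v w t) (fst z, snd z, t))"
    by (rule continuous_on_compose2[OF assms]) (auto intro!: continuous_intros)
  then show ?thesis by simp
qed

lemma measurable_section:
  fixes H :: "real \<Rightarrow> real \<Rightarrow> 't::topological_space \<Rightarrow> real"
  assumes "continuous_on (A \<times> B \<times> UNIV) (\<lambda>(v, w, t). H v w t)" and "A \<in> sets borel" "B \<in> sets borel"
    and outside: "\<And>v w. v \<notin> A \<or> w \<notin> B \<Longrightarrow> H v w t = 0"
  shows "(\<lambda>z. H (fst z) (snd z) t) \<in> borel_measurable borel"
proof -
  have "(\<lambda>z. if z \<in> A \<times> B then H (fst z) (snd z) t else 0) \<in> borel_measurable borel"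
    using assms by (intro borel_measurable_continuous_on_if continuous_on_section borel_Times) auto
  also have "(\<lambda>z. if z \<in> A \<times> B then H (fst z) (snd z) t else 0) = (\<lambda>z. H (fst z) (snd z) t)"
    by (auto simp: outside)
  finally show ?thesis .
qed

text \<open>
  Costs on the square that are continuous on a rectangle with sides of full measure.  Uniform
  integrability enters only through the assumption \<open>trunc\<close>: cutting off at a high level changes
  the cost of no coupling, for no parameter, by more than \<open>e\<close>.
\<close>

locale kernel_family =
  fixes H :: "real \<Rightarrow> real \<Rightarrow> 't::metric_space \<Rightarrow> real" and A B :: "real set"
  assumes A: "A \<in> sets borel" "AE v in unif. v \<in> A"
    and B: "B \<in> sets borel" "AE v in unif. v \<in> B"
    and cont: "continuous_on (A \<times> B \<times> UNIV) (\<lambda>(v, w, t). H v w t)"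
    and nonneg: "\<And>v w t. 0 \<le> H v w t"
    and outside: "\<And>v w t. v \<notin> A \<or> w \<notin> B \<Longrightarrow> H v w t = 0"
    and trunc: "\<And>e. e > 0 \<Longrightarrow> \<exists>C\<ge>0. \<forall>t. \<forall>\<gamma>\<in>couplings01.
        (\<integral>\<^sup>+z. ennreal (H (fst z) (snd z) t) \<partial>\<gamma>)
          \<le> (\<integral>\<^sup>+z. ennreal (min (H (fst z) (snd z) t) C) \<partial>\<gamma>) + ennreal e"
begin

definition cost :: "'t \<Rightarrow> (real \<times> real) measure \<Rightarrow> ennreal" where
  "cost t \<gamma> = (\<integral>\<^sup>+z. ennreal (H (fst z) (snd z) t) \<partial>\<gamma>)"

lemma measurable_H [measurable]: "(\<lambda>z. H (fst z) (snd z) t) \<in> borel_measurable borel"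
  by (rule measurable_section[OF cont A(1) B(1)]) (rule outside)

lemma trunc_cost:
  assumes "e > 0"
  obtains C where "C \<ge> 0" "\<And>t \<gamma>. \<gamma> \<in> couplings01 \<Longrightarrow>
     cost t \<gamma> \<le> (\<integral>\<^sup>+z. ennreal (min (H (fst z) (snd z) t) C) \<partial>\<gamma>) + ennreal e"
  using trunc[OF assms] unfolding cost_def by blast

lemma cost_finite:
  assumes \<gamma>: "\<gamma> \<in> couplings01"
  shows "cost t \<gamma> < \<infinity>"
proof -
  interpret prob_space \<gamma> by (rule couplings01_prob[OF \<gamma>])
  obtain C where C: "C \<ge> 0" "\<And>t \<gamma>. \<gamma> \<in> couplings01 \<Longrightarrow>
     cost t \<gamma> \<le> (\<integral>\<^sup>+z. ennreal (min (H (fst z) (snd z) t) C) \<partial>\<gamma>) + ennreal 1"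
    using trunc_cost[of 1] by auto
  have "(\<integral>\<^sup>+z. ennreal (min (H (fst z) (snd z) t) C) \<partial>\<gamma>) \<le> (\<integral>\<^sup>+z. ennreal C \<partial>\<gamma>)"
    by (intro nn_integral_mono ennreal_leI) simp
  also have "\<dots> = ennreal C" by (simp add: emeasure_space_1)
  finally show ?thesis
    using C(2)[OF \<gamma>, of t] by (auto simp: less_top[symmetric] top_unique)
qed

text \<open>
  After truncation the complement of a large compact rectangle contributes little, and on the
  rectangle the costs converge uniformly as the parameter converges.
\<close>

lemma cost_equicontinuous:
  assumes "e > 0"
  shows "\<forall>\<^sub>F t' in nhds t. \<forall>\<gamma>\<in>couplings01. cost t' \<gamma> \<le> cost t \<gamma> + ennreal e \<and> cost t \<gamma> \<le> cost t' \<gamma> + ennreal e"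
proof -
  obtain C where C: "C \<ge> 0" "\<And>t \<gamma>. \<gamma> \<in> couplings01 \<Longrightarrow>
     cost t \<gamma> \<le> (\<integral>\<^sup>+z. ennreal (min (H (fst z) (snd z) t) C) \<partial>\<gamma>) + ennreal (e/3)"
    using trunc_cost[of "e/3"] assms by auto
  \<comment> \<open>the truncation, the oscillation and the complement of the rectangle each cost at most a third of \<open>e\<close>\<close>
  define \<eta> where "\<eta> = e / (3 * (C + 1))"
  have \<eta>: "\<eta> > 0" "C * \<eta> \<le> e / 3"
    using assms C(1) by (auto simp: \<eta>_def field_simps)
  obtain K K' where K: "compact K" "K \<subseteq> A" "compact K'" "K' \<subseteq> B"
    and small: "\<And>\<gamma>. \<gamma> \<in> couplings01 \<Longrightarrow> emeasure \<gamma> (- (K \<times> K')) \<le> ennreal \<eta>"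
    using couplings01_inner_compact[OF A B \<eta>(1)] by metis
  have Kb: "K \<times> K' \<in> sets borel"
    using K by (intro borel_closed closed_Times compact_imp_closed)
  have "continuous_on (UNIV \<times> (K \<times> K')) (\<lambda>x. (\<lambda>(v, w, t). H v w t) (fst (snd x), snd (snd x), fst x))"
    using K by (intro continuous_on_compose2[OF cont]) (auto intro!: continuous_intros)
  then have "continuous_on (UNIV \<times> (K \<times> K')) (\<lambda>(t, z). H (fst z) (snd z) t)"
    by (simp add: case_prod_beta)
  then obtain V where V: "t \<in> V" "open V" "\<forall>t'\<in>V \<inter> UNIV. \<forall>z\<in>K \<times> K'.
      dist ((\<lambda>(t, z). H (fst z) (snd z) t) (t', z)) ((\<lambda>(t, z). H (fst z) (snd z) t) (t, z)) \<le> e / 3"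
    by (rule continuous_on_prod_compactE[OF _ compact_Times[OF K(1,3)] UNIV_I, of _ "e/3"]) (use assms in auto)
  have V3: "dist (H (fst z) (snd z) t') (H (fst z) (snd z) t) \<le> e / 3" if "t' \<in> V" "z \<in> K \<times> K'" for t' z
    using V(3)[rule_format, of t' z] that by simp
  have main: "cost t1 \<gamma> \<le> cost t2 \<gamma> + ennreal e"
    if \<gamma>: "\<gamma> \<in> couplings01" and d: "\<And>z. z \<in> K \<times> K' \<Longrightarrow> dist (H (fst z) (snd z) t1) (H (fst z) (snd z) t2) \<le> e / 3" for t1 t2 \<gamma>
  proof -
    have "(\<integral>\<^sup>+z. ennreal (min (H (fst z) (snd z) t1) C) \<partial>\<gamma>)
        \<le> (\<integral>\<^sup>+z. ennreal (H (fst z) (snd z) t2) \<partial>\<gamma>) + ennreal (e/3 + C * \<eta>)"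
    proof (rule nn_integral_le_off_small[OF \<gamma> _ Kb small[OF \<gamma>]])
      fix z assume "z \<in> K \<times> K'"
      from d[OF this] show "min (H (fst z) (snd z) t1) C \<le> H (fst z) (snd z) t2 + e / 3"
        unfolding dist_real_def by linarith
    qed (use assms C \<eta> nonneg in auto)
    also have "\<dots> \<le> cost t2 \<gamma> + ennreal (2 * e/3)"
      unfolding cost_def using \<eta> by (intro add_left_mono ennreal_leI) auto
    finally have "(\<integral>\<^sup>+z. ennreal (min (H (fst z) (snd z) t1) C) \<partial>\<gamma>) + ennreal (e/3)
        \<le> cost t2 \<gamma> + ennreal (2 * e/3) + ennreal (e/3)"
      by (rule add_right_mono)
    also have "\<dots> = cost t2 \<gamma> + ennreal e"
      using assms by (simp add: add.assoc flip: ennreal_plus)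
    finally show ?thesis
      using C(2)[OF \<gamma>, of t1] by (rule order_trans[rotated])
  qed
  have "\<forall>\<^sub>F t' in nhds t. t' \<in> V" using V by (intro eventually_nhds_in_open)
  then show ?thesis
    by (rule eventually_mono) (intro ballI conjI main, use V3 in \<open>simp_all add: dist_commute\<close>)
qed

text \<open>
  On a large compact rectangle the cost is uniformly continuous, so it is close to a function \<open>g\<close>
  of the pair of cells, and the integral of \<open>g\<close> is the same for both couplings.  The truncation is
  needed because \<open>g\<close> is not controlled by the cost outside the rectangle.
\<close>

lemma cost_same_cells:
  assumes "e > 0"
  shows "\<exists>m. \<forall>m'\<ge>m. \<forall>\<gamma>\<in>couplings01. \<forall>\<gamma>'\<in>couplings01. same_cells m' \<gamma> \<gamma>' \<longrightarrow> cost t \<gamma> \<le> cost t \<gamma>' + ennreal e"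
proof -
  obtain C where C: "C \<ge> 0" "\<And>t \<gamma>. \<gamma> \<in> couplings01 \<Longrightarrow>
     cost t \<gamma> \<le> (\<integral>\<^sup>+z. ennreal (min (H (fst z) (snd z) t) C) \<partial>\<gamma>) + ennreal (e/4)"
    using trunc_cost[of "e/4"] assms by auto
  define \<eta> where "\<eta> = e / (8 * (C + 1))"
  have \<eta>: "\<eta> > 0" "C * \<eta> \<le> e / 8"
    using assms C(1) by (auto simp: \<eta>_def field_simps)
  obtain K K' where K: "compact K" "K \<subseteq> A" "K \<subseteq> {0..<1}" "compact K'" "K' \<subseteq> B" "K' \<subseteq> {0..<1}"
    and small: "\<And>\<gamma>. \<gamma> \<in> couplings01 \<Longrightarrow> emeasure \<gamma> (- (K \<times> K')) \<le> ennreal \<eta>"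
    using couplings01_inner_compact[OF A B \<eta>(1)] by metis
  have Kb: "K \<times> K' \<in> sets borel"
    using K by (intro borel_closed closed_Times compact_imp_closed)
  define h where "h z = H (fst z) (snd z) t" for z
  have "continuous_on (K \<times> K') h"
    unfolding h_def by (rule continuous_on_subset[OF continuous_on_section[OF cont]]) (use K in auto)
  then have "uniformly_continuous_on (K \<times> K') h"
    by (rule compact_uniformly_continuous[OF _ compact_Times[OF K(1,4)]])
  then obtain d where d: "d > 0" "\<And>z z'. z \<in> K \<times> K' \<Longrightarrow> z' \<in> K \<times> K' \<Longrightarrow> dist z' z < d \<Longrightarrow> dist (h z') (h z) < e / 8"
    unfolding uniformly_continuous_on_def using assms by (metis divide_pos_pos zero_less_numeral)
  obtain m where m: "(1/2) ^ m < d / 2"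
    using real_arch_pow_inv[of "d/2" "1/2"] d by auto
  show ?thesis
  proof (intro exI[of _ m] allI impI ballI)
    fix m' \<gamma> \<gamma>' assume "m \<le> m'" and \<gamma>: "\<gamma> \<in> couplings01" and \<gamma>': "\<gamma>' \<in> couplings01" and same: "same_cells m' \<gamma> \<gamma>'"
    have mesh: "1 / 2 ^ m' < d / 2"
    proof -
      have "(1/2::real) ^ m' \<le> (1/2) ^ m" using \<open>m \<le> m'\<close> by (intro power_decreasing) auto
      with m show ?thesis by (simp add: power_one_over)
    qed
    define P where "P k l z \<longleftrightarrow> z \<in> K \<times> K' \<and> cell m' (fst z) = k \<and> cell m' (snd z) = l" for k l and z :: "real \<times> real"
    \<comment> \<open>a sample value in the cell, lowered so that it lies below the cost on the whole cell\<close>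
    define f where "f k l = (if \<exists>z. P k l z then max 0 (min (h (SOME z. P k l z)) C - e/8) else 0)" for k l
    define g where "g z = f (cell m' (fst z)) (cell m' (snd z))" for z
    have osc: "min (h z) C \<le> g z + e/4" "g z \<le> h z" if z: "z \<in> K \<times> K'" for z
    proof -
      define z0 where "z0 = (SOME z'. P (cell m' (fst z)) (cell m' (snd z)) z')"
      have ex: "P (cell m' (fst z)) (cell m' (snd z)) z" using z by (simp add: P_def)
      then have P0: "P (cell m' (fst z)) (cell m' (snd z)) z0" unfolding z0_def by (rule someI)
      have "\<bar>fst z - fst z0\<bar> \<le> 1 / 2 ^ m'" "\<bar>snd z - snd z0\<bar> \<le> 1 / 2 ^ m'"
        using P0 z K by (auto intro!: cell_dist simp: P_def)
      then have "dist z z0 < d"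
        unfolding dist_prod_def using mesh sqrt_sum_squares_le_sum_abs[of "dist (fst z) (fst z0)" "dist (snd z) (snd z0)"]
        by (simp add: dist_real_def)
      then have "dist (h z) (h z0) < e/8"
        using d(2)[of z0 z] P0 z by (simp add: P_def)
      moreover have "g z = max 0 (min (h z0) C - e/8)"
        unfolding g_def f_def z0_def[symmetric] using ex by (subst if_P) blast+
      moreover have "0 \<le> h z" by (simp add: h_def nonneg)
      ultimately show "min (h z) C \<le> g z + e/4" "g z \<le> h z"
        using assms unfolding dist_real_def by linarith+
    qed
    have g: "0 \<le> g z" "g z \<le> C" for z
      using C assms by (auto simp: g_def f_def)
    have gm [measurable]: "(\<lambda>z. ennreal (g z)) \<in> borel_measurable borel"
      unfolding g_def by (rule measurable_cells[of "\<lambda>k l. ennreal (f k l)"])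
    have "cost t \<gamma> \<le> (\<integral>\<^sup>+z. ennreal (min (h z) C) \<partial>\<gamma>) + ennreal (e/4)"
      using C(2)[OF \<gamma>, of t] by (simp add: h_def)
    also have "(\<integral>\<^sup>+z. ennreal (min (h z) C) \<partial>\<gamma>) \<le> (\<integral>\<^sup>+z. ennreal (g z) \<partial>\<gamma>) + ennreal (e/4 + C * \<eta>)"
      by (rule nn_integral_le_off_small[OF \<gamma> gm Kb small[OF \<gamma>]]) (use osc g assms C \<eta> in auto)
    also have "(\<integral>\<^sup>+z. ennreal (g z) \<partial>\<gamma>) = (\<integral>\<^sup>+z. ennreal (g z) \<partial>\<gamma>')"
      using same unfolding same_cells_def g_def by (rule spec[of _ "\<lambda>k l. ennreal (f k l)"])
    also have "\<dots> \<le> (\<integral>\<^sup>+z. ennreal (h z) \<partial>\<gamma>') + ennreal (0 + C * \<eta>)"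
      unfolding h_def
      by (rule nn_integral_le_off_small[OF \<gamma>' _ Kb small[OF \<gamma>']]) (use osc g assms C \<eta> nonneg in \<open>auto simp: h_def\<close>)
    also have "(\<integral>\<^sup>+z. ennreal (h z) \<partial>\<gamma>') = cost t \<gamma>'"
      by (simp add: cost_def h_def)
    finally have "cost t \<gamma> \<le> cost t \<gamma>' + ennreal (0 + C * \<eta>) + ennreal (e/4 + C * \<eta>) + ennreal (e/4)"
      by (simp add: add_right_mono)
    also have "\<dots> = cost t \<gamma>' + ennreal (e/2 + 2 * (C * \<eta>))"
      using assms C \<eta> by (simp add: add.assoc flip: ennreal_plus)
    also have "\<dots> \<le> cost t \<gamma>' + ennreal e"
      using assms C \<eta> by (intro add_left_mono ennreal_leI) auto
    finally show "cost t \<gamma> \<le> cost t \<gamma>' + ennreal e" .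
  qed
qed

section \<open>Optimal costs and a countable family of nearly optimal block plans\<close>

definition rcost :: "'t \<Rightarrow> (real \<times> real) measure \<Rightarrow> real" where
  "rcost t \<gamma> = enn2real (cost t \<gamma>)"

lemma cost_rcost: "\<gamma> \<in> couplings01 \<Longrightarrow> cost t \<gamma> = ennreal (rcost t \<gamma>)"
  using cost_finite[of \<gamma> t] by (simp add: rcost_def)

lemma rcost_nonneg: "0 \<le> rcost t \<gamma>"
  by (simp add: rcost_def)

lemma cost_le_iff:
  assumes "\<gamma> \<in> couplings01" "\<gamma>' \<in> couplings01" "0 \<le> e"
  shows "cost t \<gamma> \<le> cost t' \<gamma>' + ennreal e \<longleftrightarrow> rcost t \<gamma> \<le> rcost t' \<gamma>' + e"
  using assms rcost_nonneg by (simp add: cost_rcost ennreal_le_iff flip: ennreal_plus)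

definition mincost :: "'t \<Rightarrow> real" where
  "mincost t = (INF \<gamma>\<in>couplings01. rcost t \<gamma>)"

lemma couplings01_nonempty: "couplings01 \<noteq> {}"
proof -
  have "doubly_stochastic 0 (\<lambda>_ _. 1)" by (simp add: doubly_stochastic_def)
  then show ?thesis using block_plan_couplings01 by blast
qed

lemma mincost_le: "\<gamma> \<in> couplings01 \<Longrightarrow> mincost t \<le> rcost t \<gamma>"
  unfolding mincost_def by (intro cINF_lower bdd_belowI2[of _ 0] rcost_nonneg)

lemma mincost_greatest: "(\<And>\<gamma>. \<gamma> \<in> couplings01 \<Longrightarrow> x \<le> rcost t \<gamma>) \<Longrightarrow> x \<le> mincost t"
  unfolding mincost_def by (intro cINF_greatest couplings01_nonempty)

lemma mincost_nonneg: "0 \<le> mincost t"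
  by (intro mincost_greatest rcost_nonneg)

lemma rcost_equicontinuous:
  assumes "e > 0"
  shows "\<forall>\<^sub>F t' in nhds t. \<forall>\<gamma>\<in>couplings01. \<bar>rcost t' \<gamma> - rcost t \<gamma>\<bar> \<le> e"
  using cost_equicontinuous[OF assms, of t]
  by eventually_elim (use assms in \<open>fastforce simp: cost_le_iff abs_le_iff\<close>)

lemma isCont_rcost:
  assumes "\<gamma> \<in> couplings01"
  shows "isCont (\<lambda>t. rcost t \<gamma>) t"
  by (rule isCont_if_abs_diff_le) (use rcost_equicontinuous assms in \<open>fast elim: eventually_mono\<close>)

lemma isCont_mincost: "isCont mincost t"
proof (rule isCont_if_abs_diff_le)
  fix e :: real assume "e > 0"
  from rcost_equicontinuous[OF this, of t]
  show "\<forall>\<^sub>F t' in nhds t. \<bar>mincost t' - mincost t\<bar> \<le> e"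
  proof eventually_elim
    case (elim t')
    have "mincost t' - e \<le> mincost t"
      by (rule mincost_greatest) (use elim mincost_le[of _ t'] in \<open>fastforce simp: abs_le_iff\<close>)
    moreover have "mincost t - e \<le> mincost t'"
      by (rule mincost_greatest) (use elim mincost_le[of _ t] in \<open>fastforce simp: abs_le_iff\<close>)
    ultimately show ?case by simp
  qed
qed

end

text \<open>
  The block plan with this matrix is the average of \<open>\<gamma>\<close> over the products of cells.
\<close>

definition cell_masses :: "nat \<Rightarrow> (real \<times> real) measure \<Rightarrow> nat \<Rightarrow> nat \<Rightarrow> real" where
  "cell_masses n \<gamma> k l = 2 ^ n * measure \<gamma> {z. cell n (fst z) = k \<and> cell n (snd z) = l}"

lemma cells_sets [measurable]: "{z::real\<times>real. cell n (fst z) = k \<and> cell n (snd z) = l} \<in> sets borel"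
proof -
  have "(\<lambda>z::real\<times>real. cell n (fst z)) \<in> borel \<rightarrow>\<^sub>M count_space UNIV" "(\<lambda>z::real\<times>real. cell n (snd z)) \<in> borel \<rightarrow>\<^sub>M count_space UNIV"
    by measurable
  then have "{z \<in> space (borel :: (real\<times>real) measure). cell n (fst z) = k \<and> cell n (snd z) = l} \<in> sets borel"
    by measurable
  then show ?thesis by simp
qed

lemma AE_couplings01_Ico:
  assumes \<gamma>: "\<gamma> \<in> couplings01"
  shows "AE z in \<gamma>. fst z \<in> {0..<1} \<and> snd z \<in> {0..<1}"
proof -
  note [measurable_cong] = couplings01_sets[OF \<gamma>]
  have m: "fst \<in> \<gamma> \<rightarrow>\<^sub>M (borel::real measure)" "snd \<in> \<gamma> \<rightarrow>\<^sub>M (borel::real measure)" by auto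
  have d: "distr \<gamma> borel fst = unif" "distr \<gamma> borel snd = unif"
    using \<gamma> by (auto simp: couplings01_def)
  have "AE v in distr \<gamma> borel fst. v \<in> {0..<1}" "AE v in distr \<gamma> borel snd. v \<in> {0..<1}"
    unfolding d by (rule AE_unif_Ico)+
  then show ?thesis
    using AE_distrD[OF m(1)] AE_distrD[OF m(2)] by force
qed

lemma nn_integral_cells:
  assumes \<gamma>: "\<gamma> \<in> couplings01"
  shows "(\<integral>\<^sup>+z. F (cell n (fst z)) (cell n (snd z)) \<partial>\<gamma>)
     = (\<Sum>k<2^n. \<Sum>l<2^n. ennreal (1 / 2^n) * (ennreal (cell_masses n \<gamma> k l) * F k l))"
proof -
  interpret prob_space \<gamma> by (rule couplings01_prob[OF \<gamma>])
  note [measurable_cong] = couplings01_sets[OF \<gamma>]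
  let ?S = "\<lambda>k l. {z::real\<times>real. cell n (fst z) = k \<and> cell n (snd z) = l}"
  have "(\<integral>\<^sup>+z. F (cell n (fst z)) (cell n (snd z)) \<partial>\<gamma>) = (\<integral>\<^sup>+z. (\<Sum>k<2^n. \<Sum>l<2^n. F k l * indicator (?S k l) z) \<partial>\<gamma>)"
  proof (rule nn_integral_cong_AE, use AE_couplings01_Ico[OF \<gamma>] in eventually_elim)
    case (elim z)
    then have c: "cell n (fst z) < 2^n" "cell n (snd z) < 2^n" by (auto intro!: cell_less)
    have "(\<Sum>k<2^n. \<Sum>l<2^n. F k l * indicator (?S k l) z)
       = (\<Sum>k<2^n. if k = cell n (fst z) then (\<Sum>l<2^n. if l = cell n (snd z) then F k l else 0) else 0)"
      by (intro sum.cong refl) (auto simp: indicator_def intro!: sum.cong sum.neutral)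
    also have "\<dots> = F (cell n (fst z)) (cell n (snd z))"
      using c by simp
    finally show ?case ..
  qed
  also have "\<dots> = (\<Sum>k<2^n. \<Sum>l<2^n. F k l * emeasure \<gamma> (?S k l))"
  proof -
    have "(\<lambda>z. F k l * indicator (?S k l) z) \<in> borel_measurable \<gamma>" for k l
      by measurable
    moreover have "(\<integral>\<^sup>+z. F k l * indicator (?S k l) z \<partial>\<gamma>) = F k l * emeasure \<gamma> (?S k l)" for k l
      by (intro nn_integral_cmult_indicator) (simp add: couplings01_sets[OF \<gamma>])
    ultimately show ?thesis
      by (subst nn_integral_sum, (intro borel_measurable_sum; simp), intro sum.cong refl)
         (subst nn_integral_sum; simp)
  qed
  also have "\<dots> = (\<Sum>k<2^n. \<Sum>l<2^n. ennreal (1 / 2^n) * (ennreal (cell_masses n \<gamma> k l) * F k l))"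
  proof (intro sum.cong refl)
    fix k l
    have "ennreal (1 / 2^n) * ennreal (cell_masses n \<gamma> k l) = emeasure \<gamma> (?S k l)"
      unfolding cell_masses_def emeasure_eq_measure by (simp flip: ennreal_mult')
    then show "F k l * emeasure \<gamma> (?S k l) = ennreal (1 / 2^n) * (ennreal (cell_masses n \<gamma> k l) * F k l)"
      by (metis mult.assoc mult.commute)
  qed
  finally show ?thesis .
qed

lemma measurable_cell_indicator [measurable]:
  "(\<lambda>v. indicator {k} (cell n v) :: ennreal) \<in> borel_measurable borel"
  by (rule measurable_compose[OF measurable_cell]) simp

lemma nn_integral_unif_cell:
  assumes "k < 2^n"
  shows "(\<integral>\<^sup>+v. indicator {k} (cell n v) \<partial>unif) = ennreal (1 / 2^n)"
proof -
  have "(\<integral>\<^sup>+v. indicator {k} (cell n v) \<partial>unif) = (\<Sum>j<2^n. ennreal (1 / 2^n) * (\<integral>\<^sup>+s. indicator {k} j \<partial>unif))"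
    by (rule nn_integral_unif_cells[of "\<lambda>j v. indicator {k} j"]) simp
  also have "\<dots> = (\<Sum>j<2^n. if j = k then ennreal (1 / 2^n) else 0)"
    by (intro sum.cong) (auto simp: unif.emeasure_space_1[simplified])
  finally show ?thesis using assms by simp
qed

lemma doubly_stochastic_cell_masses:
  assumes \<gamma>: "\<gamma> \<in> couplings01"
  shows "doubly_stochastic n (cell_masses n \<gamma>)"
proof -
  have nn: "0 \<le> cell_masses n \<gamma> k l" for k l by (simp add: cell_masses_def)
  have aux: "s = 1" if "ennreal (1 / 2^n) * ennreal s = ennreal (1 / 2^n)" "0 \<le> s" for s :: real
    using that by (simp flip: ennreal_mult')
  have row: "(\<Sum>l<2^n. cell_masses n \<gamma> k l) = 1" if k: "k < 2^n" for k
  proof (rule aux)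
    have "(\<integral>\<^sup>+z. indicator {k} (cell n (fst z)) \<partial>\<gamma>) = (\<integral>\<^sup>+v. indicator {k} (cell n v) \<partial>unif)"
      by (rule couplings01_fst[OF \<gamma>]) simp
    then have "ennreal (1 / 2^n) = (\<integral>\<^sup>+z. indicator {k} (cell n (fst z)) \<partial>\<gamma>)"
      unfolding nn_integral_unif_cell[OF k] by (rule sym)
    also have "\<dots> = (\<Sum>k'<2^n. \<Sum>l<2^n. ennreal (1 / 2^n) * (ennreal (cell_masses n \<gamma> k' l) * indicator {k} k'))"
      by (rule nn_integral_cells[OF \<gamma>])
    also have "\<dots> = (\<Sum>k'<2^n. if k' = k then (\<Sum>l<2^n. ennreal (1 / 2^n) * ennreal (cell_masses n \<gamma> k' l)) else 0)"
      by (intro sum.cong) auto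
    also have "\<dots> = (\<Sum>l<2^n. ennreal (1 / 2^n) * ennreal (cell_masses n \<gamma> k l))"
      using k by simp
    also have "\<dots> = ennreal (1 / 2^n) * ennreal (\<Sum>l<2^n. cell_masses n \<gamma> k l)"
      by (simp add: sum_distrib_left[symmetric] sum_ennreal nn)
    finally show "ennreal (1 / 2^n) * ennreal (\<Sum>l<2^n. cell_masses n \<gamma> k l) = ennreal (1 / 2^n)" ..
  qed (simp add: sum_nonneg nn)
  have col: "(\<Sum>k<2^n. cell_masses n \<gamma> k l) = 1" if l: "l < 2^n" for l
  proof (rule aux)
    have "(\<integral>\<^sup>+z. indicator {l} (cell n (snd z)) \<partial>\<gamma>) = (\<integral>\<^sup>+v. indicator {l} (cell n v) \<partial>unif)"
      by (rule couplings01_snd[OF \<gamma>]) simp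
    then have "ennreal (1 / 2^n) = (\<integral>\<^sup>+z. indicator {l} (cell n (snd z)) \<partial>\<gamma>)"
      unfolding nn_integral_unif_cell[OF l] by (rule sym)
    also have "\<dots> = (\<Sum>k<2^n. \<Sum>l'<2^n. ennreal (1 / 2^n) * (ennreal (cell_masses n \<gamma> k l') * indicator {l} l'))"
      by (rule nn_integral_cells[OF \<gamma>])
    also have "\<dots> = (\<Sum>k<2^n. \<Sum>l'<2^n. if l' = l then ennreal (1 / 2^n) * ennreal (cell_masses n \<gamma> k l') else 0)"
      by (intro sum.cong) auto
    also have "\<dots> = (\<Sum>k<2^n. ennreal (1 / 2^n) * ennreal (cell_masses n \<gamma> k l))"
      using l by simp
    also have "\<dots> = ennreal (1 / 2^n) * ennreal (\<Sum>k<2^n. cell_masses n \<gamma> k l)"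
      by (simp add: sum_distrib_left[symmetric] sum_ennreal nn)
    finally show "ennreal (1 / 2^n) * ennreal (\<Sum>k<2^n. cell_masses n \<gamma> k l) = ennreal (1 / 2^n)" ..
  qed (simp add: sum_nonneg nn)
  show ?thesis unfolding doubly_stochastic_def using nn row col by blast
qed

lemma nn_integral_block_plan_sum:
  assumes F [measurable]: "F \<in> borel_measurable borel"
  shows "(\<integral>\<^sup>+z. F z \<partial>block_plan n D) = (\<Sum>k<2^n. \<Sum>l<2^n. ennreal (D k l) *
     (ennreal (1 / 2^n) * (\<integral>\<^sup>+s. \<integral>\<^sup>+s'. F ((real k + s) / 2^n, (real l + s') / 2^n) \<partial>unif \<partial>unif)))"
proof -
  have sec [measurable]: "(\<lambda>v. \<integral>\<^sup>+s'. F (v, (real l + s') / 2^n) \<partial>unif) \<in> borel_measurable borel" for l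
  proof (rule unif.borel_measurable_nn_integral)
    have "(\<lambda>z::real\<times>real. (fst z, (real l + snd z) / 2^n)) \<in> borel \<rightarrow>\<^sub>M borel"
      by (intro borel_measurable_continuous_onI continuous_intros) auto
    then have "(\<lambda>z. F (fst z, (real l + snd z) / 2^n)) \<in> borel_measurable borel"
      by measurable
    then show "(\<lambda>(v, s'). F (v, (real l + s') / 2^n)) \<in> borel_measurable (borel \<Otimes>\<^sub>M unif)"
      using measurable_cong_sets[OF sets_pair_measure_cong[OF refl sets_unif], of borel borel borel]
      by (simp add: case_prod_beta borel_prod)
  qed
  have "(\<integral>\<^sup>+z. F z \<partial>block_plan n D) = (\<integral>\<^sup>+v. (\<Sum>l<2^n. ennreal (D (cell n v) l) * (\<integral>\<^sup>+s'. F (v, (real l + s') / 2^n) \<partial>unif)) \<partial>unif)"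
    by (simp add: nn_integral_block_plan nn_integral_block_density)
  also have "\<dots> = (\<Sum>k<2^n. ennreal (1 / 2^n) * (\<integral>\<^sup>+s. (\<Sum>l<2^n. ennreal (D k l) *
      (\<integral>\<^sup>+s'. F ((real k + s) / 2^n, (real l + s') / 2^n) \<partial>unif)) \<partial>unif))"
    by (rule nn_integral_unif_cells[of "\<lambda>k v. \<Sum>l<2^n. ennreal (D k l) * (\<integral>\<^sup>+s'. F (v, (real l + s') / 2^n) \<partial>unif)"]) simp
  also have "\<dots> = (\<Sum>k<2^n. ennreal (1 / 2^n) * (\<Sum>l<2^n. ennreal (D k l) *
      (\<integral>\<^sup>+s. \<integral>\<^sup>+s'. F ((real k + s) / 2^n, (real l + s') / 2^n) \<partial>unif \<partial>unif)))"
  proof (intro sum.cong refl arg_cong2[where f="(*)"])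
    fix k
    have [measurable]: "(\<lambda>s. \<integral>\<^sup>+s'. F ((real k + s) / 2^n, (real l + s') / 2^n) \<partial>unif) \<in> borel_measurable borel" for l
      using measurable_compose[OF _ sec, of "\<lambda>s. (real k + s) / 2^n" borel l] by simp
    show "(\<integral>\<^sup>+s. (\<Sum>l<2^n. ennreal (D k l) * (\<integral>\<^sup>+s'. F ((real k + s) / 2^n, (real l + s') / 2^n) \<partial>unif)) \<partial>unif)
       = (\<Sum>l<2^n. ennreal (D k l) * (\<integral>\<^sup>+s. \<integral>\<^sup>+s'. F ((real k + s) / 2^n, (real l + s') / 2^n) \<partial>unif \<partial>unif))"
      by (simp add: nn_integral_sum nn_integral_cmult)
  qed
  finally show ?thesis by (simp add: sum_distrib_left mult.left_commute)
qed

lemma same_cells_cell_masses: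
  assumes \<gamma>: "\<gamma> \<in> couplings01"
  shows "same_cells n \<gamma> (block_plan n (cell_masses n \<gamma>))"
  unfolding same_cells_def
proof
  fix F :: "nat \<Rightarrow> nat \<Rightarrow> ennreal"
  have i: "(\<integral>\<^sup>+s. \<integral>\<^sup>+s'. F (cell n ((real k + s) / 2^n)) (cell n ((real l + s') / 2^n)) \<partial>unif \<partial>unif) = F k l" for k l
  proof -
    have "(\<integral>\<^sup>+s. \<integral>\<^sup>+s'. F (cell n ((real k + s) / 2^n)) (cell n ((real l + s') / 2^n)) \<partial>unif \<partial>unif)
       = (\<integral>\<^sup>+s. \<integral>\<^sup>+s'. F k l \<partial>unif \<partial>unif)"
      by (rule nn_integral_cong_AE, rule eventually_mono[OF AE_unif_Ico],
          rule nn_integral_cong_AE, rule eventually_mono[OF AE_unif_Ico]) (simp add: cell_block)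
    then show ?thesis by (simp add: unif.emeasure_space_1[simplified])
  qed
  show "(\<integral>\<^sup>+z. F (cell n (fst z)) (cell n (snd z)) \<partial>\<gamma>)
      = (\<integral>\<^sup>+z. F (cell n (fst z)) (cell n (snd z)) \<partial>block_plan n (cell_masses n \<gamma>))"
    by (simp add: nn_integral_cells[OF \<gamma>] nn_integral_block_plan_sum i mult.left_commute)
qed

context kernel_family begin

text \<open>
  For a fixed level the cost is linear in the matrix, hence continuous, which makes a countable
  dense set of matrices sufficient.  The coefficients are finite because the uniform matrix has
  finite cost.
\<close>

lemma rcost_block_plan_linear:
  "\<exists>c. \<forall>D. doubly_stochastic n D \<longrightarrow> rcost t (block_plan n D) = (\<Sum>k<2^n. \<Sum>l<2^n. D k l * c k l)"
proof -
  define c where "c k l = ennreal (1 / 2^n) * (\<integral>\<^sup>+s. \<integral>\<^sup>+s'. ennreal (H ((real k + s) / 2^n) ((real l + s') / 2^n) t) \<partial>unif \<partial>unif)" for k l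
  have eq: "cost t (block_plan n D) = (\<Sum>k<2^n. \<Sum>l<2^n. ennreal (D k l) * c k l)" for D
    unfolding cost_def c_def using nn_integral_block_plan_sum[of "\<lambda>z. ennreal (H (fst z) (snd z) t)" n D] by simp
  have fin: "c k l < \<infinity>" if kl: "k < 2^n" "l < 2^n" for k l
  proof -
    have u: "doubly_stochastic n (\<lambda>_ _. 1 / 2^n)" by (simp add: doubly_stochastic_def)
    have "ennreal (1 / 2^n) * c k l \<le> (\<Sum>l<2^n. ennreal (1 / 2^n) * c k l)"
      using kl by (intro member_le_sum[of l "{..<2^n}" "\<lambda>l. ennreal (1 / 2^n) * c k l"]) auto
    also have "\<dots> \<le> (\<Sum>k<2^n. \<Sum>l<2^n. ennreal (1 / 2^n) * c k l)"
      using kl by (intro member_le_sum[of k "{..<2^n}" "\<lambda>k. \<Sum>l<2^n. ennreal (1 / 2^n) * c k l"]) auto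
    also have "\<dots> < \<infinity>"
      using cost_finite[OF block_plan_couplings01[OF u], of t] by (simp add: eq)
    finally show ?thesis
      by (auto simp: ennreal_mult_less_top)
  qed
  show ?thesis
  proof (intro exI allI impI)
    fix D assume D: "doubly_stochastic n D"
    have "cost t (block_plan n D) = (\<Sum>k<2^n. \<Sum>l<2^n. ennreal (D k l * enn2real (c k l)))"
      unfolding eq using D fin by (intro sum.cong refl) (auto simp: doubly_stochastic_def ennreal_mult')
    also have "\<dots> = (\<Sum>k<2^n. ennreal (\<Sum>l<2^n. D k l * enn2real (c k l)))"
      using D by (intro sum.cong refl sum_ennreal) (auto simp: doubly_stochastic_def)
    also have "\<dots> = ennreal (\<Sum>k<2^n. \<Sum>l<2^n. D k l * enn2real (c k l))"
      using D by (intro sum_ennreal sum_nonneg) (auto simp: doubly_stochastic_def)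
    finally show "rcost t (block_plan n D) = (\<Sum>k<2^n. \<Sum>l<2^n. D k l * enn2real (c k l))"
      using D unfolding rcost_def by (auto simp: doubly_stochastic_def intro!: enn2real_ennreal sum_nonneg)
  qed
qed

text \<open>
  A nearly optimal coupling may be averaged over the cells of a fine level without changing its cost
  much; the resulting matrix is then approximated by one from a countable dense set of doubly
  stochastic matrices of that level, which exists because the space of all real matrices is second
  countable.
\<close>

lemma countable_block_family:
  obtains lvl :: "nat \<Rightarrow> nat" and D where "plan_family lvl D"
    "\<And>t e. e > 0 \<Longrightarrow> \<exists>j. rcost t (block_plan (lvl j) (D j)) < mincost t + e"
proof -
  have "\<exists>T. countable T \<and> T \<subseteq> Collect (doubly_stochastic n) \<and> Collect (doubly_stochastic n) \<subseteq> closure T" for n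
    using separable[of "Collect (doubly_stochastic n)"] by metis
  then obtain T where T: "\<And>n. countable (T n)" "\<And>n. T n \<subseteq> Collect (doubly_stochastic n)"
    "\<And>n. Collect (doubly_stochastic n) \<subseteq> closure (T n)" by metis
  define E where "E = (SIGMA n:UNIV. T n)"
  have cE: "countable E" unfolding E_def using T(1) by (intro countable_SIGMA) auto
  have dense: "\<exists>x\<in>E. rcost t (block_plan (fst x) (snd x)) < mincost t + e" if "e > 0" for t e
  proof -
    obtain \<gamma> where \<gamma>: "\<gamma> \<in> couplings01" "rcost t \<gamma> < mincost t + e/3"
    proof -
      have "\<not> (\<forall>\<gamma>\<in>couplings01. mincost t + e/3 \<le> rcost t \<gamma>)"
        using mincost_greatest[of "mincost t + e/3" t] \<open>e > 0\<close> by force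
      then show thesis using that by (auto simp: not_le)
    qed
    obtain n where n: "\<forall>m'\<ge>n. \<forall>\<gamma>\<in>couplings01. \<forall>\<gamma>'\<in>couplings01. same_cells m' \<gamma> \<gamma>' \<longrightarrow> cost t \<gamma> \<le> cost t \<gamma>' + ennreal (e/3)"
      using cost_same_cells[of "e/3" t] \<open>e > 0\<close> by auto
    define D0 where "D0 = cell_masses n \<gamma>"
    have D0: "doubly_stochastic n D0" unfolding D0_def by (rule doubly_stochastic_cell_masses[OF \<gamma>(1)])
    have "same_cells n (block_plan n D0) \<gamma>"
      using same_cells_cell_masses[OF \<gamma>(1)] by (simp add: D0_def same_cells_def)
    then have "cost t (block_plan n D0) \<le> cost t \<gamma> + ennreal (e/3)"
      using n block_plan_couplings01[OF D0] \<gamma>(1) by blast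
    then have r0: "rcost t (block_plan n D0) \<le> rcost t \<gamma> + e/3"
      using that by (subst (asm) cost_le_iff) (auto intro: block_plan_couplings01 D0 \<gamma>(1))
    obtain c where c: "\<And>D. doubly_stochastic n D \<Longrightarrow> rcost t (block_plan n D) = (\<Sum>k<2^n. \<Sum>l<2^n. D k l * c k l)"
      using rcost_block_plan_linear[of n t] by auto
    define \<phi> where "\<phi> D = (\<Sum>k<2^n. \<Sum>l<2^n. D k l * c k l)" for D :: "nat \<Rightarrow> nat \<Rightarrow> real"
    have co: "continuous_on UNIV (\<lambda>D::nat \<Rightarrow> nat \<Rightarrow> real. D k l)" for k l
      by (rule continuous_on_compose2[OF continuous_on_product_coordinates[of l] continuous_on_product_coordinates[of k]]) auto
    have "continuous_on UNIV \<phi>"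
      unfolding \<phi>_def by (intro continuous_intros co)
    then have "open {D. \<phi> D < \<phi> D0 + e/3}"
      by (intro open_Collect_less continuous_intros)
    moreover have "D0 \<in> closure (T n)" "D0 \<in> {D. \<phi> D < \<phi> D0 + e/3}"
      using T(3)[of n] D0 that by auto
    ultimately have "T n \<inter> {D. \<phi> D < \<phi> D0 + e/3} \<noteq> {}"
      using closure_iff_nhds_not_empty[of D0 "T n"] by blast
    then obtain D' where D': "D' \<in> T n" "\<phi> D' < \<phi> D0 + e/3"
      by auto
    have "rcost t (block_plan n D') < mincost t + e"
      using D' T(2)[of n] c[of D'] c[OF D0] r0 \<gamma>(2) by (auto simp: \<phi>_def)
    then show ?thesis using D' by (intro bexI[of _ "(n, D')"]) (auto simp: E_def)
  qed
  then have "E \<noteq> {}" using zero_less_one by blast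
  define x where "x = from_nat_into E"
  have rx: "range x = E" unfolding x_def using cE \<open>E \<noteq> {}\<close> by (rule range_from_nat_into[rotated])
  show thesis
  proof (rule that[of "\<lambda>j. fst (x j)" "\<lambda>j. snd (x j)"])
    show "plan_family (\<lambda>j. fst (x j)) (\<lambda>j. snd (x j))"
    proof
      fix j have "x j \<in> E" using rx by auto
      then show "doubly_stochastic (fst (x j)) (snd (x j))" using T(2) unfolding E_def by fastforce
    qed
    fix t and e :: real assume "e > 0"
    from dense[OF this] rx show "\<exists>j. rcost t (block_plan (fst (x j)) (snd (x j))) < mincost t + e"
      by (metis rangeE)
  qed
qed

end

section \<open>Continuous selection of maps on the interval\<close>

lemma summable_half_weights:
  fixes a :: "nat \<Rightarrow> real"
  assumes "\<And>j. 0 \<le> a j" "\<And>j. a j \<le> 1"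
  shows "summable (\<lambda>j. (1/2) ^ Suc j * a j)"
proof (rule summable_comparison_test')
  show "summable (\<lambda>j. (1/2::real) ^ Suc j)" using power_half_series by (rule sums_summable)
  fix j show "norm ((1/2) ^ Suc j * a j) \<le> (1/2) ^ Suc j"
    using assms[of j] by (simp add: abs_mult mult_left_le)
qed

lemma continuous_half_weights:
  fixes f :: "nat \<Rightarrow> 'a::topological_space \<Rightarrow> real"
  assumes cont: "\<And>j. continuous_on UNIV (f j)" and f: "\<And>j t. 0 \<le> f j t" "\<And>j t. f j t \<le> 1"
  shows "continuous_on UNIV (\<lambda>t. \<Sum>j. (1/2) ^ Suc j * f j t)"
proof (rule uniform_limit_theorem)
  show "uniform_limit UNIV (\<lambda>n t. \<Sum>j<n. (1/2) ^ Suc j * f j t) (\<lambda>t. \<Sum>j. (1/2) ^ Suc j * f j t) sequentially"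
  proof (rule Weierstrass_m_test)
    show "summable (\<lambda>j. (1/2::real) ^ Suc j)" using power_half_series by (rule sums_summable)
    fix j and t :: 'a show "norm ((1/2) ^ Suc j * f j t) \<le> (1/2) ^ Suc j"
      using f[of j t] by (simp add: abs_mult mult_left_le)
  qed
  show "\<forall>\<^sub>F n in sequentially. continuous_on UNIV (\<lambda>t. \<Sum>j<n. (1/2) ^ Suc j * f j t)"
    by (intro always_eventually allI continuous_intros cont)
qed simp

text \<open>
  A partition of unity is not needed to pick indices continuously from an increasing open cover.
  The sum \<open>g\<close> of the truncated distances to the complements with weights \<open>(1/2) ^ (m + 1)\<close> is
  positive and continuous, and outside \<open>V m\<close> it is at most \<open>(1/2) ^ m\<close>; so a level one above
  the binary logarithm of \<open>1 / g\<close> is large enough.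
\<close>

lemma continuous_level_function:
  fixes V :: "nat \<Rightarrow> 't::metric_space set"
  assumes op: "\<And>m. open (V m)" and mono: "\<And>m n. m \<le> n \<Longrightarrow> V m \<subseteq> V n" and cover: "(\<Union>m. V m) = UNIV"
  obtains l :: "'t \<Rightarrow> real" where "continuous_on UNIV l" "\<And>t. 1 \<le> l t" "\<And>t. t \<in> V (nat \<lfloor>l t\<rfloor>)"
proof -
  \<comment> \<open>the distance to the empty set is 0 by convention, hence the case distinction\<close>
  define d where "d m t = (if V m = UNIV then 1 else min 1 (infdist t (- V m)))" for m t
  have d01: "0 \<le> d m t" "d m t \<le> 1" for m t
    by (auto simp: d_def infdist_nonneg)
  have dc: "continuous_on UNIV (d m)" for m
    unfolding d_def by (cases "V m = UNIV") (auto intro!: continuous_intros)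
  have d0: "d m t = 0" if "t \<notin> V m" for m t
    using that by (auto simp: d_def)
  have dpos: "0 < d m t" if "t \<in> V m" for m t
  proof (cases "V m = UNIV")
    case False
    then have "infdist t (- V m) \<noteq> 0"
      using that op[of m] in_closed_iff_infdist_zero[of "- V m" t] by auto
    then show ?thesis using infdist_nonneg[of t "- V m"] by (auto simp: d_def)
  qed (simp add: d_def)
  define g where "g t = (\<Sum>m. (1/2) ^ Suc m * d m t)" for t
  have sm: "summable (\<lambda>m. (1/2) ^ Suc m * d m t)" for t
    by (intro summable_half_weights d01)
  have gpos: "0 < g t" for t
  proof -
    obtain m where "t \<in> V m" using cover by auto
    then show ?thesis unfolding g_def
      by (intro suminf_pos2[OF sm, of _ m]) (auto simp: d01 dpos)
  qed
  have tail: "g t \<le> (1/2) ^ m" if "t \<notin> V m" for t m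
  proof -
    have z: "d i t = 0" if "i < m" for i
      using mono[of i m] that \<open>t \<notin> V m\<close> by (intro d0) auto
    have "g t = (\<Sum>i. (1/2) ^ Suc (i + m) * d (i + m) t) + (\<Sum>i<m. (1/2) ^ Suc i * d i t)"
      unfolding g_def by (rule suminf_split_initial_segment[OF sm])
    also have "\<dots> = (\<Sum>i. (1/2) ^ Suc (i + m) * d (i + m) t)"
      using z by simp
    also have "\<dots> \<le> (\<Sum>i. (1/2) ^ m * (1/2) ^ Suc i)"
    proof (rule suminf_le)
      fix i show "(1/2) ^ Suc (i + m) * d (i + m) t \<le> (1/2) ^ m * (1/2) ^ Suc i"
        using d01(2)[of "i + m" t] by (simp add: power_add mult_left_le)
      show "summable (\<lambda>i. (1/2) ^ Suc (i + m) * d (i + m) t)"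
        using summable_ignore_initial_segment[OF sm[of t], of m] by simp
      show "summable (\<lambda>i. (1/2) ^ m * (1/2::real) ^ Suc i)"
        by (intro summable_mult sums_summable[OF power_half_series])
    qed
    also have "\<dots> = (1/2) ^ m"
      using sums_unique[OF sums_mult[OF power_half_series, of "(1/2) ^ m"]] by simp
    finally show ?thesis .
  qed
  have g1: "g t \<le> 1" for t
  proof -
    have "g t \<le> (\<Sum>m. (1/2) ^ Suc m)"
      unfolding g_def using d01 by (intro suminf_le sm sums_summable[OF power_half_series]) (simp add: mult_left_le)
    then show ?thesis using sums_unique[OF power_half_series] by simp
  qed
  define l where "l t = 1 - log 2 (g t)" for t
  show thesis
  proof
    show "continuous_on UNIV l"
      unfolding l_def log_def g_def using gpos
      by (intro continuous_intros continuous_half_weights dc d01) (auto simp: g_def less_imp_neq[symmetric])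
    show l1: "1 \<le> l t" for t
      using gpos[of t] g1[of t] by (simp add: l_def)
    show "t \<in> V (nat \<lfloor>l t\<rfloor>)" for t
    proof (rule ccontr)
      assume "t \<notin> V (nat \<lfloor>l t\<rfloor>)"
      define m where "m = nat \<lfloor>l t\<rfloor>"
      have "real m > l t - 1" using l1[of t] unfolding m_def by linarith
      then have "- real m < log 2 (g t)" by (simp add: l_def)
      then have "2 powr (- real m) < g t"
        using gpos[of t] by (simp add: less_log_iff)
      then have "(1/2) ^ m < g t"
        by (simp add: powr_minus powr_realpow power_one_over inverse_eq_divide)
      with tail[of t m] \<open>t \<notin> V (nat \<lfloor>l t\<rfloor>)\<close> show False by (simp add: m_def)
    qed
  qed
qed

text \<open>
  A level \<open>m\<close> is good at \<open>t\<close> if some nearly optimal plan of the family has level below \<open>m\<close> and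
  couplings with the same cells of level \<open>m\<close> or finer have nearly the same cost.  By
  equicontinuity the interiors of these conditions cover the parameter space, so a continuous
  function \<open>l\<close> with values in good levels exists.  The weight of plan \<open>j\<close> at \<open>t\<close> is, up to
  normalization, \<open>(1/2) ^ (j + 1)\<close> times the amounts, cut off at 1, by which its cost stays below
  the optimal cost plus \<open>e / 2\<close> and its level stays below \<open>l t\<close>; so it vanishes for plans that
  are not nearly optimal or are too fine.
\<close>

theorem (in kernel_family) continuous_monge_selection:
  assumes "e > 0"
  shows "\<exists>r :: 't \<Rightarrow> real \<Rightarrow> real.
     (\<forall>t. r t \<in> borel_measurable borel \<and> distr unif borel (r t) = unif \<and>
        (\<forall>\<gamma>\<in>couplings01. (\<integral>\<^sup>+v. ennreal (H v (r t v) t) \<partial>unif) \<le> cost t \<gamma> + ennreal e)) \<and>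
     (\<forall>t s. s \<longlonglongrightarrow> t \<longrightarrow> (AE v in unif. (\<lambda>n. r (s n) v) \<longlonglongrightarrow> r t v))"
proof -
  obtain lvl D where "plan_family lvl D"
    and dense: "\<And>t e. e > 0 \<Longrightarrow> \<exists>j. rcost t (block_plan (lvl j) (D j)) < mincost t + e"
    by (rule countable_block_family) metis
  interpret plan_family lvl D by fact
  define bp where "bp j = block_plan (lvl j) (D j)" for j
  have bp: "bp j \<in> couplings01" for j unfolding bp_def by (rule block_plan_couplings01[OF stochastic])
  define good where "good m t \<longleftrightarrow> (\<exists>j. lvl j < m \<and> rcost t (bp j) < mincost t + e/2) \<and>
     (\<forall>m'\<ge>m. \<forall>\<gamma>\<in>couplings01. \<forall>\<gamma>'\<in>couplings01. same_cells m' \<gamma> \<gamma>' \<longrightarrow> rcost t \<gamma> \<le> rcost t \<gamma>' + e/2)" for m t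
  define U where "U m = interior {t. good m t}" for m
  have cover: "\<exists>m. t \<in> U m" for t
  proof -
    obtain j where j: "rcost t (bp j) < mincost t + e/2"
      using dense[of "e/2" t] assms by (auto simp: bp_def)
    obtain m where m: "\<forall>m'\<ge>m. \<forall>\<gamma>\<in>couplings01. \<forall>\<gamma>'\<in>couplings01. same_cells m' \<gamma> \<gamma>' \<longrightarrow> cost t \<gamma> \<le> cost t \<gamma>' + ennreal (e/6)"
      using cost_same_cells[of "e/6" t] assms by auto
    have "isCont (\<lambda>t. mincost t + e/2 - rcost t (bp j)) t"
      by (intro continuous_intros isCont_mincost isCont_rcost bp)
    then have "\<forall>\<^sub>F t' in nhds t. 0 < mincost t' + e/2 - rcost t' (bp j)"
      using j tendsto_at_iff_tendsto_nhds[of "\<lambda>t. mincost t + e/2 - rcost t (bp j)" t]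
      unfolding isCont_def by (intro order_tendstoD(1)[where y="mincost t + e/2 - rcost t (bp j)"]) auto
    moreover have "\<forall>\<^sub>F t' in nhds t. \<forall>\<gamma>\<in>couplings01. \<bar>rcost t' \<gamma> - rcost t \<gamma>\<bar> \<le> e/6"
      using assms by (intro rcost_equicontinuous) auto
    ultimately have "\<forall>\<^sub>F t' in nhds t. good (max m (Suc (lvl j))) t'"
    proof eventually_elim
      case (elim t')
      have "rcost t' \<gamma> \<le> rcost t' \<gamma>' + e/2"
        if "m' \<ge> m" "\<gamma> \<in> couplings01" "\<gamma>' \<in> couplings01" "same_cells m' \<gamma> \<gamma>'" for m' \<gamma> \<gamma>'
      proof -
        have "rcost t \<gamma> \<le> rcost t \<gamma>' + e/6"
          using m that assms by (subst cost_le_iff[symmetric]) auto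
        moreover have "\<bar>rcost t' \<gamma> - rcost t \<gamma>\<bar> \<le> e/6" "\<bar>rcost t' \<gamma>' - rcost t \<gamma>'\<bar> \<le> e/6"
          using elim(2) that(2,3) by blast+
        ultimately show ?thesis by linarith
      qed
      then show ?case unfolding good_def using elim(1) by (auto intro!: exI[of _ j])
    qed
    then show ?thesis
      unfolding U_def by (auto simp: eventually_nhds intro!: interiorI exI[of _ "max m (Suc (lvl j))"])
  qed
  have U_mono: "U m \<subseteq> U n" if "m \<le> n" for m n
  proof -
    have "good n t" if "good m t" for t
      using that \<open>m \<le> n\<close> unfolding good_def by (meson le_trans less_le_trans)
    then show ?thesis unfolding U_def by (intro interior_mono) auto
  qed
  obtain l :: "'t \<Rightarrow> real" where l: "continuous_on UNIV l" "\<And>t. 1 \<le> l t" "\<And>t. t \<in> U (nat \<lfloor>l t\<rfloor>)"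
  proof (rule continuous_level_function[of U])
    show "open (U m)" for m by (simp add: U_def)
    show "(\<Union>m. U m) = UNIV" using cover by auto
  qed (use U_mono in auto)
  define lev where "lev t = nat \<lfloor>l t\<rfloor>" for t
  have good: "good (lev t) t" for t
    using l(3)[of t] interior_subset unfolding U_def lev_def by blast
  define f where "f j t = min 1 (max 0 (mincost t + e/2 - rcost t (bp j))) * min 1 (max 0 (l t - real (lvl j)))" for j t
  have f01: "0 \<le> f j t" "f j t \<le> 1" for j t
    unfolding f_def by (auto intro!: mult_le_one)
  have fc: "continuous_on UNIV (f j)" for j
    unfolding f_def using l(1) isCont_mincost isCont_rcost[OF bp]
    by (intro continuous_intros) (auto simp: continuous_on_eq_continuous_at)
  define Z where "Z t = (\<Sum>j. (1/2) ^ Suc j * f j t)" for t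
  have sm: "summable (\<lambda>j. (1/2) ^ Suc j * f j t)" for t
    by (intro summable_half_weights f01)
  have Zpos: "0 < Z t" for t
  proof -
    obtain j where j: "lvl j < lev t" "rcost t (bp j) < mincost t + e/2"
      using good[of t] by (auto simp: good_def)
    then have "real (lvl j) < l t" unfolding lev_def by linarith
    with j have "0 < f j t" by (simp add: f_def)
    then show ?thesis unfolding Z_def
      by (intro suminf_pos2[OF sm, of _ j]) (auto simp: f01)
  qed
  have Zc: "continuous_on UNIV Z"
    unfolding Z_def by (intro continuous_half_weights fc f01)
  define q where "q t j = (1/2) ^ Suc j * f j t / Z t" for t j
  have q: "weights (q t)" for t
  proof
    show "0 \<le> q t i" for i using Zpos[of t] f01 by (simp add: q_def)
    have "(\<lambda>j. (1/2) ^ Suc j * f j t / Z t) sums (Z t / Z t)"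
      unfolding Z_def by (intro sums_divide summable_sums sm)
    then show "q t sums 1" using Zpos[of t] by (simp add: q_def[abs_def])
  qed
  have qc: "(\<lambda>n. q (s n) j) \<longlonglongrightarrow> q t j" if "s \<longlonglongrightarrow> t" for s t j
  proof -
    have "isCont (f j) t" "isCont Z t"
      using fc Zc by (auto simp: continuous_on_eq_continuous_at)
    then show ?thesis unfolding q_def using Zpos[of t] that
      by (intro tendsto_intros isCont_tendsto_compose[where g="f j"] isCont_tendsto_compose[where g=Z]) auto
  qed
  have qnz: "real (lvl j) < l t" "rcost t (bp j) < mincost t + e/2" if "q t j \<noteq> 0" for t j
    using that by (auto simp: q_def f_def max_def min_def split: if_splits)
  have lb: "level_bound (q t) (lev t)" for t
    unfolding level_bound_def lev_def using qnz(1)[of t] by (force simp: le_nat_iff le_floor_iff)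
  have mixcost: "rcost t (mix (q t)) \<le> mincost t + e/2" for t
  proof -
    have "cost t (mix (q t)) = (\<Sum>j. ennreal (q t j) * cost t (bp j))"
      unfolding cost_def bp_def by (rule nn_integral_mix) simp
    also have "\<dots> \<le> (\<Sum>j. ennreal (q t j) * ennreal (mincost t + e/2))"
    proof (intro suminf_le summableI)
      fix j show "ennreal (q t j) * cost t (bp j) \<le> ennreal (q t j) * ennreal (mincost t + e/2)"
        using qnz(2)[of t j] by (cases "q t j = 0") (auto simp: cost_rcost[OF bp] intro!: mult_left_mono ennreal_leI)
    qed
    also have "\<dots> = ennreal (mincost t + e/2)"
      unfolding ennreal_suminf_multc suminf_ennreal_eq[OF weights.p_nonneg[OF q] weights.p_sums[OF q]] by simp
    finally show ?thesis
      unfolding cost_rcost[OF mix_couplings01[OF q]]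
      using assms mincost_nonneg[of t] by (subst (asm) ennreal_le_iff) auto
  qed
  define r where "r t = monge (q t) (l t)" for t
  show ?thesis
  proof (intro exI[of _ r] conjI allI impI)
    fix t
    note gp = graph_plan_couplings01[OF q lb lev_def[symmetric]]
    show rm [measurable]: "r t \<in> borel_measurable borel"
      unfolding r_def by (rule measurable_monge[OF lb])
    show "distr unif borel (r t) = unif"
    proof (rule distr_eq_unifI)
      show "r t \<in> unif \<rightarrow>\<^sub>M borel" by measurable
      fix f :: "real \<Rightarrow> ennreal" assume f: "f \<in> borel_measurable borel"
      have "(\<integral>\<^sup>+v. f (r t v) \<partial>unif) = (\<integral>\<^sup>+z. f (snd z) \<partial>graph_plan (q t) (l t))"
        unfolding r_def using f by (subst nn_integral_graph_plan[OF lb]) auto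
      also have "\<dots> = (\<integral>\<^sup>+v. f v \<partial>unif)" by (rule couplings01_snd[OF gp f])
      finally show "(\<integral>\<^sup>+v. f (r t v) \<partial>unif) = (\<integral>\<^sup>+v. f v \<partial>unif)" .
    qed
    show "\<forall>\<gamma>\<in>couplings01. (\<integral>\<^sup>+v. ennreal (H v (r t v) t) \<partial>unif) \<le> cost t \<gamma> + ennreal e"
    proof
      fix \<gamma> assume \<gamma>: "\<gamma> \<in> couplings01"
      have "same_cells (lev t) (graph_plan (q t) (l t)) (mix (q t))"
        unfolding same_cells_def
      proof
        fix F :: "nat \<Rightarrow> nat \<Rightarrow> ennreal"
        have Fm: "(\<lambda>w. F k (cell m w)) \<in> borel_measurable borel" for k m
          by (rule measurable_compose[OF measurable_cell]) simp
        show "(\<integral>\<^sup>+z. F (cell (lev t) (fst z)) (cell (lev t) (snd z)) \<partial>graph_plan (q t) (l t))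
           = (\<integral>\<^sup>+z. F (cell (lev t) (fst z)) (cell (lev t) (snd z)) \<partial>mix (q t))"
          using nn_integral_monge[OF q lb lev_def[symmetric], of "\<lambda>k w. F k (cell (lev t) w)"] Fm
          by (subst nn_integral_graph_plan[OF lb]) auto
      qed
      then have "rcost t (graph_plan (q t) (l t)) \<le> rcost t (mix (q t)) + e/2"
        using good[of t] gp mix_couplings01[OF q] unfolding good_def by blast
      also have "\<dots> \<le> rcost t \<gamma> + e"
        using mixcost[of t] mincost_le[OF \<gamma>, of t] by simp
      finally have "cost t (graph_plan (q t) (l t)) \<le> cost t \<gamma> + ennreal e"
        using assms by (subst cost_le_iff[OF gp \<gamma>]) auto
      moreover have "cost t (graph_plan (q t) (l t)) = (\<integral>\<^sup>+v. ennreal (H v (r t v) t) \<partial>unif)"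
        unfolding cost_def r_def by (subst nn_integral_graph_plan[OF lb]) auto
      ultimately show "(\<integral>\<^sup>+v. ennreal (H v (r t v) t) \<partial>unif) \<le> cost t \<gamma> + ennreal e" by simp
    qed
  next
    fix t :: 't and s assume s: "s \<longlonglongrightarrow> t"
    have "isCont l t" using l(1) by (auto simp: continuous_on_eq_continuous_at)
    then have "(\<lambda>n. l (s n)) \<longlonglongrightarrow> l t" using s by (rule isCont_tendsto_compose)
    then show "AE v in unif. (\<lambda>n. r (s n) v) \<longlonglongrightarrow> r t v"
      unfolding r_def by (intro monge_tendsto[OF q lb] q qc s l(2))
  qed
qed

section \<open>Coding compact metrizable sets by real numbers\<close>

text \<open>
  Without separation axioms the closure of a compact set may be larger than the set.  In a regular
  space it consists of the points that cannot be distinguished from points of the set, and neither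
  Borel sets nor continuous functions notice the difference.
\<close>

definition indist :: "'a::topological_space \<Rightarrow> 'a \<Rightarrow> bool" where
  "indist x y \<longleftrightarrow> (\<forall>U. open U \<longrightarrow> (x \<in> U \<longleftrightarrow> y \<in> U))"

lemma indist_sym: "indist x y \<Longrightarrow> indist y x"
  by (auto simp: indist_def)

lemma indist_borel:
  assumes "indist x y" "B \<in> sets borel"
  shows "x \<in> B \<longleftrightarrow> y \<in> B"
proof -
  have "B \<in> sigma_sets UNIV {S. open S}"
    using assms(2) by (simp add: borel_def)
  then show ?thesis
    by induction (use assms(1) in \<open>auto simp: indist_def\<close>)
qed

lemma indist_continuous_eq:
  fixes f :: "'a::topological_space \<Rightarrow> 'b::t2_space"
  assumes "indist x y" "continuous_on UNIV f"
  shows "f x = f y"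
proof (rule ccontr)
  assume "f x \<noteq> f y"
  then obtain U where U: "open U" "f x \<in> U" "f y \<notin> U"
    using t1_space by blast
  have "open (f -` U)"
    using assms(2) U(1) by (metis continuous_on_open_vimage open_UNIV inf_top_right Int_UNIV_right)
  then show False using assms(1) U by (auto simp: indist_def)
qed

lemma regular_separation:
  assumes reg: "regular_space (euclidean :: 'a::topological_space topology)" and "\<not> indist (x :: 'a) y"
  obtains U V where "open U" "open V" "x \<in> U" "y \<in> V" "U \<inter> V = {}"
proof -
  have sep: "\<exists>U V. open U \<and> open V \<and> a \<in> U \<and> b \<in> V \<and> U \<inter> V = {}"
    if "open W" "a \<in> W" "b \<notin> W" for a b :: 'a and W
  proof -
    have "closedin euclidean (- W)" "a \<in> topspace euclidean - (- W)"
      using that by auto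
    then obtain U V where "openin euclidean U" "openin euclidean V" "a \<in> U" "- W \<subseteq> V" "disjnt U V"
      using reg unfolding regular_space_def by metis
    then show ?thesis using that by (intro exI[of _ U] exI[of _ V]) (auto simp: disjnt_def)
  qed
  from assms(2) obtain W where W: "open W" "(x \<in> W \<and> y \<notin> W) \<or> (y \<in> W \<and> x \<notin> W)"
    by (auto simp: indist_def)
  then show thesis
    using sep[of W x y] sep[of W y x] that by (metis Int_commute)
qed

text \<open>
  Otherwise every point of the compact set has a neighbourhood disjoint from some neighbourhood of
  \<open>x\<close>, and finitely many of them cover the compact set.
\<close>

lemma closure_compact_indist:
  assumes reg: "regular_space (euclidean :: 'a::topological_space topology)"
    and K: "compact (K :: 'a set)" and x: "x \<in> closure K"
  shows "\<exists>k\<in>K. indist x k"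
proof (rule ccontr)
  assume "\<not> ?thesis"
  then have "\<forall>k\<in>K. \<exists>U V. open U \<and> open V \<and> x \<in> U \<and> k \<in> V \<and> U \<inter> V = {}"
    using regular_separation[OF reg] by metis
  then obtain U V where UV: "\<And>k. k \<in> K \<Longrightarrow> open (U k) \<and> open (V k) \<and> x \<in> U k \<and> k \<in> V k \<and> U k \<inter> V k = {}"
    by metis
  obtain C where C: "C \<subseteq> K" "finite C" "K \<subseteq> (\<Union>k\<in>C. V k)"
    using compactE_image[OF K, of K V] UV by blast
  have "open (\<Inter>k\<in>C. U k)" using C UV by (intro open_INT) auto
  moreover have "x \<in> (\<Inter>k\<in>C. U k)" using C UV by auto
  moreover have "(\<Inter>k\<in>C. U k) \<inter> K = {}" using C UV by blast
  ultimately show False using x by (meson disjoint_iff open_Int_closure_eq_empty)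
qed

definition ternary :: "(nat \<Rightarrow> bool) \<Rightarrow> real" where
  "ternary e = (\<Sum>j. (1/2) ^ Suc j * ((2/3) ^ Suc j * of_bool (e j)))"

lemma ternary_digit_bounds: "0 \<le> (2/3::real) ^ Suc j * of_bool b" "(2/3::real) ^ Suc j * of_bool b \<le> 1"
  using power_le_one[of "2/3::real" "Suc j"] by (cases b; simp)+

lemma ternary_term: "(1/2) ^ Suc j * ((2/3) ^ Suc j * of_bool (e j)) = (1/3::real) ^ Suc j * of_bool (e j)"
  by (simp add: mult.assoc[symmetric] power_mult_distrib[symmetric] del: power_Suc)

lemma ternary_sums: "(\<lambda>j. (1/3) ^ Suc j * of_bool (e j)) sums ternary e"
  using summable_sums[OF summable_half_weights[of "\<lambda>j. (2/3) ^ Suc j * of_bool (e j)", OF ternary_digit_bounds]]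
  unfolding ternary_def ternary_term .

lemma ternary_bounds: "0 \<le> ternary e" "ternary e \<le> 1"
proof -
  note sm = summable_half_weights[of "\<lambda>j. (2/3) ^ Suc j * of_bool (e j)", OF ternary_digit_bounds]
  show "0 \<le> ternary e" unfolding ternary_def
    by (rule suminf_nonneg[OF sm]) simp
  have "ternary e \<le> (\<Sum>j. (1/2) ^ Suc j)" unfolding ternary_def
    by (intro suminf_le sm sums_summable[OF power_half_series] mult_left_le ternary_digit_bounds) simp
  then show "ternary e \<le> 1" using sums_unique[OF power_half_series] by simp
qed

lemma continuous_ternary: "continuous_on S ternary"
proof -
  have c: "continuous_on UNIV (\<lambda>e::nat \<Rightarrow> bool. (2/3::real) ^ Suc j * of_bool (e j))" for j
  proof (intro continuous_intros)
    have "continuous_on UNIV (of_bool :: bool \<Rightarrow> real)"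
      unfolding continuous_on_open_vimage[OF open_UNIV] by (intro allI impI) (rule discrete_topology_class.open_discrete)
    then show "continuous_on UNIV (\<lambda>e::nat \<Rightarrow> bool. of_bool (e j) :: real)"
      by (rule continuous_on_compose2) (auto intro: continuous_on_product_coordinates)
  qed
  have "continuous_on UNIV ternary"
    unfolding ternary_def[abs_def] by (rule continuous_half_weights[OF c]) (rule ternary_digit_bounds)+
  then show ?thesis by (rule continuous_on_subset) simp
qed

text \<open>
  At the first differing digit the two sums differ by twice the largest possible contribution of
  all later digits.
\<close>

lemma inj_ternary: "inj ternary"
proof (rule injI, rule ccontr)
  fix e e' assume eq: "ternary e = ternary e'" and "e \<noteq> e'"
  then obtain i0 where "e i0 \<noteq> e' i0" by auto
  define i where "i = (LEAST i. e i \<noteq> e' i)"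
  have i: "e i \<noteq> e' i" unfolding i_def by (rule LeastI[of _ i0]) fact
  have before: "e j = e' j" if "j < i" for j using not_less_Least[of j "\<lambda>i. e i \<noteq> e' i"] that by (auto simp: i_def)
  define t where "t j = (1/3::real) ^ Suc j * of_bool (e j) - (1/3) ^ Suc j * of_bool (e' j)" for j
  have t0: "t sums 0"
    using sums_diff[OF ternary_sums[of e] ternary_sums[of e']] eq by (simp add: t_def[abs_def])
  have tb: "\<bar>t j\<bar> \<le> (1/3) ^ Suc j" for j by (auto simp: t_def)
  have geo: "(\<lambda>j. (1/3::real) ^ (Suc i) * ((1/3) * (1/3) ^ j)) sums ((1/3) ^ (Suc i) * ((1/3) * (1 / (1 - 1/3))))"
    by (intro sums_mult geometric_sums) simp
  have b: "\<bar>t (j + Suc i)\<bar> \<le> (1/3::real) ^ (Suc i) * ((1/3) * (1/3) ^ j)" for j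
    using tb[of "j + Suc i"] by (simp add: power_add mult_ac)
  have abs_summable: "summable (\<lambda>j. \<bar>t (j + Suc i)\<bar>)"
    by (rule summable_comparison_test'[OF sums_summable[OF geo]]) (use b in simp)
  have "0 = (\<Sum>j. t (j + Suc i)) + (\<Sum>j<Suc i. t j)"
    using suminf_split_initial_segment[of t "Suc i"] t0 by (simp add: sums_iff)
  also have "(\<Sum>j<Suc i. t j) = t i"
    using before by (simp add: t_def)
  finally have "\<bar>t i\<bar> = \<bar>\<Sum>j. t (j + Suc i)\<bar>" by simp
  also have "\<dots> \<le> (\<Sum>j. \<bar>t (j + Suc i)\<bar>)"
    by (rule summable_rabs[OF abs_summable])
  also have "\<dots> \<le> (\<Sum>j. (1/3::real) ^ (Suc i) * ((1/3) * (1/3) ^ j))"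
  proof (rule suminf_le)
    show "\<bar>t (j + Suc i)\<bar> \<le> (1/3::real) ^ (Suc i) * ((1/3) * (1/3) ^ j)" for j
      by (rule b)
    show "summable (\<lambda>j. \<bar>t (j + Suc i)\<bar>)"
      by (rule abs_summable)
    show "summable (\<lambda>j. (1/3::real) ^ (Suc i) * ((1/3) * (1/3) ^ j))"
      by (rule sums_summable[OF geo])
  qed
  also have "\<dots> = (1/3) ^ (Suc i) / 2"
    using sums_unique[OF geo] by simp
  finally have "\<bar>t i\<bar> \<le> (1/3) ^ (Suc i) / 2" .
  moreover have "\<bar>t i\<bar> = (1/3) ^ (Suc i)"
    using i by (cases "e i"; cases "e' i") (auto simp: t_def)
  ultimately show False by simp
qed

lemma compact_binary_sequences: "compact (UNIV :: (nat \<Rightarrow> bool) set)"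
proof -
  have "compact_space (product_topology (\<lambda>_::nat. euclidean :: bool topology) UNIV)"
    by (subst compact_space_product_topology) (auto simp: compact_space_def finite_imp_compact)
  then show ?thesis
    unfolding euclidean_product_topology by (simp add: compact_space_def)
qed

text \<open>
  The pairs are the open and the closed balls of radius \<open>1 / (n + 1)\<close> around finitely many centres
  for each \<open>n\<close>.  The pair of empty sets only serves to make the family nonempty.
\<close>

lemma metrizable_compact_separating_family:
  assumes "compact_space T" "metrizable_space T"
  obtains G C :: "nat \<Rightarrow> 'a set" where
    "\<And>i. openin T (G i)" "\<And>i. closedin T (C i)" "\<And>i. G i \<subseteq> C i"
    "\<And>x y. x \<in> topspace T \<Longrightarrow> y \<in> topspace T \<Longrightarrow> x \<noteq> y \<Longrightarrow> \<exists>i. x \<in> G i \<and> y \<notin> C i"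
proof -
  obtain M d where Md: "Metric_space M d" "T = Metric_space.mtopology M d"
    using assms(2) by (auto simp: metrizable_space_def)
  interpret Metric_space M d by fact
  have "\<exists>F. finite F \<and> F \<subseteq> M \<and> M \<subseteq> (\<Union>c\<in>F. mball c (1 / Suc n))" for n
  proof -
    have "compactin mtopology M" using assms(1) Md(2) by (simp add: compact_space_def)
    moreover have "M \<subseteq> \<Union>((\<lambda>c. mball c (1 / Suc n)) ` M)" by auto
    moreover have "\<forall>U\<in>(\<lambda>c. mball c (1 / Suc n)) ` M. openin mtopology U" by auto
    ultimately obtain \<F> where \<F>: "finite \<F>" "\<F> \<subseteq> (\<lambda>c. mball c (1 / Suc n)) ` M" "M \<subseteq> \<Union>\<F>"
      unfolding compactin_def by meson
    then obtain F where "finite F" "F \<subseteq> M" "\<F> = (\<lambda>c. mball c (1 / Suc n)) ` F"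
      by (meson finite_subset_image)
    with \<F>(3) show ?thesis by blast
  qed
  then obtain F where F: "\<And>n. finite (F n)" "\<And>n. F n \<subseteq> M" "\<And>n. M \<subseteq> (\<Union>c\<in>F n. mball c (1 / Suc n))"
    by metis
  define P where "P = insert ({}, {}) (\<Union>n. (\<lambda>c. (mball c (1 / Suc n), mcball c (1 / Suc n))) ` F n)"
  have "countable P" unfolding P_def using F(1) by (intro countable_insert countable_UN countable_image) (auto intro: countable_finite)
  then have rP: "range (from_nat_into P) = P" by (intro range_from_nat_into) (auto simp: P_def)
  have inP: "openin T (fst (from_nat_into P i)) \<and> closedin T (snd (from_nat_into P i)) \<and> fst (from_nat_into P i) \<subseteq> snd (from_nat_into P i)" for i
  proof -
    have "from_nat_into P i \<in> P" using rP by auto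
    then show ?thesis unfolding P_def using Md(2) mball_subset_mcball by auto
  qed
  have sep: "\<exists>i. x \<in> fst (from_nat_into P i) \<and> y \<notin> snd (from_nat_into P i)"
    if xy: "x \<in> topspace T" "y \<in> topspace T" "x \<noteq> y" for x y
  proof -
    have xM: "x \<in> M" "y \<in> M" using xy Md(2) by auto
    then have "d x y > 0" using xy by simp
    then obtain n where n: "1 / Suc n < d x y / 2"
      using nat_approx_posE[of "d x y / 2"] by auto
    obtain c where c: "c \<in> F n" "x \<in> mball c (1 / Suc n)" using F(3) xM by blast
    have "y \<notin> mcball c (1 / Suc n)"
    proof
      assume "y \<in> mcball c (1 / Suc n)"
      then have "d x y < 2 * (1 / Suc n)"
        using c(2) triangle[of x c y] commute[of x c] by auto
      then show False using n by simp
    qed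
    moreover have "(mball c (1 / Suc n), mcball c (1 / Suc n)) \<in> range (from_nat_into P)"
      unfolding rP unfolding P_def using c(1) by blast
    ultimately show ?thesis using c(2) by (metis fst_conv snd_conv rangeE)
  qed
  show thesis
    by (rule that[of "\<lambda>i. fst (from_nat_into P i)" "\<lambda>i. snd (from_nat_into P i)"]) (use inP sep in auto)
qed

text \<open>
  The code of \<open>x\<close> is the sequence that records in which of the open sets \<open>W i\<close> of a separating family \<open>x\<close>
  lies.  A digit sequence \<open>e\<close> confines a point to closed sets \<open>E i (e i)\<close>, and at most one
  point of \<open>K\<close> fits all of them.  By compactness, whether some point fits, and whether the fitting
  point lies in a given open set, is decided by finitely many digits: so the decodable sequences
  form a closed set, and decoding is continuous on it.
\<close>

lemma compact_metrizable_code: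
  assumes reg: "regular_space (euclidean :: 'a::topological_space topology)"
    and K: "compact (K :: 'a set)" "metrizable_space (top_of_set K)"
  shows "\<exists>(\<theta> :: 'a \<Rightarrow> real) Z \<zeta>. \<theta> \<in> borel_measurable borel \<and> closed Z \<and> continuous_on Z \<zeta> \<and>
     (\<forall>x. 0 \<le> \<theta> x \<and> \<theta> x \<le> 1) \<and> Z \<subseteq> {0..1} \<and> (\<forall>x\<in>closure K. \<theta> x \<in> Z \<and> indist (\<zeta> (\<theta> x)) x)"
proof -
  have cK: "compact_space (top_of_set K)" using K(1) by (simp add: compact_space_subtopology)
  obtain G C :: "nat \<Rightarrow> 'a set" where GC: "\<And>i. openin (top_of_set K) (G i)" "\<And>i. closedin (top_of_set K) (C i)" "\<And>i. G i \<subseteq> C i"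
    "\<And>x y. x \<in> K \<Longrightarrow> y \<in> K \<Longrightarrow> x \<noteq> y \<Longrightarrow> \<exists>i. x \<in> G i \<and> y \<notin> C i"
  proof (rule metrizable_compact_separating_family[OF cK K(2)])
    fix G C :: "nat \<Rightarrow> 'a set" assume "\<And>i. openin (top_of_set K) (G i)" "\<And>i. closedin (top_of_set K) (C i)" "\<And>i::nat. G i \<subseteq> C i"
      "\<And>x y. x \<in> topspace (top_of_set K) \<Longrightarrow> y \<in> topspace (top_of_set K) \<Longrightarrow> x \<noteq> y \<Longrightarrow> \<exists>i. x \<in> G i \<and> y \<notin> C i"
    then show thesis by (intro that[of G C]) simp_all
  qed
  have "\<exists>W. open W \<and> G i = K \<inter> W" for i
    using GC(1)[of i] by (auto simp: openin_open)
  then obtain W where W: "\<And>i. open (W i)" "\<And>i. G i = K \<inter> W i" by metis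
  define E where "E i b = (if b then C i else K - G i)" for i b
  have Ec: "closedin (top_of_set K) (E i b)" for i b
    using GC by (auto simp: E_def intro: closedin_diff)
  define fits where "fits e I k \<longleftrightarrow> (\<forall>i\<in>I. k \<in> E i (e i))" for e I k
  have fits_digits: "fits (\<lambda>i. k \<in> W i) UNIV k" if "k \<in> K" for k
    using that GC(3) W(2) by (auto simp: fits_def E_def)
  have unique: "k = k'" if "k \<in> K" "k' \<in> K" "fits e UNIV k" "fits e UNIV k'" for e k k'
  proof (rule ccontr)
    assume "k \<noteq> k'"
    then obtain i where "k \<in> G i" "k' \<notin> C i" using GC(4) \<open>k \<in> K\<close> \<open>k' \<in> K\<close> by blast
    then show False using that by (cases "e i") (auto simp: fits_def E_def dest!: spec[of _ i])
  qed
  have finite_stage: "\<exists>I. finite I \<and> (\<forall>k\<in>L. \<not> fits e I k)"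
    if L: "closedin (top_of_set K) L" and none: "\<forall>k\<in>L. \<not> fits e UNIV k" for L e
  proof -
    let ?\<U> = "insert L (range (\<lambda>i. E i (e i)))"
    have "\<Inter>?\<U> = {}" using none by (auto simp: fits_def)
    moreover have "\<forall>X\<in>?\<U>. closedin (top_of_set K) X" using L Ec by auto
    ultimately obtain \<F> where \<F>: "finite \<F>" "\<F> \<subseteq> ?\<U>" "\<Inter>\<F> = {}"
      using cK unfolding compact_space_fip by meson
    have "finite (\<F> - {L})" "\<F> - {L} \<subseteq> (\<lambda>i. E i (e i)) ` UNIV" using \<F> by auto
    then obtain I where I: "finite I" "\<F> - {L} = (\<lambda>i. E i (e i)) ` I"
      by (meson finite_subset_image)
    have "\<not> fits e I k" if "k \<in> L" for k
    proof
      assume "fits e I k"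
      have "k \<in> X" if "X \<in> \<F>" for X
      proof (cases "X = L")
        case False
        then have "X \<in> (\<lambda>i. E i (e i)) ` I" unfolding I(2)[symmetric] using that by simp
        then obtain i where "i \<in> I" "X = E i (e i)" by (rule imageE)
        then show ?thesis using \<open>fits e I k\<close> by (simp add: fits_def)
      qed (use \<open>k \<in> L\<close> in simp)
      then have "k \<in> \<Inter>\<F>" by blast
      then show False using \<F> by simp
    qed
    then show ?thesis using I(1) by blast
  qed
  have cyl: "open {e'. \<forall>i\<in>I. e' i = e i}" if "finite I" for I and e :: "nat \<Rightarrow> bool"
  proof -
    have "open ((\<lambda>e'. e' i) -` {e i})" for i
      using continuous_on_product_coordinates[of i] discrete_topology_class.open_discrete[of "{e i}"]
      by (rule open_vimage[rotated])
    then have "open (\<Inter>i\<in>I. (\<lambda>e'. e' i) -` {e i})" using that by (intro open_INT) auto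
    also have "(\<Inter>i\<in>I. (\<lambda>e'. e' i) -` {e i}) = {e'. \<forall>i\<in>I. e' i = e i}" by auto
    finally show ?thesis .
  qed
  have fits_cong: "fits e' I k \<longleftrightarrow> fits e I k" if "\<forall>i\<in>I. e' i = e i" for e e' I k
    using that by (auto simp: fits_def)
  define S where "S = {e. \<exists>k\<in>K. fits e UNIV k}"
  have "open (- S)"
  proof (subst open_subopen, intro ballI)
    fix e assume "e \<in> - S"
    then obtain I where I: "finite I" "\<forall>k\<in>K. \<not> fits e I k"
      using finite_stage[of K e] by (auto simp: S_def)
    have "e' \<notin> S" if "\<forall>i\<in>I. e' i = e i" for e'
    proof
      assume "e' \<in> S"
      then obtain k where "k \<in> K" "fits e' I k" by (auto simp: S_def fits_def)
      then show False using I(2) fits_cong[OF that] by blast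
    qed
    then have "{e'. \<forall>i\<in>I. e' i = e i} \<subseteq> - S" by blast
    then show "\<exists>T. open T \<and> e \<in> T \<and> T \<subseteq> - S" using cyl[OF I(1), of e] by blast
  qed
  then have Sc: "compact S"
    using compact_Int_closed[OF compact_binary_sequences, of S] by (simp add: closed_def)
  define dec where "dec e = (SOME k. k \<in> K \<and> fits e UNIV k)" for e
  have dec: "dec e \<in> K \<and> fits e UNIV (dec e)" if "e \<in> S" for e
    unfolding dec_def by (rule someI_ex) (use that in \<open>auto simp: S_def\<close>)
  have decc: "continuous_on S dec"
    unfolding continuous_on_topological
  proof (intro ballI allI impI)
    fix e B assume e: "e \<in> S" and B: "open B" "dec e \<in> B"
    have "closedin (top_of_set K) (K - B)"
      using B(1) by (auto simp: closedin_subtopology intro!: exI[of _ "- B"])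
    moreover have "\<forall>k\<in>K - B. \<not> fits e UNIV k"
      using unique dec[OF e] B(2) by blast
    ultimately obtain I where I: "finite I" "\<forall>k\<in>K - B. \<not> fits e I k"
      using finite_stage by blast
    have "dec e' \<in> B" if "e' \<in> S" "\<forall>i\<in>I. e' i = e i" for e'
    proof -
      have "dec e' \<in> K" "fits e' I (dec e')" using dec[OF that(1)] by (auto simp: fits_def)
      then show ?thesis using I(2) fits_cong[OF that(2)] by blast
    qed
    then show "\<exists>A. open A \<and> e \<in> A \<and> (\<forall>y\<in>S. y \<in> A \<longrightarrow> dec y \<in> B)"
      using cyl[OF I(1), of e] by (intro exI[of _ "{e'. \<forall>i\<in>I. e' i = e i}"]) auto
  qed
  define \<theta> where "\<theta> x = ternary (\<lambda>i. x \<in> W i)" for x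
  define \<zeta> where "\<zeta> = dec \<circ> inv ternary"
  have invc: "continuous_on (ternary ` S) (inv ternary)"
    by (rule continuous_on_inv[OF continuous_ternary Sc]) (simp add: inv_f_f[OF inj_ternary])
  have "inv ternary ` ternary ` S = S" by (auto simp: inv_f_f[OF inj_ternary] image_image)
  then have "continuous_on (ternary ` S) \<zeta>"
    unfolding \<zeta>_def using invc decc by (intro continuous_on_compose) simp_all
  moreover have "closed (ternary ` S)"
    by (intro compact_imp_closed compact_continuous_image continuous_ternary Sc)
  moreover have "\<theta> \<in> borel_measurable borel"
  proof -
    have [measurable]: "W i \<in> sets borel" for i using W(1) by auto
    have "(\<lambda>x. of_bool (x \<in> W i) :: real) \<in> borel_measurable borel" for i
      by (simp add: of_bool_def)
    then show ?thesis unfolding \<theta>_def ternary_def by measurable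
  qed
  moreover have "\<theta> x \<in> ternary ` S \<and> indist (\<zeta> (\<theta> x)) x" if x: "x \<in> closure K" for x
  proof -
    obtain k where k: "k \<in> K" "indist x k" using closure_compact_indist[OF reg K(1) x] by blast
    have eq: "(\<lambda>i. x \<in> W i) = (\<lambda>i. k \<in> W i)" using k(2) W(1) by (auto simp: indist_def)
    have inS: "(\<lambda>i. k \<in> W i) \<in> S" using fits_digits[OF k(1)] k(1) by (auto simp: S_def)
    have "dec (\<lambda>i. k \<in> W i) = k"
      using unique dec[OF inS] fits_digits[OF k(1)] k(1) by blast
    then have "\<zeta> (\<theta> x) = k" by (simp add: \<zeta>_def \<theta>_def eq inv_f_f[OF inj_ternary])
    then show ?thesis using inS k(2) by (auto simp: \<theta>_def eq indist_sym)
  qed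
  ultimately show ?thesis
    using ternary_bounds by (intro exI[of _ \<theta>] exI[of _ "ternary ` S"] exI[of _ \<zeta>]) (auto simp: \<theta>_def)
qed

text \<open>
  The codes of the single compact sets are shifted into disjoint intervals \<open>[2 n, 2 n + 1]\<close>; the
  gaps between these intervals keep the decoder continuous.
\<close>

lemma concentrated_code:
  fixes \<mu> :: "'a::topological_space measure"
  assumes reg: "regular_space (euclidean :: 'a topology)" and sets: "sets \<mu> = sets borel"
    and conc: "concentrated_on_metrizable_compacts \<mu>"
  shows "\<exists>(\<theta> :: 'a \<Rightarrow> real) Z \<zeta>. \<theta> \<in> borel_measurable borel \<and> Z \<in> sets borel \<and> continuous_on Z \<zeta> \<and>
     (AE x in \<mu>. \<theta> x \<in> Z \<and> indist (\<zeta> (\<theta> x)) x)"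
proof -
  obtain K where K: "\<And>n::nat. compact (K n)" "\<And>n. metrizable_space (top_of_set (K n))"
    "concentrated_on \<mu> (\<Union>n. K n)"
    using conc unfolding concentrated_on_metrizable_compacts_def by blast
  have "\<forall>n. \<exists>(\<theta> :: 'a \<Rightarrow> real) Z \<zeta>. \<theta> \<in> borel_measurable borel \<and> closed Z \<and> continuous_on Z \<zeta> \<and>
     (\<forall>x. 0 \<le> \<theta> x \<and> \<theta> x \<le> 1) \<and> Z \<subseteq> {0..1} \<and> (\<forall>x\<in>closure (K n). \<theta> x \<in> Z \<and> indist (\<zeta> (\<theta> x)) x)"
    using compact_metrizable_code[OF reg K(1,2)] by blast
  then obtain \<theta> Z \<zeta> where code: "\<And>n. \<theta> n \<in> borel_measurable borel" "\<And>n. closed (Z n)" "\<And>n. continuous_on (Z n) (\<zeta> n)"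
    "\<And>n x. 0 \<le> \<theta> n x" "\<And>n x. \<theta> n x \<le> 1" "\<And>n. Z n \<subseteq> {0..1::real}"
    "\<And>n x. x \<in> closure (K n) \<Longrightarrow> \<theta> n x \<in> Z n \<and> indist (\<zeta> n (\<theta> n x)) x"
    by metis
  note [measurable] = code(1)
  define idx where "idx x = (LEAST n. x \<in> closure (K n))" for x
  have [measurable]: "closure (K n) \<in> sets borel" for n by simp
  have [measurable]: "idx \<in> borel \<rightarrow>\<^sub>M count_space UNIV"
    unfolding idx_def by measurable
  define \<Theta> where "\<Theta> x = 2 * real (idx x) + \<theta> (idx x) x" for x
  define W where "W = (\<Union>n. (\<lambda>z. 2 * real n + z) ` Z n)"
  define \<xi> where "\<xi> z = \<zeta> (nat \<lfloor>z / 2\<rfloor>) (z - 2 * real (nat \<lfloor>z / 2\<rfloor>))" for z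
  have fl: "nat \<lfloor>(2 * real n + z) / 2\<rfloor> = n" if "0 \<le> z" "z \<le> 1" for n z
  proof -
    have "\<lfloor>(2 * real n + z) / 2\<rfloor> = int n" using that by (simp add: floor_eq_iff)
    then show ?thesis by simp
  qed
  have Zb: "0 \<le> z" "z \<le> 1" if "z \<in> Z n" for z n using code(6)[of n] that by auto
  have "\<Theta> \<in> borel_measurable borel"
    unfolding \<Theta>_def by (rule measurable_compose_countable'[where I=UNIV and g=idx]) auto
  moreover have "W \<in> sets borel"
    unfolding W_def using code(2) closed_translation[of "Z _" "2 * real _"] by (intro sets.countable_UN) auto
  moreover have "continuous_on W \<xi>"
    unfolding continuous_on_topological
  proof (intro ballI allI impI)
    fix z B assume z: "z \<in> W" and B: "open B" "\<xi> z \<in> B"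
    then obtain n x where x: "x \<in> Z n" "z = 2 * real n + x" by (auto simp: W_def)
    have "\<xi> z = \<zeta> n x" using x Zb[OF x(1)] by (simp add: \<xi>_def fl)
    then obtain A where A: "open A" "x \<in> A" "\<And>y. y \<in> Z n \<Longrightarrow> y \<in> A \<Longrightarrow> \<zeta> n y \<in> B"
      using code(3)[of n] x(1) B unfolding continuous_on_topological by metis
    define A' where "A' = (\<lambda>y. y - 2 * real n) -` A \<inter> {2 * real n - 1/2<..<2 * real n + 3/2}"
    have "open A'" unfolding A'_def
      by (intro open_Int open_vimage A continuous_intros open_greaterThanLessThan)
    moreover have "z \<in> A'" using A(2) x Zb[OF x(1)] by (auto simp: A'_def)
    moreover have "\<xi> y \<in> B" if y: "y \<in> W" "y \<in> A'" for y
    proof -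
      obtain k u where u: "u \<in> Z k" "y = 2 * real k + u" using y(1) by (auto simp: W_def)
      have "k = n" using y(2) u Zb[OF u(1)] unfolding A'_def by auto
      then show ?thesis using u y(2) A(3)[of u] Zb[OF u(1)] by (auto simp: \<xi>_def fl A'_def)
    qed
    ultimately show "\<exists>A. open A \<and> z \<in> A \<and> (\<forall>y\<in>W. y \<in> A \<longrightarrow> \<xi> y \<in> B)" by blast
  qed
  moreover have "AE x in \<mu>. \<Theta> x \<in> W \<and> indist (\<xi> (\<Theta> x)) x"
  proof -
    have "AE x in \<mu>. x \<notin> space \<mu> - (\<Union>n. K n)"
      using K(3) unfolding concentrated_on_def by (rule AE_not_in)
    then show ?thesis
    proof eventually_elim
      case (elim x)
      then obtain n where "x \<in> K n" using sets_eq_imp_space_eq[OF sets] by auto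
      then have "x \<in> closure (K n)" using closure_subset by blast
      then have "x \<in> closure (K (idx x))" unfolding idx_def by (rule LeastI)
      from code(7)[OF this] show ?case
        using code(4,5)[of "idx x" x] by (auto simp: W_def \<Theta>_def \<xi>_def fl)
    qed
  qed
  ultimately show ?thesis by blast
qed

section \<open>Parametrizing measures by the unit interval\<close>

lemma unif_lessThan: "0 \<le> c \<Longrightarrow> c \<le> 1 \<Longrightarrow> emeasure unif {..<c} = ennreal c"
  and unif_atMost: "0 \<le> c \<Longrightarrow> c \<le> 1 \<Longrightarrow> emeasure unif {..c} = ennreal c"
proof -
  assume c: "0 \<le> c" "c \<le> 1"
  have "emeasure unif {..<c} = (\<integral>\<^sup>+x. 1 * indicator {0..<c} x \<partial>lborel)"
    using c unfolding unif_def
    by (subst emeasure_density) (auto intro!: nn_integral_cong simp: indicator_def)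
  then show 1: "emeasure unif {..<c} = ennreal c" using c by simp
  have "AE v in unif. v \<in> {..<c} \<longleftrightarrow> v \<in> {..c}"
    using AE_unif_countable[of "{c}"] by simp (auto elim: eventually_mono)
  then have "emeasure unif {..<c} = emeasure unif {..c}"
    by (intro emeasure_eq_AE) auto
  with 1 show "emeasure unif {..c} = ennreal c" by simp
qed

text \<open>
  Strict and weak inequality in the two bounds make them easy to verify; together they determine
  the distribution function.
\<close>

lemma eq_unifI:
  assumes M: "prob_space M" "sets M = sets borel"
    and lt: "\<And>s. 0 < s \<Longrightarrow> s < 1 \<Longrightarrow> emeasure M {..<s} \<le> ennreal s"
    and le: "\<And>s. 0 < s \<Longrightarrow> s < 1 \<Longrightarrow> ennreal s \<le> emeasure M {..s}"
  shows "M = unif"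
proof -
  have c: "cdf N x = max 0 (min 1 x)" if N: "prob_space N" "sets N = sets borel"
    and lt: "\<And>s. 0 < s \<Longrightarrow> s < 1 \<Longrightarrow> emeasure N {..<s} \<le> ennreal s"
    and le: "\<And>s. 0 < s \<Longrightarrow> s < 1 \<Longrightarrow> ennreal s \<le> emeasure N {..s}" for N :: "real measure" and x
  proof -
    interpret N: prob_space N by fact
    have sp: "space N = UNIV" using sets_eq_imp_space_eq[OF N(2)] by simp
    have [simp]: "S \<in> sets N \<longleftrightarrow> S \<in> sets borel" for S by (simp add: N(2))
    have lo: "s \<le> cdf N y" if "0 < s" "s < 1" "s \<le> y" for s y
    proof -
      have "s \<le> measure N {..s}"
        using le[of s] that by (simp add: N.emeasure_eq_measure)
      also have "\<dots> \<le> cdf N y" unfolding cdf_def using that by (intro N.finite_measure_mono) auto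
      finally show ?thesis .
    qed
    have hi: "cdf N y \<le> s" if "0 < s" "s < 1" "y < s" for s y
    proof -
      have "cdf N y \<le> measure N {..<s}" unfolding cdf_def using that by (intro N.finite_measure_mono) auto
      also have "\<dots> \<le> s" using lt[of s] that by (simp add: N.emeasure_eq_measure)
      finally show ?thesis .
    qed
    have b: "0 \<le> cdf N x" "cdf N x \<le> 1" by (simp_all add: cdf_def)
    show ?thesis
    proof (rule antisym)
      show "cdf N x \<le> max 0 (min 1 x)"
      proof (cases "x < 1")
        case True
        show ?thesis
        proof (rule dense_ge)
          fix s assume "max 0 (min 1 x) < s"
          then show "cdf N x \<le> s" using hi[of s x] b by (cases "s < 1") auto
        qed
      qed (use b in auto)
      show "max 0 (min 1 x) \<le> cdf N x"
      proof (cases "0 < x")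
        case True
        have "min 1 x \<le> cdf N x"
        proof (rule dense_le)
          fix s assume "s < min 1 x"
          then show "s \<le> cdf N x" using lo[of s x] b by (cases "0 < s") auto
        qed
        then show ?thesis using b by auto
      qed (use b in auto)
    qed
  qed
  have "real_distribution M"
    using M by (intro real_distribution.intro real_distribution_axioms.intro)
  moreover have "real_distribution unif"
    using prob_space_unif by (intro real_distribution.intro real_distribution_axioms.intro) auto
  moreover have "cdf M = cdf unif"
    using c[OF M lt le] c[OF prob_space_unif sets_unif] unif_lessThan unif_atMost by (simp add: fun_eq_iff)
  ultimately show ?thesis by (rule cdf_unique)
qed

context cdf_distribution begin

text \<open>
  The distributional transform: if \<open>z\<close> has law \<open>M\<close> and \<open>u\<close> is an independent uniform number, then a
  jump of the distribution function at \<open>z\<close> is filled uniformly.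
\<close>

definition dtrans :: "real \<Rightarrow> real \<Rightarrow> real" where
  "dtrans z u = measure M {..<z} + u * measure M {z}"

lemma C_eq: "C z = measure M {..<z} + measure M {z}"
proof -
  have "{..z} = {..<z} \<union> {z}" by auto
  moreover have "measure M ({..<z} \<union> {z}) = measure M {..<z} + measure M {z}"
    by (rule finite_measure_Union) auto
  ultimately show ?thesis unfolding cdf_def by (simp only:)
qed

lemma measurable_dtrans: "(\<lambda>x. dtrans (fst x) (snd x)) \<in> borel_measurable (M \<Otimes>\<^sub>M unif)"
proof -
  have "mono (\<lambda>z. measure M {..<z})"
    by (intro monoI finite_measure_mono) auto
  then have [measurable]: "(\<lambda>z. measure M {..<z}) \<in> borel_measurable borel"
    by (rule borel_measurable_mono)
  have "(\<lambda>z. measure M {z}) = (\<lambda>z. C z - measure M {..<z})"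
    by (simp add: C_eq fun_eq_iff)
  then have [measurable]: "(\<lambda>z. measure M {z}) \<in> borel_measurable borel"
    by simp
  show ?thesis unfolding dtrans_def by measurable
qed

lemma dtrans_le: "u \<le> 1 \<Longrightarrow> dtrans z u \<le> C z"
  using mult_right_mono[of u 1 "measure M {z}"] by (simp add: dtrans_def C_eq)

lemma dtrans_ge: "0 \<le> u \<Longrightarrow> measure M {..<z} \<le> dtrans z u"
  by (simp add: dtrans_def)

text \<open>
  Let \<open>z0\<close> be the quantile at \<open>s\<close>.  Up to null sets and the boundary case, the transform is below
  \<open>s\<close> iff \<open>z < z0\<close>, or \<open>z = z0\<close> and \<open>u\<close> is below the fraction \<open>c\<close> of the jump at \<open>z0\<close> that lies
  below \<open>s\<close>; this event has probability \<open>a + c * b = s\<close>.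
\<close>

lemma distr_dtrans: "distr (M \<Otimes>\<^sub>M unif) borel (\<lambda>x. dtrans (fst x) (snd x)) = unif"
proof (rule eq_unifI)
  interpret P: pair_prob_space M unif ..
  let ?T = "\<lambda>x. dtrans (fst x) (snd x)"
  note [measurable] = measurable_dtrans
  show "prob_space (distr (M \<Otimes>\<^sub>M unif) borel ?T)"
    by (intro P.prob_space_distr) measurable
  have uAE: "AE x in M \<Otimes>\<^sub>M unif. 0 \<le> snd x \<and> snd x < 1"
  proof (rule P.AE_pair_measure)
    show "AE x in M. AE y in unif. 0 \<le> snd (x, y) \<and> snd (x, y) < 1"
      using AE_unif_Ico by simp
  qed measurable
  fix s :: real assume s: "0 < s" "s < 1"
  define z0 where "z0 = I s"
  define a where "a = measure M {..<z0}"
  define b where "b = measure M {z0}"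
  \<comment> \<open>without a jump at \<open>z0\<close> the value of \<open>c\<close> does not matter\<close>
  define c where "c = (if b = 0 then 0 else (s - a) / b)"
  have sC: "s \<le> C z0" using pseudoinverse[of s z0] s by (simp add: z0_def)
  have below: "C z < s" if "z < z0" for z
    using pseudoinverse[of s z] s that by (simp add: z0_def not_le[symmetric])
  have "a \<le> s"
  proof (rule tendsto_upperbound)
    show "(C \<longlongrightarrow> a) (at_left z0)" unfolding a_def by (rule cdf_at_left)
    show "\<forall>\<^sub>F z in at_left z0. C z \<le> s"
      using below unfolding eventually_at_left_field by (intro exI[of _ "z0 - 1"]) (auto intro: less_imp_le)
  qed simp
  have ab: "0 \<le> a" "0 \<le> b" "s \<le> a + b" using sC by (simp_all add: a_def b_def C_eq)
  have c: "0 \<le> c" "c \<le> 1" "a + c * b = s"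
    using ab \<open>a \<le> s\<close> by (auto simp: c_def field_simps)
  have prod_eq: "emeasure (M \<Otimes>\<^sub>M unif) ({..<z0} \<times> UNIV \<union> {z0} \<times> S) = ennreal s"
    if S: "S \<in> sets borel" "emeasure unif S = ennreal c" for S
  proof -
    have "emeasure (M \<Otimes>\<^sub>M unif) ({..<z0} \<times> UNIV \<union> {z0} \<times> S)
        = emeasure (M \<Otimes>\<^sub>M unif) ({..<z0} \<times> UNIV) + emeasure (M \<Otimes>\<^sub>M unif) ({z0} \<times> S)"
      using S(1) by (intro plus_emeasure[symmetric]) auto
    also have "\<dots> = ennreal a * 1 + ennreal b * ennreal c"
      using S unif.emeasure_space_1 by (simp add: unif.emeasure_pair_measure_Times a_def b_def emeasure_eq_measure)
    also have "\<dots> = ennreal s"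
      using ab c by (simp add: ennreal_mult[symmetric] ennreal_plus[symmetric] mult.commute del: ennreal_plus)
    finally show ?thesis .
  qed
  have "emeasure (distr (M \<Otimes>\<^sub>M unif) borel ?T) {..<s} = emeasure (M \<Otimes>\<^sub>M unif) (?T -` {..<s} \<inter> space (M \<Otimes>\<^sub>M unif))"
    by (rule emeasure_distr) auto
  also have "\<dots> \<le> emeasure (M \<Otimes>\<^sub>M unif) ({..<z0} \<times> UNIV \<union> {z0} \<times> {..<c})"
  proof (rule emeasure_mono_AE)
    show "AE x in M \<Otimes>\<^sub>M unif. x \<in> ?T -` {..<s} \<inter> space (M \<Otimes>\<^sub>M unif) \<longrightarrow> x \<in> {..<z0} \<times> UNIV \<union> {z0} \<times> {..<c}"
      using uAE
    proof eventually_elim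
      case (elim x)
      obtain z u where x: "x = (z, u)" by (cases x)
      show ?case
      proof (rule impI, rule ccontr)
        assume "x \<in> ?T -` {..<s} \<inter> space (M \<Otimes>\<^sub>M unif)"
          and nin: "x \<notin> {..<z0} \<times> UNIV \<union> {z0} \<times> {..<c}"
        then have lt: "dtrans z u < s" by (simp add: x)
        from nin consider "z = z0" "c \<le> u" | "z0 < z" by (force simp: x)
        then show False
        proof cases
          case 1
          then have "a + c * b \<le> dtrans z u" using ab by (simp add: dtrans_def a_def b_def mult_right_mono)
          then show False using lt c by simp
        next
          case 2
          have "C z0 \<le> measure M {..<z}" unfolding cdf_def using 2 by (intro finite_measure_mono) auto
          then show False using sC dtrans_ge[of u z] lt elim by (simp add: x)
        qed
      qed
    qed
  qed simp
  also have "\<dots> = ennreal s" by (rule prod_eq) (use unif_lessThan c in auto)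
  finally show "emeasure (distr (M \<Otimes>\<^sub>M unif) borel ?T) {..<s} \<le> ennreal s" .
  have "ennreal s = emeasure (M \<Otimes>\<^sub>M unif) ({..<z0} \<times> UNIV \<union> {z0} \<times> {..c})"
    by (rule prod_eq[symmetric]) (use unif_atMost c in auto)
  also have "\<dots> \<le> emeasure (M \<Otimes>\<^sub>M unif) (?T -` {..s} \<inter> space (M \<Otimes>\<^sub>M unif))"
  proof (rule emeasure_mono_AE)
    show "AE x in M \<Otimes>\<^sub>M unif. x \<in> {..<z0} \<times> UNIV \<union> {z0} \<times> {..c} \<longrightarrow> x \<in> ?T -` {..s} \<inter> space (M \<Otimes>\<^sub>M unif)"
      using uAE
    proof eventually_elim
      case (elim x)
      obtain z u where x: "x = (z, u)" by (cases x)
      show ?case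
      proof
        assume "x \<in> {..<z0} \<times> UNIV \<union> {z0} \<times> {..c}"
        then consider "z < z0" | "z = z0" "u \<le> c" by (auto simp: x)
        then have "dtrans z u \<le> s"
        proof cases
          case 1
          then show ?thesis using below[OF 1] dtrans_le[of u z] elim by (simp add: x)
        next
          case 2
          then have "dtrans z u \<le> a + c * b" using ab by (simp add: dtrans_def a_def b_def mult_right_mono)
          then show ?thesis using c by simp
        qed
        then show "x \<in> ?T -` {..s} \<inter> space (M \<Otimes>\<^sub>M unif)" by (simp add: x space_pair_measure)
      qed
    qed
  qed (rule measurable_sets[OF measurable_dtrans], simp)
  also have "\<dots> = emeasure (distr (M \<Otimes>\<^sub>M unif) borel ?T) {..s}"
    by (rule emeasure_distr[symmetric]) auto
  finally show "ennreal s \<le> emeasure (distr (M \<Otimes>\<^sub>M unif) borel ?T) {..s}" .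
qed simp

text \<open>
  The value 0 outside \<open>(0, 1)\<close> only makes the function total.
\<close>

definition quantile :: "real \<Rightarrow> real" where
  "quantile v = (if v \<in> {0<..<1} then I v else 0)"

lemma measurable_quantile [measurable]: "quantile \<in> borel_measurable borel"
  unfolding quantile_def
  by (subst measurable_If_restrict_space_iff) (simp_all only: Collect_mem_eq measurable_CI, simp_all)

lemma distr_quantile: "distr unif borel quantile = M"
proof -
  have "distr unif borel quantile = distr (restrict_space lborel {0<..<1}) borel I"
  proof (rule measure_eqI)
    fix S assume "S \<in> sets (distr unif borel quantile)"
    then have S [measurable]: "S \<in> sets borel" by simp
    have m: "quantile -` S \<inter> {0<..<1} \<in> sets borel" by measurable
    have "emeasure (distr unif borel quantile) S = emeasure unif (quantile -` S)"
      by (subst emeasure_distr) auto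
    also have "\<dots> = emeasure unif (quantile -` S \<inter> {0<..<1})"
    proof (rule emeasure_eq_AE)
      show "AE x in unif. (x \<in> quantile -` S) = (x \<in> quantile -` S \<inter> {0<..<1})"
        using AE_unif_Ioo by eventually_elim auto
      have "quantile -` S \<inter> space borel \<in> sets borel" by measurable
      then show "quantile -` S \<in> sets unif" by simp
    qed (use m in auto)
    also have "\<dots> = (\<integral>\<^sup>+x. indicator {0..<1} x * indicator (quantile -` S \<inter> {0<..<1}) x \<partial>lborel)"
      unfolding unif_def using m by (subst emeasure_density) auto
    also have "\<dots> = (\<integral>\<^sup>+x. indicator (quantile -` S \<inter> {0<..<1}) x \<partial>lborel)"
      by (intro nn_integral_cong) (auto simp: indicator_def)
    also have "\<dots> = emeasure lborel (quantile -` S \<inter> {0<..<1})"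
      using m by simp
    also have "quantile -` S \<inter> {0<..<1} = I -` S \<inter> {0<..<1}"
      by (auto simp: quantile_def)
    also have "emeasure lborel (I -` S \<inter> {0<..<1}) = emeasure (distr (restrict_space lborel {0<..<1}) borel I) S"
      using S by (subst emeasure_distr) (auto simp: space_restrict_space emeasure_restrict_space)
    finally show "emeasure (distr unif borel quantile) S = emeasure (distr (restrict_space lborel {0<..<1}) borel I) S" .
  qed simp
  then show ?thesis using distr_I_eq_M by simp
qed

text \<open>
  The quantile of the transform of \<open>z\<close> is at most \<open>z\<close> and has the same law as \<open>z\<close>; comparing the
  expectations of a bounded strictly increasing function, here \<open>arctan\<close>, yields equality.
\<close>

lemma quantile_dtrans: "AE x in M \<Otimes>\<^sub>M unif. quantile (dtrans (fst x) (snd x)) = fst x"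
proof -
  interpret P: pair_prob_space M unif ..
  let ?T = "\<lambda>x. dtrans (fst x) (snd x)"
  note [measurable] = measurable_dtrans
  have uAE: "AE x in M \<Otimes>\<^sub>M unif. 0 \<le> snd x \<and> snd x < 1"
  proof (rule P.AE_pair_measure)
    show "AE x in M. AE y in unif. 0 \<le> snd (x, y) \<and> snd (x, y) < 1"
      using AE_unif_Ico by simp
  qed measurable
  have "AE v in distr (M \<Otimes>\<^sub>M unif) borel ?T. v \<in> {0<..<1}"
    unfolding distr_dtrans by (rule AE_unif_Ioo)
  then have TAE: "AE x in M \<Otimes>\<^sub>M unif. ?T x \<in> {0<..<1}"
    by (rule AE_distrD[rotated]) simp
  define g where "g x = arctan (fst x) - arctan (quantile (?T x))" for x :: "real \<times> real"
  have am [measurable]: "arctan \<in> borel_measurable borel" by simp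
  have bnd: "norm (arctan y) \<le> 2" for y using arctan_bounded[of y] pi_less_4 by (auto simp: abs_le_iff)
  have i1: "integrable (M \<Otimes>\<^sub>M unif) (\<lambda>x. arctan (fst x))"
    by (rule P.integrable_const_bound[where B=2]) (use bnd in auto)
  have i2: "integrable (M \<Otimes>\<^sub>M unif) (\<lambda>x. arctan (quantile (?T x)))"
    by (rule P.integrable_const_bound[where B=2]) (use bnd in auto)
  have "(\<integral>x. arctan (quantile (?T x)) \<partial>(M \<Otimes>\<^sub>M unif)) = (\<integral>v. arctan (quantile v) \<partial>distr (M \<Otimes>\<^sub>M unif) borel ?T)"
    by (rule integral_distr[symmetric]) auto
  also have "\<dots> = (\<integral>z. arctan z \<partial>distr unif borel quantile)"
    unfolding distr_dtrans by (rule integral_distr[symmetric]) auto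
  also have "\<dots> = (\<integral>z. arctan z \<partial>distr (M \<Otimes>\<^sub>M unif) M fst)"
    unfolding distr_quantile using unif.distr_pair_fst[of M] by (simp add: P.sigma_finite_measure_axioms)
  also have "\<dots> = (\<integral>x. arctan (fst x) \<partial>(M \<Otimes>\<^sub>M unif))"
    by (rule integral_distr) auto
  finally have "(\<integral>x. g x \<partial>(M \<Otimes>\<^sub>M unif)) = 0"
    unfolding g_def by (subst Bochner_Integration.integral_diff[OF i1 i2]) simp
  moreover have "AE x in M \<Otimes>\<^sub>M unif. 0 \<le> g x"
    using uAE TAE
  proof eventually_elim
    case (elim x)
    have "quantile (?T x) \<le> fst x"
      using pseudoinverse[of "?T x" "fst x"] elim dtrans_le[of "snd x" "fst x"] by (simp add: quantile_def)
    then show ?case by (simp add: g_def arctan_le_iff)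
  qed
  moreover have "integrable (M \<Otimes>\<^sub>M unif) g" unfolding g_def using i1 i2 by simp
  ultimately have "AE x in M \<Otimes>\<^sub>M unif. g x = 0"
    by (simp add: integral_nonneg_eq_0_iff_AE)
  then show ?thesis by eventually_elim (simp add: g_def arctan_eq_iff)
qed

lemma countable_discont_quantile: "countable {v\<in>{0<..<1}. \<not> isCont quantile v}"
proof -
  have "mono_on {0<..<1} quantile"
    using mono_I by (auto simp: mono_on_def quantile_def)
  then show ?thesis by (intro mono_on_ctble_discont_open) auto
qed

end

lemma pair_unif_distr:
  assumes [measurable]: "f \<in> M \<rightarrow>\<^sub>M N"
  shows "distr (M \<Otimes>\<^sub>M unif) (N \<Otimes>\<^sub>M unif) (\<lambda>x. (f (fst x), snd x)) = distr M N f \<Otimes>\<^sub>M unif"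
  using pair_measure_distr[of f M N "\<lambda>u. u" unif unif] unif.sigma_finite_measure_axioms
  by (simp add: distr_id case_prod_beta')

text \<open>
  The points of a fibre of the code are almost surely indistinguishable from each other, so no
  Borel set can split the fibre.
\<close>

lemma nonatomic_fibre_null:
  fixes \<mu> :: "'a::topological_space measure" and \<theta> :: "'a \<Rightarrow> real"
  assumes \<mu>: "prob_space \<mu>" "sets \<mu> = sets borel" "nonatomic \<mu>"
    and \<theta>: "\<theta> \<in> borel_measurable \<mu>" and code: "AE x in \<mu>. indist (\<zeta> (\<theta> x)) x"
  shows "measure (distr \<mu> borel \<theta>) {z} = 0"
proof (rule ccontr)
  interpret prob_space \<mu> by fact
  assume ne: "measure (distr \<mu> borel \<theta>) {z} \<noteq> 0"
  define F where "F = \<theta> -` {z} \<inter> space \<mu>"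
  have F: "F \<in> sets \<mu>" unfolding F_def using \<theta> by measurable
  have "measure (distr \<mu> borel \<theta>) {z} = measure \<mu> F"
    unfolding F_def using \<theta> by (simp add: measure_distr)
  then have "0 < emeasure \<mu> F" using ne by (simp add: emeasure_eq_measure less_le)
  then obtain B where B: "B \<in> sets \<mu>" "B \<subseteq> F" "0 < emeasure \<mu> B" "emeasure \<mu> B < emeasure \<mu> F"
    using \<mu>(3) F unfolding nonatomic_def by blast
  have same: "AE x in \<mu>. x \<in> F \<longrightarrow> (x \<in> B \<longleftrightarrow> \<zeta> z \<in> B)"
    using code
  proof eventually_elim
    case (elim x)
    then show ?case using indist_borel[of "\<zeta> (\<theta> x)" x B] B(1) \<mu>(2) by (auto simp: F_def)
  qed
  show False
  proof (cases "\<zeta> z \<in> B")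
    case True
    have "emeasure \<mu> F \<le> emeasure \<mu> B"
      by (rule emeasure_mono_AE) (use same True B(1) in \<open>auto elim: eventually_mono\<close>)
    then show False using B(4) by simp
  next
    case False
    have "emeasure \<mu> B \<le> emeasure \<mu> {}"
      by (rule emeasure_mono_AE) (use same False B(2) in \<open>auto elim: eventually_mono\<close>)
    then show False using B(3) by simp
  qed
qed

text \<open>
  \<open>\<xi>\<close> represents \<open>\<mu>\<close> on the unit interval and is continuous on the set \<open>A\<close> of full measure;
  \<open>\<tau> x u\<close> is a uniformly distributed parameter of the point \<open>x\<close>, where the uniform number \<open>u\<close>
  resolves the ambiguity of the parameter at atoms.
\<close>

locale interval_param =
  fixes \<mu> :: "'a::topological_space measure" and A :: "real set"
    and \<xi> :: "real \<Rightarrow> 'a" and \<tau> :: "'a \<Rightarrow> real \<Rightarrow> real"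
  assumes prob: "prob_space \<mu>" and sets_eq: "sets \<mu> = sets borel"
    and domain: "A \<in> sets borel" "AE v in unif. v \<in> A"
    and continuous_param: "continuous_on A \<xi>"
    and measurable_param: "\<xi> \<in> borel \<rightarrow>\<^sub>M borel" and law_param: "distr unif borel \<xi> = \<mu>"
    and measurable_inverse: "(\<lambda>x. \<tau> (fst x) (snd x)) \<in> borel_measurable (\<mu> \<Otimes>\<^sub>M unif)"
    and law_inverse: "distr (\<mu> \<Otimes>\<^sub>M unif) borel (\<lambda>x. \<tau> (fst x) (snd x)) = unif"
    and param_inverse: "AE x in \<mu> \<Otimes>\<^sub>M unif. indist (\<xi> (\<tau> (fst x) (snd x))) (fst x)"

text \<open>
  The parameter of a point is the distributional transform of its code; the quantile function leads
  back to the code, and the decoder to the point.  The parametrization is continuous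
  wherever the quantile function is continuous and takes a decodable value; the quantile function,
  being monotone, has only countably many discontinuities.
\<close>

lemma interval_parametrization:
  fixes \<mu> :: "'a::topological_space measure"
  assumes reg: "regular_space (euclidean :: 'a topology)" and \<mu>: "prob_space \<mu>" "sets \<mu> = sets borel"
    and conc: "concentrated_on_metrizable_compacts \<mu>"
  obtains A \<xi> \<tau> where "interval_param \<mu> A \<xi> \<tau>" "nonatomic \<mu> \<longrightarrow> (\<forall>x u. \<tau> x u = \<tau> x 0)"
proof -
  interpret \<mu>: prob_space \<mu> by fact
  note [measurable_cong] = \<mu>(2)
  obtain \<theta> :: "'a \<Rightarrow> real" and Z \<zeta> where \<theta>[measurable]: "\<theta> \<in> borel_measurable borel" and Z[measurable]: "Z \<in> sets borel"
    and \<zeta>: "continuous_on Z \<zeta>" and code: "AE x in \<mu>. \<theta> x \<in> Z \<and> indist (\<zeta> (\<theta> x)) x"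
    using concentrated_code[OF reg \<mu>(2) conc] by blast
  have \<theta>\<mu>[measurable]: "\<theta> \<in> borel_measurable \<mu>" using \<theta> by measurable
  define M where "M = distr \<mu> borel \<theta>"
  interpret M: cdf_distribution M
    unfolding M_def cdf_distribution_def by (rule \<mu>.real_distribution_distr) simp
  interpret P: pair_prob_space \<mu> unif ..
  define \<tau> where "\<tau> x u = M.dtrans (\<theta> x) u" for x u
  define A where "A = {0<..<1} \<inter> (M.quantile -` Z) - {v\<in>{0<..<1}. \<not> isCont M.quantile v}"
  define \<xi> where "\<xi> v = (if v \<in> A then \<zeta> (M.quantile v) else undefined)" for v
  have A [measurable]: "A \<in> sets borel"
  proof -
    have "M.quantile -` Z \<inter> space borel \<in> sets borel" by measurable
    moreover have "{v\<in>{0<..<1}. \<not> isCont M.quantile v} \<in> sets borel"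
      by (rule sets.countable[OF _ M.countable_discont_quantile]) simp
    ultimately show ?thesis unfolding A_def by simp
  qed
  have "AE z in M. z \<in> Z"
    unfolding M_def using code by (subst AE_distr_iff) (auto elim: eventually_mono)
  then have "AE z in distr unif borel M.quantile. z \<in> Z"
    unfolding M.distr_quantile .
  then have "AE v in unif. M.quantile v \<in> Z"
    by (rule AE_distrD[rotated]) simp
  then have AE_A: "AE v in unif. v \<in> A"
    using AE_unif_Ioo AE_unif_countable[OF M.countable_discont_quantile]
    by eventually_elim (auto simp: A_def)
  have cont: "continuous_on A (\<lambda>v. \<zeta> (M.quantile v))"
    by (rule continuous_on_compose2[OF \<zeta>]) (auto simp: A_def intro!: continuous_at_imp_continuous_on)
  then have cont\<xi>: "continuous_on A \<xi>"
    by (rule continuous_on_eq) (simp add: \<xi>_def)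
  have \<xi>m [measurable]: "\<xi> \<in> borel \<rightarrow>\<^sub>M borel"
    unfolding \<xi>_def by (intro borel_measurable_continuous_on_if A cont continuous_on_const)
  have MU: "distr (\<mu> \<Otimes>\<^sub>M unif) (borel \<Otimes>\<^sub>M unif) (\<lambda>x. (\<theta> (fst x), snd x)) = M \<Otimes>\<^sub>M unif"
    unfolding M_def by (rule pair_unif_distr) simp
  have mD: "(\<lambda>x. M.dtrans (fst x) (snd x)) \<in> borel_measurable (borel \<Otimes>\<^sub>M unif)"
  proof -
    have "sets M = sets borel" by (simp add: M_def)
    from measurable_cong_sets[OF sets_pair_measure_cong[OF this refl] refl]
    show ?thesis using M.measurable_dtrans by blast
  qed
  have m\<Theta>: "(\<lambda>x. (\<theta> (fst x), snd x)) \<in> \<mu> \<Otimes>\<^sub>M unif \<rightarrow>\<^sub>M borel \<Otimes>\<^sub>M unif" by measurable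
  have \<tau>m [measurable]: "(\<lambda>x. \<tau> (fst x) (snd x)) \<in> borel_measurable (\<mu> \<Otimes>\<^sub>M unif)"
    using measurable_compose[OF m\<Theta> mD] by (simp add: \<tau>_def)
  have law: "distr (\<mu> \<Otimes>\<^sub>M unif) borel (\<lambda>x. \<tau> (fst x) (snd x)) = unif"
  proof -
    have "distr (distr (\<mu> \<Otimes>\<^sub>M unif) (borel \<Otimes>\<^sub>M unif) (\<lambda>x. (\<theta> (fst x), snd x))) borel (\<lambda>x. M.dtrans (fst x) (snd x))
      = distr (\<mu> \<Otimes>\<^sub>M unif) borel (\<lambda>x. \<tau> (fst x) (snd x))"
      unfolding \<tau>_def by (subst distr_distr[OF mD m\<Theta>]) (simp add: comp_def)
    then show ?thesis unfolding MU M.distr_dtrans by simp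
  qed
  have ind: "AE x in \<mu> \<Otimes>\<^sub>M unif. indist (\<xi> (\<tau> (fst x) (snd x))) (fst x)"
  proof -
    have "AE x in distr (\<mu> \<Otimes>\<^sub>M unif) (borel \<Otimes>\<^sub>M unif) (\<lambda>x. (\<theta> (fst x), snd x)). M.quantile (M.dtrans (fst x) (snd x)) = fst x"
      unfolding MU by (rule M.quantile_dtrans)
    then have 1: "AE x in \<mu> \<Otimes>\<^sub>M unif. M.quantile (\<tau> (fst x) (snd x)) = \<theta> (fst x)"
      using AE_distrD[OF m\<Theta>] unfolding \<tau>_def by fastforce
    have 2: "AE x in \<mu> \<Otimes>\<^sub>M unif. \<tau> (fst x) (snd x) \<in> A"
      using AE_distrD[OF \<tau>m, of "\<lambda>v. v \<in> A"] AE_A unfolding law by blast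
    have "AE x in distr (\<mu> \<Otimes>\<^sub>M unif) \<mu> fst. \<theta> x \<in> Z \<and> indist (\<zeta> (\<theta> x)) x"
      unfolding unif.distr_pair_fst by (rule code)
    then have 3: "AE x in \<mu> \<Otimes>\<^sub>M unif. \<theta> (fst x) \<in> Z \<and> indist (\<zeta> (\<theta> (fst x))) (fst x)"
      by (rule AE_distrD[rotated]) simp
    from 1 2 3 show ?thesis
      by eventually_elim (simp add: \<xi>_def)
  qed
  have \<xi>law: "distr unif borel \<xi> = \<mu>"
  proof (rule measure_eqI)
    fix S assume "S \<in> sets (distr unif borel \<xi>)"
    then have S [measurable]: "S \<in> sets borel" by simp
    have "emeasure (distr unif borel \<xi>) S = emeasure (distr (\<mu> \<Otimes>\<^sub>M unif) borel (\<lambda>x. \<tau> (fst x) (snd x))) (\<xi> -` S)"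
      unfolding law by (subst emeasure_distr) auto
    also have "\<dots> = emeasure (\<mu> \<Otimes>\<^sub>M unif) ((\<lambda>x. \<tau> (fst x) (snd x)) -` (\<xi> -` S) \<inter> space (\<mu> \<Otimes>\<^sub>M unif))"
      using measurable_sets[OF \<xi>m S] by (intro emeasure_distr) auto
    also have "\<dots> = emeasure (\<mu> \<Otimes>\<^sub>M unif) (fst -` S \<inter> space (\<mu> \<Otimes>\<^sub>M unif))"
    proof (rule emeasure_eq_AE)
      show "AE x in \<mu> \<Otimes>\<^sub>M unif. (x \<in> (\<lambda>x. \<tau> (fst x) (snd x)) -` (\<xi> -` S) \<inter> space (\<mu> \<Otimes>\<^sub>M unif)) = (x \<in> fst -` S \<inter> space (\<mu> \<Otimes>\<^sub>M unif))"
        using ind by eventually_elim (use indist_borel[OF _ S] in \<open>auto simp: space_pair_measure\<close>)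
      show "(\<lambda>x. \<tau> (fst x) (snd x)) -` (\<xi> -` S) \<inter> space (\<mu> \<Otimes>\<^sub>M unif) \<in> sets (\<mu> \<Otimes>\<^sub>M unif)"
        using measurable_sets[OF \<xi>m S] measurable_sets[OF \<tau>m] by simp
      show "fst -` S \<inter> space (\<mu> \<Otimes>\<^sub>M unif) \<in> sets (\<mu> \<Otimes>\<^sub>M unif)" by measurable
    qed
    also have "\<dots> = emeasure (distr (\<mu> \<Otimes>\<^sub>M unif) \<mu> fst) S"
      by (subst emeasure_distr) (auto simp: \<mu>(2))
    also have "\<dots> = emeasure \<mu> S" by (simp add: unif.distr_pair_fst)
    finally show "emeasure (distr unif borel \<xi>) S = emeasure \<mu> S" .
  qed (simp add: \<mu>(2))
  have "\<tau> x u = \<tau> x 0" if "nonatomic \<mu>" for x u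
  proof -
    have "measure M {\<theta> x} = 0"
      unfolding M_def by (rule nonatomic_fibre_null[OF \<mu> that \<theta>\<mu>]) (use code in \<open>auto elim: eventually_mono\<close>)
    then show ?thesis by (simp add: \<tau>_def M.dtrans_def)
  qed
  then have "nonatomic \<mu> \<longrightarrow> (\<forall>x u. \<tau> x u = \<tau> x 0)" by blast
  moreover have "interval_param \<mu> A \<xi> \<tau>"
    by (rule interval_param.intro[OF \<mu> A AE_A cont\<xi> \<xi>m \<xi>law \<tau>m law ind])
  ultimately show thesis using that by blast
qed

section \<open>Transport between the spaces and the interval\<close>

lemma le_truncation_plus_tails:
  fixes x y c R :: real
  assumes "c \<le> x + y" "0 \<le> c" "0 < R"
  shows "c \<le> min c (2 * R) + ((if R \<le> x then x else 0) + (if R \<le> y then y else 0))"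
  using assms by auto

lemma nn_integral_tail:
  assumes "integrable M f" "0 < R"
  shows "(\<integral>\<^sup>+x. ennreal (if R \<le> f x then f x else 0) \<partial>M) = ennreal (LINT x:{x. R \<le> f x}|M. f x)"
    and "0 \<le> (LINT x:{x. R \<le> f x}|M. f x)"
proof -
  have [measurable]: "f \<in> borel_measurable M" using assms by auto
  have eq: "(\<lambda>x. indicator {x. R \<le> f x} x *\<^sub>R f x) = (\<lambda>x. if R \<le> f x then f x else 0)"
    by (auto simp: indicator_def)
  have int: "integrable M (\<lambda>x. if R \<le> f x then f x else 0)"
    by (rule Bochner_Integration.integrable_bound[OF assms(1)]) auto
  show "(\<integral>\<^sup>+x. ennreal (if R \<le> f x then f x else 0) \<partial>M) = ennreal (LINT x:{x. R \<le> f x}|M. f x)"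
    unfolding set_lebesgue_integral_def eq
    by (rule nn_integral_eq_integral[OF int]) (use assms(2) in auto)
  show "0 \<le> (LINT x:{x. R \<le> f x}|M. f x)"
    unfolding set_lebesgue_integral_def eq by (rule integral_nonneg_AE) (use assms(2) in auto)
qed

text \<open>
  The source measure carries a uniform coordinate that does not use the random number, as is the
  case for measures without atoms.
\<close>

locale interval_problem =
  X: interval_param \<mu> A \<xi> \<sigma> + Y: interval_param \<nu> B \<psi> \<tau>
  for \<mu> :: "'a::topological_space measure" and A \<xi> \<sigma> and \<nu> :: "'b::topological_space measure" and B \<psi> \<tau> +
  fixes h :: "'a \<Rightarrow> 'b \<Rightarrow> 't::metric_space \<Rightarrow> real"
  assumes h_cont: "continuous_on UNIV (\<lambda>(x, y, t). h x y t)" and h_nonneg: "\<And>x y t. 0 \<le> h x y t"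
    and deterministic: "\<forall>x u. \<sigma> x u = \<sigma> x 0"
begin

definition coord :: "'a \<Rightarrow> real" where "coord x = \<sigma> x 0"

text \<open>
  Outside the rectangle on which both parametrizations are continuous the cost is set to 0, which
  keeps it Borel measurable on the square although the Borel sets of \<open>X \<times> Y\<close> need not be generated
  by rectangles.
\<close>

definition H :: "real \<Rightarrow> real \<Rightarrow> 't \<Rightarrow> real" where
  "H v w t = (if v \<in> A \<and> w \<in> B then h (\<xi> v) (\<psi> w) t else 0)"

lemma H_nonneg: "0 \<le> H v w t"
  using h_nonneg by (simp add: H_def)

lemma h_section: "continuous_on UNIV (\<lambda>z. h (fst z) (snd z) t)"
proof -
  have "continuous_on UNIV (\<lambda>z. (\<lambda>(x, y, t). h x y t) (fst z, snd z, t))"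
    by (rule continuous_on_compose2[OF h_cont]) (auto intro!: continuous_intros)
  then show ?thesis by simp
qed

lemma h_indist:
  assumes "indist x x'" "indist y y'"
  shows "h x y t = h x' y' t"
proof -
  have "continuous_on UNIV (\<lambda>x. h x y t)"
    using continuous_on_compose2[OF h_section[of t], of UNIV "\<lambda>x. (x, y)"] by (simp add: continuous_intros)
  then have "h x y t = h x' y t" by (rule indist_continuous_eq[OF assms(1)])
  moreover have "continuous_on UNIV (\<lambda>y. h x' y t)"
    using continuous_on_compose2[OF h_section[of t], of UNIV "\<lambda>y. (x', y)"] by (simp add: continuous_intros)
  then have "h x' y t = h x' y' t" by (rule indist_continuous_eq[OF assms(2)])
  ultimately show ?thesis by simp
qed

lemma continuous_H: "continuous_on (A \<times> B \<times> UNIV) (\<lambda>(v, w, t). H v w t)"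
proof -
  have "continuous_on (A \<times> B \<times> UNIV) (\<lambda>x. (\<lambda>(x, y, t). h x y t) (\<xi> (fst x), \<psi> (fst (snd x)), snd (snd x)))"
    by (rule continuous_on_compose2[OF h_cont])
       (auto intro!: continuous_intros continuous_on_compose2[OF X.continuous_param] continuous_on_compose2[OF Y.continuous_param])
  then show ?thesis
    by (rule continuous_on_eq) (auto simp: H_def)
qed

lemma measurable_coord [measurable]: "coord \<in> borel_measurable \<mu>"
  using measurable_compose[OF _ X.measurable_inverse, of "\<lambda>x. (x, 0)" \<mu>] by (simp add: coord_def[abs_def])

lemma coord_eq: "\<sigma> x u = coord x"
  using deterministic by (simp add: coord_def)

lemma law_coord: "distr \<mu> borel coord = unif"
proof -
  have "distr (distr (\<mu> \<Otimes>\<^sub>M unif) \<mu> fst) borel coord = distr (\<mu> \<Otimes>\<^sub>M unif) borel (\<lambda>x. \<sigma> (fst x) (snd x))"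
    by (subst distr_distr) (auto simp: comp_def coord_eq)
  then show ?thesis unfolding unif.distr_pair_fst X.law_inverse .
qed

lemma AE_coord: "AE x in \<mu>. coord x \<in> A \<and> indist (\<xi> (coord x)) x"
proof -
  interpret \<mu>: prob_space \<mu> by (rule X.prob)
  interpret P: pair_prob_space \<mu> unif ..
  have "AE x in \<mu>. AE u in unif. indist (\<xi> (coord x)) x"
    using P.AE_pair[OF X.param_inverse] by (simp add: coord_eq)
  moreover have "AE x in \<mu>. coord x \<in> A"
    using X.domain(2) AE_distrD[OF measurable_coord, of "\<lambda>v. v \<in> A"] unfolding law_coord by blast
  ultimately show ?thesis by (simp add: unif.AE_const)
qed

text \<open>
  Pass to the coordinates of both components, with an independent uniform number
  for the second one.  Almost surely the parametrizations lead back to indistinguishable points, at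
  which \<open>h\<close> has the same value.
\<close>

lemma lift_coupling:
  assumes \<pi>: "\<pi> \<in> couplings \<mu> \<nu>"
  shows "\<exists>\<gamma>\<in>couplings01. (\<integral>\<^sup>+z. ennreal (H (fst z) (snd z) t) \<partial>\<gamma>) = (\<integral>\<^sup>+z. ennreal (h (fst z) (snd z) t) \<partial>\<pi>)"
proof -
  have sets\<pi>: "sets \<pi> = sets borel" and "prob_space \<pi>" 
    and m1: "\<And>E. E \<in> sets borel \<Longrightarrow> emeasure \<pi> (E \<times> UNIV) = emeasure \<mu> E"
    and m2: "\<And>E. E \<in> sets borel \<Longrightarrow> emeasure \<pi> (UNIV \<times> E) = emeasure \<nu> E"
    using \<pi> by (auto simp: couplings_def)
  interpret \<pi>: prob_space \<pi> by fact
  note [measurable_cong] = sets\<pi>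
  have sp: "space \<pi> = UNIV" using sets_eq_imp_space_eq[OF sets\<pi>] by simp
  have fm [measurable]: "fst \<in> \<pi> \<rightarrow>\<^sub>M borel" "snd \<in> \<pi> \<rightarrow>\<^sub>M borel" by auto
  have fm' [measurable]: "fst \<in> \<pi> \<rightarrow>\<^sub>M \<mu>" "snd \<in> \<pi> \<rightarrow>\<^sub>M \<nu>"
    using fm measurable_cong_sets[OF refl X.sets_eq, of \<pi>] measurable_cong_sets[OF refl Y.sets_eq, of \<pi>] by auto
  have d1: "distr \<pi> \<mu> fst = \<mu>"
  proof (rule measure_eqI)
    fix E assume "E \<in> sets (distr \<pi> \<mu> fst)"
    then have E: "E \<in> sets borel" by (simp add: X.sets_eq)
    have "fst -` E = E \<times> (UNIV :: 'b set)" by auto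
    then show "emeasure (distr \<pi> \<mu> fst) E = emeasure \<mu> E"
      using m1[OF E] E by (subst emeasure_distr) (auto simp: X.sets_eq sp)
  qed simp
  have d2: "distr \<pi> \<nu> snd = \<nu>"
  proof (rule measure_eqI)
    fix E assume "E \<in> sets (distr \<pi> \<nu> snd)"
    then have E: "E \<in> sets borel" by (simp add: Y.sets_eq)
    have "snd -` E = (UNIV :: 'a set) \<times> E" by auto
    then show "emeasure (distr \<pi> \<nu> snd) E = emeasure \<nu> E"
      using m2[OF E] E by (subst emeasure_distr) (auto simp: Y.sets_eq sp)
  qed simp
  have SU: "distr (\<pi> \<Otimes>\<^sub>M unif) (\<nu> \<Otimes>\<^sub>M unif) (\<lambda>x. (snd (fst x), snd x)) = \<nu> \<Otimes>\<^sub>M unif"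
    using pair_unif_distr[OF fm'(2)] by (simp add: d2)
  have FU: "distr (\<pi> \<Otimes>\<^sub>M unif) \<pi> fst = \<pi>" by (rule unif.distr_pair_fst)
  have mS: "(\<lambda>x. (snd (fst x), snd x)) \<in> \<pi> \<Otimes>\<^sub>M unif \<rightarrow>\<^sub>M \<nu> \<Otimes>\<^sub>M unif" by measurable
  define p where "p x = coord (fst (fst x))" for x :: "('a \<times> 'b) \<times> real"
  define q where "q x = \<tau> (snd (fst x)) (snd x)" for x :: "('a \<times> 'b) \<times> real"
  have pm [measurable]: "p \<in> borel_measurable (\<pi> \<Otimes>\<^sub>M unif)"
    unfolding p_def by measurable
  have qm [measurable]: "q \<in> borel_measurable (\<pi> \<Otimes>\<^sub>M unif)"
    unfolding q_def using measurable_compose[OF mS Y.measurable_inverse] by simp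
  define \<gamma> where "\<gamma> = distr (\<pi> \<Otimes>\<^sub>M unif) borel (\<lambda>x. (p x, q x))"
  have plaw: "distr (\<pi> \<Otimes>\<^sub>M unif) borel p = unif"
  proof -
    have "distr (distr (distr (\<pi> \<Otimes>\<^sub>M unif) \<pi> fst) \<mu> fst) borel coord = distr (\<pi> \<Otimes>\<^sub>M unif) borel p"
      by (subst distr_distr, simp, simp, subst distr_distr, simp, simp) (simp add: comp_def p_def[abs_def])
    then show ?thesis unfolding FU d1 law_coord by simp
  qed
  have qlaw: "distr (\<pi> \<Otimes>\<^sub>M unif) borel q = unif"
  proof -
    have "distr (distr (\<pi> \<Otimes>\<^sub>M unif) (\<nu> \<Otimes>\<^sub>M unif) (\<lambda>x. (snd (fst x), snd x))) borel (\<lambda>x. \<tau> (fst x) (snd x)) = distr (\<pi> \<Otimes>\<^sub>M unif) borel q"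
      by (subst distr_distr[OF Y.measurable_inverse mS]) (simp add: comp_def q_def[abs_def])
    then show ?thesis unfolding SU Y.law_inverse by simp
  qed
  have pq: "(\<lambda>x. (p x, q x)) \<in> \<pi> \<Otimes>\<^sub>M unif \<rightarrow>\<^sub>M borel" by measurable
  have \<gamma>: "\<gamma> \<in> couplings01"
    unfolding couplings01_def \<gamma>_def
    by (auto simp: distr_distr[OF borel_fst pq] distr_distr[OF borel_snd pq] comp_def plaw qlaw)
  have pind: "AE x in \<pi> \<Otimes>\<^sub>M unif. p x \<in> A \<and> indist (\<xi> (p x)) (fst (fst x))"
  proof -
    have "AE x in distr (distr (\<pi> \<Otimes>\<^sub>M unif) \<pi> fst) \<mu> fst. coord x \<in> A \<and> indist (\<xi> (coord x)) x"
      unfolding FU d1 by (rule AE_coord)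
    then have "AE z in distr (\<pi> \<Otimes>\<^sub>M unif) \<pi> fst. coord (fst z) \<in> A \<and> indist (\<xi> (coord (fst z))) (fst z)"
      by (rule AE_distrD[rotated]) simp
    then show ?thesis
      unfolding p_def by (rule AE_distrD[rotated]) simp
  qed
  have "AE v in distr (\<pi> \<Otimes>\<^sub>M unif) borel q. v \<in> B" unfolding qlaw by (rule Y.domain(2))
  then have qB: "AE x in \<pi> \<Otimes>\<^sub>M unif. q x \<in> B" by (rule AE_distrD[OF qm])
  have "AE x in distr (\<pi> \<Otimes>\<^sub>M unif) (\<nu> \<Otimes>\<^sub>M unif) (\<lambda>x. (snd (fst x), snd x)). indist (\<psi> (\<tau> (fst x) (snd x))) (fst x)"
    unfolding SU by (rule Y.param_inverse)
  then have qind: "AE x in \<pi> \<Otimes>\<^sub>M unif. indist (\<psi> (q x)) (snd (fst x))"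
    unfolding q_def using AE_distrD[OF mS] by fastforce
  have Hm: "(\<lambda>z. H (fst z) (snd z) t) \<in> borel_measurable borel"
    by (rule measurable_section[OF continuous_H X.domain(1) Y.domain(1)]) (auto simp: H_def)
  have "(\<integral>\<^sup>+z. ennreal (H (fst z) (snd z) t) \<partial>\<gamma>) = (\<integral>\<^sup>+x. ennreal (H (p x) (q x) t) \<partial>(\<pi> \<Otimes>\<^sub>M unif))"
    unfolding \<gamma>_def using Hm by (subst nn_integral_distr[OF pq]) auto
  also have "\<dots> = (\<integral>\<^sup>+x. ennreal (h (fst (fst x)) (snd (fst x)) t) \<partial>(\<pi> \<Otimes>\<^sub>M unif))"
  proof (rule nn_integral_cong_AE)
    show "AE x in \<pi> \<Otimes>\<^sub>M unif. ennreal (H (p x) (q x) t) = ennreal (h (fst (fst x)) (snd (fst x)) t)"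
      using pind qB qind
    proof eventually_elim
      case (elim x)
      then show ?case using h_indist[of "\<xi> (p x)" "fst (fst x)" "\<psi> (q x)" "snd (fst x)" t] by (simp add: H_def)
    qed
  qed
  also have "\<dots> = (\<integral>\<^sup>+z. ennreal (h (fst z) (snd z) t) \<partial>distr (\<pi> \<Otimes>\<^sub>M unif) \<pi> fst)"
    using borel_measurable_continuous_onI[OF h_section[of t]] by (subst nn_integral_distr) auto
  also have "\<dots> = (\<integral>\<^sup>+z. ennreal (h (fst z) (snd z) t) \<partial>\<pi>)" unfolding FU ..
  finally show ?thesis using \<gamma> by blast
qed

text \<open>
  The excess of \<open>h\<close> over \<open>2 R\<close> is bounded by the parts of \<open>a t\<close> and \<open>b t\<close> above \<open>R\<close>, whose
  integrals depend only on the marginals.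
\<close>

lemma uniform_truncation:
  fixes a :: "'t \<Rightarrow> 'a \<Rightarrow> real" and b :: "'t \<Rightarrow> 'b \<Rightarrow> real"
  assumes a_int: "\<And>t. integrable \<mu> (a t)" and b_int: "\<And>t. integrable \<nu> (b t)"
    and h_le: "\<And>x y t. h x y t \<le> a t x + b t y"
    and ui: "((\<lambda>R. SUP t. ereal ((LINT x:{x. a t x \<ge> R}|\<mu>. a t x) + (LINT y:{y. b t y \<ge> R}|\<nu>. b t y)))
            \<longlongrightarrow> 0) at_top"
    and "e > 0"
  shows "\<exists>C\<ge>0. \<forall>t. \<forall>\<gamma>\<in>couplings01. (\<integral>\<^sup>+z. ennreal (H (fst z) (snd z) t) \<partial>\<gamma>)
     \<le> (\<integral>\<^sup>+z. ennreal (min (H (fst z) (snd z) t) C) \<partial>\<gamma>) + ennreal e"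
proof -
  note [measurable] = X.measurable_param Y.measurable_param
  define f where "f R t = (LINT x:{x. a t x \<ge> R}|\<mu>. a t x) + (LINT y:{y. b t y \<ge> R}|\<nu>. b t y)" for R t
  have "\<forall>\<^sub>F R in at_top. (SUP t. ereal (f R t)) < ereal e"
    using order_tendstoD(2)[OF ui, of "ereal e"] \<open>e > 0\<close> by (simp add: f_def)
  then have "\<forall>\<^sub>F R in at_top. (SUP t. ereal (f R t)) < ereal e \<and> 0 < R"
    using eventually_gt_at_top[of "0::real"] by eventually_elim simp
  then obtain R where R: "(SUP t. ereal (f R t)) < ereal e" "0 < R"
    by (auto dest: eventually_happens)
  have fe: "f R t \<le> e" for t
  proof -
    have "ereal (f R t) \<le> (SUP t. ereal (f R t))" by (rule SUP_upper) simp
    with R(1) have "ereal (f R t) < ereal e" by (rule le_less_trans[rotated])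
    then show ?thesis by simp
  qed
  show "\<exists>C\<ge>0. \<forall>t. \<forall>\<gamma>\<in>couplings01. (\<integral>\<^sup>+z. ennreal (H (fst z) (snd z) t) \<partial>\<gamma>)
        \<le> (\<integral>\<^sup>+z. ennreal (min (H (fst z) (snd z) t) C) \<partial>\<gamma>) + ennreal e"
  proof (intro exI[of _ "2 * R"] conjI allI ballI)
    fix t :: 't and \<gamma> assume \<gamma>: "\<gamma> \<in> couplings01"
    note [measurable_cong] = couplings01_sets[OF \<gamma>]
    define a1 where "a1 x = ennreal (if R \<le> a t x then a t x else 0)" for x
    define b1 where "b1 y = ennreal (if R \<le> b t y then b t y else 0)" for y
    have am: "a t \<in> borel_measurable borel" "b t \<in> borel_measurable borel"
      using borel_measurable_integrable[OF a_int[of t]] borel_measurable_integrable[OF b_int[of t]]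
        measurable_cong_sets[OF X.sets_eq refl] measurable_cong_sets[OF Y.sets_eq refl] by auto
    have [measurable]: "a1 \<in> borel_measurable borel" "b1 \<in> borel_measurable borel"
      unfolding a1_def b1_def using am by measurable
    have Hm: "(\<lambda>z. H (fst z) (snd z) t) \<in> borel_measurable borel"
      by (rule measurable_section[OF continuous_H X.domain(1) Y.domain(1)]) (auto simp: H_def)
    note [measurable] = Hm
    have "(\<integral>\<^sup>+z. ennreal (H (fst z) (snd z) t) \<partial>\<gamma>)
       \<le> (\<integral>\<^sup>+z. ennreal (min (H (fst z) (snd z) t) (2 * R)) + (a1 (\<xi> (fst z)) + b1 (\<psi> (snd z))) \<partial>\<gamma>)"
    proof (rule nn_integral_mono)
      fix z
      have "H (fst z) (snd z) t \<le> min (H (fst z) (snd z) t) (2 * R)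
          + ((if R \<le> a t (\<xi> (fst z)) then a t (\<xi> (fst z)) else 0) + (if R \<le> b t (\<psi> (snd z)) then b t (\<psi> (snd z)) else 0))"
        using le_truncation_plus_tails[OF h_le h_nonneg R(2), of "\<xi> (fst z)" "\<psi> (snd z)" t] R(2) by (auto simp: H_def)
      then have "ennreal (H (fst z) (snd z) t) \<le> ennreal (min (H (fst z) (snd z) t) (2 * R)
          + ((if R \<le> a t (\<xi> (fst z)) then a t (\<xi> (fst z)) else 0) + (if R \<le> b t (\<psi> (snd z)) then b t (\<psi> (snd z)) else 0)))"
        by (rule ennreal_leI)
      also have "\<dots> = ennreal (min (H (fst z) (snd z) t) (2 * R)) + (a1 (\<xi> (fst z)) + b1 (\<psi> (snd z)))"
        unfolding a1_def b1_def using R(2) h_nonneg by (subst ennreal_plus; (subst ennreal_plus)?; auto simp: H_def)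
      finally show "ennreal (H (fst z) (snd z) t)
          \<le> ennreal (min (H (fst z) (snd z) t) (2 * R)) + (a1 (\<xi> (fst z)) + b1 (\<psi> (snd z)))" .
    qed
    also have "\<dots> = (\<integral>\<^sup>+z. ennreal (min (H (fst z) (snd z) t) (2 * R)) \<partial>\<gamma>)
        + ((\<integral>\<^sup>+z. a1 (\<xi> (fst z)) \<partial>\<gamma>) + (\<integral>\<^sup>+z. b1 (\<psi> (snd z)) \<partial>\<gamma>))"
      by (simp add: nn_integral_add)
    also have "(\<integral>\<^sup>+z. a1 (\<xi> (fst z)) \<partial>\<gamma>) = (\<integral>\<^sup>+x. a1 x \<partial>distr unif borel \<xi>)"
      using couplings01_fst[OF \<gamma>, of "\<lambda>v. a1 (\<xi> v)"] by (simp add: nn_integral_distr)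
    also have "\<dots> = ennreal (LINT x:{x. a t x \<ge> R}|\<mu>. a t x)"
      unfolding X.law_param a1_def by (rule nn_integral_tail(1)[OF a_int R(2)])
    also have "(\<integral>\<^sup>+z. b1 (\<psi> (snd z)) \<partial>\<gamma>) = (\<integral>\<^sup>+x. b1 x \<partial>distr unif borel \<psi>)"
      using couplings01_snd[OF \<gamma>, of "\<lambda>v. b1 (\<psi> v)"] by (simp add: nn_integral_distr)
    also have "\<dots> = ennreal (LINT y:{y. b t y \<ge> R}|\<nu>. b t y)"
      unfolding Y.law_param b1_def by (rule nn_integral_tail(1)[OF b_int R(2)])
    also have "ennreal (LINT x:{x. a t x \<ge> R}|\<mu>. a t x) + ennreal (LINT y:{y. b t y \<ge> R}|\<nu>. b t y) = ennreal (f R t)"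
      unfolding f_def by (intro ennreal_plus[symmetric] nn_integral_tail(2) a_int b_int R(2))
    also have "(\<integral>\<^sup>+z. ennreal (min (H (fst z) (snd z) t) (2 * R)) \<partial>\<gamma>) + ennreal (f R t)
        \<le> (\<integral>\<^sup>+z. ennreal (min (H (fst z) (snd z) t) (2 * R)) \<partial>\<gamma>) + ennreal e"
      by (intro add_left_mono ennreal_leI fe)
    finally show "(\<integral>\<^sup>+z. ennreal (H (fst z) (snd z) t) \<partial>\<gamma>)
        \<le> (\<integral>\<^sup>+z. ennreal (min (H (fst z) (snd z) t) (2 * R)) \<partial>\<gamma>) + ennreal e" .
  qed (use R in simp)
qed

end

theorem theorem2p2:
  fixes \<mu> :: "'a::topological_space measure"
    and \<nu> :: "'b::topological_space measure"
    and h :: "'a \<Rightarrow> 'b \<Rightarrow> 't::metric_space \<Rightarrow> real"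
    and a :: "'t \<Rightarrow> 'a \<Rightarrow> real"
    and b :: "'t \<Rightarrow> 'b \<Rightarrow> real"
    and \<epsilon> :: real
  assumes "completely_regular_space (euclidean :: 'a topology)"
    and "completely_regular_space (euclidean :: 'b topology)"
    and "prob_space \<mu>" and "radon_measure \<mu>" and "nonatomic \<mu>"
    and "prob_space \<nu>" and "radon_measure \<nu>"
    and "concentrated_on_metrizable_compacts \<mu>"
    and "concentrated_on_metrizable_compacts \<nu>"
    and "continuous_on UNIV (\<lambda>(x, y, t). h x y t)"
    and "\<And>x y t. 0 \<le> h x y t"
    and "\<And>t. integrable \<mu> (a t)"
    and "\<And>t. integrable \<nu> (b t)"
    and "\<And>x y t. h x y t \<le> a t x + b t y"
    and "((\<lambda>R. SUP t. ereal ((LINT x:{x. a t x \<ge> R}|\<mu>. a t x) + (LINT y:{y. b t y \<ge> R}|\<nu>. b t y)))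
            \<longlongrightarrow> 0) at_top"
    and "\<epsilon> > 0"
  shows "\<exists>S :: 't \<Rightarrow> 'a \<Rightarrow> 'b.
           (\<forall>t. eps_optimal_monge \<epsilon> (\<lambda>x y. h x y t) \<mu> \<nu> (S t)) \<and>
           (\<forall>t s. s \<longlonglongrightarrow> t \<longrightarrow> (AE x in \<mu>. (\<lambda>n. S (s n) x) \<longlonglongrightarrow> S t x))"
proof -
  have sets: "sets \<mu> = sets borel" "sets \<nu> = sets borel"
    using assms(4,7) by (auto simp: radon_measure_def)
  obtain A \<xi> \<sigma> where X: "interval_param \<mu> A \<xi> \<sigma>" "nonatomic \<mu> \<longrightarrow> (\<forall>x u. \<sigma> x u = \<sigma> x 0)"
    by (rule interval_parametrization[OF completely_regular_imp_regular_space[OF assms(1)] assms(3) sets(1) assms(8)])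
  obtain B \<psi> \<tau> where Y: "interval_param \<nu> B \<psi> \<tau>"
    by (rule interval_parametrization[OF completely_regular_imp_regular_space[OF assms(2)] assms(6) sets(2) assms(9)])
  interpret interval_problem \<mu> A \<xi> \<sigma> \<nu> B \<psi> \<tau> h
    using X assms(5,10,11) Y by (intro interval_problem.intro interval_problem_axioms.intro) auto
  note [measurable_cong] = sets
  note [measurable] = Y.measurable_param
  interpret kernel_family H A B
  proof
    show "\<exists>C\<ge>0. \<forall>t. \<forall>\<gamma>\<in>couplings01. (\<integral>\<^sup>+z. ennreal (H (fst z) (snd z) t) \<partial>\<gamma>)
     \<le> (\<integral>\<^sup>+z. ennreal (min (H (fst z) (snd z) t) C) \<partial>\<gamma>) + ennreal e" if "e > 0" for e
      by (rule uniform_truncation[OF assms(12-15) that])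
  qed (use X.domain Y.domain continuous_H H_nonneg in \<open>auto simp: H_def\<close>)
  obtain r :: "'t \<Rightarrow> real \<Rightarrow> real" where r: "\<And>t. r t \<in> borel_measurable borel" "\<And>t. distr unif borel (r t) = unif"
      "\<And>t \<gamma>. \<gamma> \<in> couplings01 \<Longrightarrow> (\<integral>\<^sup>+v. ennreal (H v (r t v) t) \<partial>unif) \<le> cost t \<gamma> + ennreal \<epsilon>"
    and r_cont: "\<And>t s. s \<longlonglongrightarrow> t \<Longrightarrow> AE v in unif. (\<lambda>n. r (s n) v) \<longlonglongrightarrow> r t v"
    using continuous_monge_selection[OF assms(16)] by blast
  note [measurable] = r(1)
  define S where "S t x = \<psi> (r t (coord x))" for t x
  have rB: "AE x in \<mu>. r t (coord x) \<in> B" for t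
  proof -
    have "AE v in distr unif borel (r t). v \<in> B" unfolding r(2) by (rule Y.domain(2))
    then have "AE v in distr \<mu> borel coord. r t v \<in> B"
      unfolding law_coord by (rule AE_distrD[rotated]) simp
    then show ?thesis by (rule AE_distrD[rotated]) simp
  qed
  have lift: "\<exists>\<gamma>\<in>couplings01. cost t \<gamma> = (\<integral>\<^sup>+z. ennreal (h (fst z) (snd z) t) \<partial>\<pi>)"
    if "\<pi> \<in> couplings \<mu> \<nu>" for \<pi> t
    unfolding cost_def by (rule lift_coupling[OF that])
  have "eps_optimal_monge \<epsilon> (\<lambda>x y. h x y t) \<mu> \<nu> (S t)" for t
    unfolding eps_optimal_monge_def
  proof (intro conjI)
    have Sm: "S t \<in> \<mu> \<rightarrow>\<^sub>M borel" unfolding S_def by measurable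
    then show "S t \<in> borel \<rightarrow>\<^sub>M borel" using measurable_cong_sets[OF X.sets_eq refl] by blast
    have "distr (distr (distr \<mu> borel coord) borel (r t)) borel \<psi> = distr \<mu> borel (S t)"
      by (subst distr_distr, simp, simp, subst distr_distr, simp, simp) (simp add: comp_def S_def[abs_def])
    then show "distr \<mu> borel (S t) = \<nu>" unfolding law_coord r(2) Y.law_param by simp
    have Hm: "(\<lambda>v. ennreal (H v (r t v) t)) \<in> borel_measurable borel"
    proof -
      have "(\<lambda>v. (v, r t v)) \<in> borel \<rightarrow>\<^sub>M borel" by measurable
      from measurable_compose[OF this measurable_H[of t]] show ?thesis by simp
    qed
    have "(\<integral>\<^sup>+x. ennreal (h x (S t x) t) \<partial>\<mu>) = (\<integral>\<^sup>+x. ennreal (H (coord x) (r t (coord x)) t) \<partial>\<mu>)"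
    proof (rule nn_integral_cong_AE)
      show "AE x in \<mu>. ennreal (h x (S t x) t) = ennreal (H (coord x) (r t (coord x)) t)"
        using AE_coord rB[of t]
      proof eventually_elim
        case (elim x)
        then show ?case
          using h_indist[OF conjunct2[OF elim(1)], of "S t x" "S t x" t] by (simp add: H_def S_def indist_def)
      qed
    qed
    also have "\<dots> = (\<integral>\<^sup>+v. ennreal (H v (r t v) t) \<partial>distr \<mu> borel coord)"
      using Hm by (subst nn_integral_distr) auto
    finally have cost_S: "(\<integral>\<^sup>+x. ennreal (h x (S t x) t) \<partial>\<mu>) = (\<integral>\<^sup>+v. ennreal (H v (r t v) t) \<partial>unif)"
      unfolding law_coord .
    have "(\<integral>\<^sup>+x. ennreal (h x (S t x) t) \<partial>\<mu>) - ennreal \<epsilon> \<le> kantorovich_cost (\<lambda>x y. h x y t) \<mu> \<nu>"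
      unfolding kantorovich_cost_def
    proof (rule INF_greatest)
      fix \<sigma> assume "\<sigma> \<in> couplings \<mu> \<nu>"
      then obtain \<gamma> where \<gamma>: "\<gamma> \<in> couplings01" "cost t \<gamma> = (\<integral>\<^sup>+z. ennreal (h (fst z) (snd z) t) \<partial>\<sigma>)"
        using lift by blast
      then show "(\<integral>\<^sup>+x. ennreal (h x (S t x) t) \<partial>\<mu>) - ennreal \<epsilon> \<le> (\<integral>\<^sup>+z. ennreal (h (fst z) (snd z) t) \<partial>\<sigma>)"
        using r(3)[OF \<gamma>(1), of t] unfolding cost_S by (simp add: ennreal_minus_le_iff add.commute)
    qed
    then show "(\<integral>\<^sup>+x. ennreal (h x (S t x) t) \<partial>\<mu>) \<le> kantorovich_cost (\<lambda>x y. h x y t) \<mu> \<nu> + ennreal \<epsilon>"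
      by (simp add: ennreal_minus_le_iff add.commute)
  qed
  moreover have "AE x in \<mu>. (\<lambda>n. S (s n) x) \<longlonglongrightarrow> S t x" if s: "s \<longlonglongrightarrow> t" for t s
  proof -
    have "AE v in distr \<mu> borel coord. (\<lambda>n. r (s n) v) \<longlonglongrightarrow> r t v"
      unfolding law_coord by (rule r_cont[OF s])
    then have "AE x in \<mu>. (\<lambda>n. r (s n) (coord x)) \<longlonglongrightarrow> r t (coord x)"
      by (rule AE_distrD[rotated]) simp
    moreover have "AE x in \<mu>. \<forall>n. r (s n) (coord x) \<in> B"
      using rB by (simp add: AE_all_countable)
    ultimately show ?thesis
      using rB[of t]
    proof eventually_elim
      case (elim x)
      then show ?case
        unfolding S_def using Y.continuous_param by (auto simp: continuous_on_sequentially comp_def)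
    qed
  qed
  ultimately show ?thesis by blast
qed

end
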